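(* Let $\mathbf X$ be a $j$-layer ecpx on a closed connected smooth triangulable manifold $M^n$. Then the holonomy $\mathrm{Hol}_{\|\mathbf X\|^{(1)}}:\pi_1(\|\mathbf X\|^{(1)})\to S_{n+j}$ extends uniquely to a homomorphism $\mathrm{Hol}_{\mathbf X}:\pi_1(M)\to S_{n+j}$, i.e. there is a unique homomorphism $\mathrm{Hol}_{\mathbf X}:\pi_1(M)\to S_{n+j}$ whose composition with the map $\pi_1(\|\mathbf X\|^{(1)})\to\pi_1(M)$ induced by inclusion is the given holonomy.
   Context: A cpx $X$ on a closed connected smooth triangulable manifold $M^n$ (without boundary) is a cell complex structure on $M$ with embedded cells that is dual to a simplicial triangulation of $M$. It has regular degree: for $1\le k\le n$, exactly $n-k+2$ $k$-cells meet at each $(k-1)$-cell. $n$-cells are called regions and $X^{\langle n\rangle}$ is the set of regions. A $j$-layer cpx on $M$ is a family $\mathbf X=(X_1,\dots,X_j)$ of setwise transverse cpx on $M$ such that, with $\mathbf X^{\langle n\rangle}=\bigcup_{i\le j}X_i^{\langle n\rangle}$, for every $Q\subset\mathbf X^{\langle n\rangle}$ with $\bigcap Q\neq\emptyset$ one has $\bigcap Q\cong B^i$ (an $i$-ball) for some $i\le n$. $\|\mathbf X\|$ is the CW-complex on $M$ whose cells are the nonempty intersections $\bigcap R$ with $R\subset\mathbf X^{\langle n\rangle}$ containing at least one region from each layer. $\mathbf X$ is a $j$-layer ecpx if all $2$-cells of $\|\mathbf X\|$ are even sided. Holonomy on the $1$-skeleton: each vertex of $\|\mathbf X\|$ is the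 intersection of $n+j$ regions of $\mathbf X$ and each edge of $\|\mathbf X\|$ the intersection of $n+j-1$ regions. Fix a base vertex and a coloring of the $n+j$ regions there by the $n+j$ distinct colors $1,\dots,n+j$. Along each edge the $n+j-1$ regions containing it keep their colors, and the one new region at the end vertex is assigned the unused color. Closed edge paths give permutations in $S_{n+j}$, defining $\mathrm{Hol}_{\|\mathbf X\|^{(1)}}:\pi_1(\|\mathbf X\|^{(1)})\to S_{n+j}$. *)

theory Defs
  imports "HOL-Analysis.Analysis" "HOL-Algebra.Sym_Groups"
begin

section \<open>Smooth closed manifolds\<close>

text \<open>\<open>\<real>\<^sup>n\<close> is the library's \<open>Euclidean_space n\<close>, whose points are the functions
  \<open>nat \<Rightarrow> real\<close> vanishing from \<open>n\<close> on.\<close>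

primrec Ck_on :: "nat \<Rightarrow> (nat \<Rightarrow> real) set \<Rightarrow> nat \<Rightarrow> ((nat \<Rightarrow> real) \<Rightarrow> real) \<Rightarrow> bool" where
  "Ck_on n V 0 f \<longleftrightarrow> continuous_map (subtopology (Euclidean_space n) V) euclideanreal f"
| "Ck_on n V (Suc k) f \<longleftrightarrow>
     continuous_map (subtopology (Euclidean_space n) V) euclideanreal f \<and>
     (\<forall>i<n. \<exists>g. (\<forall>x\<in>V. ((\<lambda>t. f (x(i := t))) has_real_derivative g x) (at (x i))) \<and> Ck_on n V k g)"

definition smooth_on :: "nat \<Rightarrow> (nat \<Rightarrow> real) set \<Rightarrow> ((nat \<Rightarrow> real) \<Rightarrow> nat \<Rightarrow> real) \<Rightarrow> bool" where
  "smooth_on n V f \<longleftrightarrow> (\<forall>i<n. \<forall>k. Ck_on n V k (\<lambda>x. f x i))"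

definition chart_on :: "nat \<Rightarrow> 'a::topological_space set \<Rightarrow> 'a set \<Rightarrow> ('a \<Rightarrow> nat \<Rightarrow> real) \<Rightarrow> bool" where
  "chart_on n M U \<phi> \<longleftrightarrow>
     openin (top_of_set M) U \<and> openin (Euclidean_space n) (\<phi> ` U) \<and>
     homeomorphic_map (top_of_set U) (subtopology (Euclidean_space n) (\<phi> ` U)) \<phi>"

definition smooth_atlas ::
  "nat \<Rightarrow> 'a::topological_space set \<Rightarrow> ('a set \<times> ('a \<Rightarrow> nat \<Rightarrow> real)) set \<Rightarrow> bool" where
  "smooth_atlas n M A \<longleftrightarrow>
     (\<forall>(U, \<phi>)\<in>A. chart_on n M U \<phi>) \<and> (\<Union>(U, \<phi>)\<in>A. U) = M \<and>
     (\<forall>(U, \<phi>)\<in>A. \<forall>(U', \<phi>')\<in>A. smooth_on n (\<phi> ` (U \<inter> U')) (\<phi>' \<circ> inv_into U \<phi>))"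

text \<open>Being Hausdorff is part of the type class; second countability follows from compactness.\<close>

definition closed_smooth_manifold ::
  "nat \<Rightarrow> 'a::t2_space set \<Rightarrow> ('a set \<times> ('a \<Rightarrow> nat \<Rightarrow> real)) set \<Rightarrow> bool" where
  "closed_smooth_manifold n M A \<longleftrightarrow> compact M \<and> smooth_atlas n M A"


section \<open>Simplicial triangulations and their dual blocks\<close>

text \<open>A triangulation of a compact space has finitely many simplices, so its vertices may be
  taken to be natural numbers; the dimension of the ambient Euclidean space then need not be
  fixed by a type.\<close>

definition abstract_complex :: "nat set set \<Rightarrow> bool" where
  "abstract_complex K \<longleftrightarrow>
     finite K \<and> (\<forall>\<sigma>\<in>K. finite \<sigma> \<and> \<sigma> \<noteq> {}) \<and> (\<forall>\<sigma>\<in>K. \<forall>\<tau>\<subseteq>\<sigma>. \<tau> \<noteq> {} \<longrightarrow> \<tau> \<in> K)"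

definition realization :: "nat set set \<Rightarrow> (nat \<Rightarrow> real) set" where
  "realization K = {f. (\<forall>v. 0 \<le> f v) \<and> {v. f v \<noteq> 0} \<in> K \<and> (\<Sum>v | f v \<noteq> 0. f v) = 1}"

definition triangulation_of ::
  "nat set set \<Rightarrow> ((nat \<Rightarrow> real) \<Rightarrow> 'a::topological_space) \<Rightarrow> 'a set \<Rightarrow> bool" where
  "triangulation_of K h M \<longleftrightarrow> abstract_complex K \<and> (\<exists>g. homeomorphism (realization K) M h g)"

definition triangulable :: "'a::topological_space set \<Rightarrow> bool" where
  "triangulable M \<longleftrightarrow> (\<exists>K h. triangulation_of K h M)"

text \<open>The dual block of a simplex \<open>\<sigma>\<close> is the union of the simplices of the barycentric subdivision
  spanned by barycentres of chains \<open>\<sigma> \<subseteq> \<tau>\<^sub>0 \<subset> \<dots> \<subset> \<tau>\<^sub>p\<close>. In barycentric coordinates these are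
  the points all of whose \<open>\<sigma>\<close>-coordinates are maximal.\<close>

definition dual_block :: "nat set set \<Rightarrow> nat set \<Rightarrow> (nat \<Rightarrow> real) set" where
  "dual_block K \<sigma> = {f \<in> realization K. \<forall>v\<in>\<sigma>. \<forall>w. f w \<le> f v}"


section \<open>Cell complexes\<close>

definition std_ball :: "nat \<Rightarrow> (nat \<Rightarrow> real) set" where
  "std_ball k = {x \<in> topspace (Euclidean_space k). (\<Sum>i<k. (x i)\<^sup>2) \<le> 1}"

definition std_sphere :: "nat \<Rightarrow> (nat \<Rightarrow> real) set" where
  "std_sphere k = {x \<in> topspace (Euclidean_space k). (\<Sum>i<k. (x i)\<^sup>2) = 1}"

definition is_ball :: "nat \<Rightarrow> 'a::topological_space set \<Rightarrow> bool" where
  "is_ball k c \<longleftrightarrow> c homeomorphic std_ball k"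

text \<open>A complex is given by its closed cells, and \<open>cells_of_dim k X\<close> consists of its \<open>k\<close>-cells.\<close>

definition cells_of_dim :: "nat \<Rightarrow> 'a::topological_space set set \<Rightarrow> 'a set set" where
  "cells_of_dim k X = {c \<in> X. is_ball k c}"

definition cell_boundary :: "'a set set \<Rightarrow> 'a set \<Rightarrow> 'a set" where
  "cell_boundary X c = \<Union>{d \<in> X. d \<subset> c}"

definition cell_complex_on :: "'a::topological_space set \<Rightarrow> 'a set set \<Rightarrow> bool" where
  "cell_complex_on M X \<longleftrightarrow>
     finite X \<and> \<Union>X = M \<and>
     (\<forall>c\<in>X. \<exists>k f g. homeomorphism (std_ball k) c f g \<and> f ` std_sphere k = cell_boundary X c) \<and>
     (\<forall>c\<in>X. \<forall>d\<in>X. c \<noteq> d \<longrightarrow> (c - cell_boundary X c) \<inter> (d - cell_boundary X d) = {})"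

definition cpx :: "nat \<Rightarrow> 'a::topological_space set \<Rightarrow> 'a set set \<Rightarrow> bool" where
  "cpx n M X \<longleftrightarrow> cell_complex_on M X \<and>
     (\<exists>K h. triangulation_of K h M \<and> X = (\<lambda>\<sigma>. h ` dual_block K \<sigma>) ` K \<and>
        (\<forall>\<sigma>\<in>K. \<exists>k. k + card \<sigma> = n + 1 \<and> is_ball k (h ` dual_block K \<sigma>)))"


section \<open>Layers\<close>

definition regions :: "nat \<Rightarrow> nat \<Rightarrow> (nat \<Rightarrow> 'a::topological_space set set) \<Rightarrow> 'a set set" where
  "regions n j X = (\<Union>i<j. cells_of_dim n (X i))"

definition regions_at :: "nat \<Rightarrow> nat \<Rightarrow> (nat \<Rightarrow> 'a::topological_space set set) \<Rightarrow> 'a \<Rightarrow> 'a set set" where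
  "regions_at n j X x = {r \<in> regions n j X. x \<in> r}"

text \<open>Transversality of all layers together, for cells that are only topologically embedded.
  Where \<open>m + 1\<close> regions of one cpx meet, the cpx is locally the product of a Euclidean space with
  the fan in \<open>\<real>\<^sup>m\<close> dual to an \<open>m\<close>-simplex: the maximality regions of the \<open>m + 1\<close> functions
  \<open>0, y\<^sub>1, \<dots>, y\<^sub>m\<close> (the function \<open>0\<close> belongs to the region \<open>b i\<close>). The layers are transverse at \<open>x\<close>
  if one chart achieves this for all of them at once, with pairwise disjoint sets of coordinates,
  i.e. with independent normal directions. All cells of a cpx are intersections of its regions,
  so it suffices to describe the regions.\<close>

definition transverse_at ::
  "nat \<Rightarrow> 'a::topological_space set \<Rightarrow> nat \<Rightarrow> (nat \<Rightarrow> 'a set set) \<Rightarrow> 'a \<Rightarrow> bool" where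
  "transverse_at n M j X x \<longleftrightarrow>
     (let star = (\<lambda>i. {r \<in> cells_of_dim n (X i). x \<in> r}) in
      \<exists>U \<psi> b c. chart_on n M U \<psi> \<and> x \<in> U \<and>
        (\<forall>i<j. b i \<in> star i) \<and>
        inj_on c (SIGMA i:{..<j}. star i - {b i}) \<and>
        c ` (SIGMA i:{..<j}. star i - {b i}) \<subseteq> {..<n} \<and>
        (let y = (\<lambda>i s u. if s = b i then 0 else \<psi> u (c (i, s))) in
         \<forall>i<j. \<forall>r\<in>cells_of_dim n (X i).
           r \<inter> U = (if x \<in> r then {u \<in> U. \<forall>s\<in>star i. y i s u \<le> y i r u} else {})))"

definition layer_cpx ::
  "nat \<Rightarrow> 'a::topological_space set \<Rightarrow> nat \<Rightarrow> (nat \<Rightarrow> 'a set set) \<Rightarrow> bool" where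
  "layer_cpx n M j X \<longleftrightarrow>
     1 \<le> j \<and> (\<forall>i<j. cpx n M (X i)) \<and> (\<forall>x\<in>M. transverse_at n M j X x) \<and>
     (\<forall>Q\<subseteq>regions n j X. Q \<noteq> {} \<and> \<Inter>Q \<noteq> {} \<longrightarrow> (\<exists>i\<le>n. is_ball i (\<Inter>Q)))"

definition layer_cells :: "nat \<Rightarrow> nat \<Rightarrow> (nat \<Rightarrow> 'a::topological_space set set) \<Rightarrow> 'a set set" where
  "layer_cells n j X =
     {\<Inter>R | R. R \<subseteq> regions n j X \<and> (\<forall>i<j. R \<inter> cells_of_dim n (X i) \<noteq> {}) \<and> \<Inter>R \<noteq> {}}"

definition layer_ecpx ::
  "nat \<Rightarrow> 'a::topological_space set \<Rightarrow> nat \<Rightarrow> (nat \<Rightarrow> 'a set set) \<Rightarrow> bool" where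
  "layer_ecpx n M j X \<longleftrightarrow>
     layer_cpx n M j X \<and>
     (\<forall>f\<in>cells_of_dim 2 (layer_cells n j X).
        even (card {e \<in> cells_of_dim 1 (layer_cells n j X). e \<subseteq> f}))"

definition one_skeleton :: "nat \<Rightarrow> nat \<Rightarrow> (nat \<Rightarrow> 'a::topological_space set set) \<Rightarrow> 'a set" where
  "one_skeleton n j X =
     \<Union>(cells_of_dim 0 (layer_cells n j X) \<union> cells_of_dim 1 (layer_cells n j X))"


section \<open>The fundamental group\<close>

definition loop_class :: "'a::topological_space set \<Rightarrow> (real \<Rightarrow> 'a) \<Rightarrow> (real \<Rightarrow> 'a) set" where
  "loop_class S p = {q. homotopic_paths S p q}"

definition fundamental_group :: "'a::topological_space set \<Rightarrow> 'a \<Rightarrow> (real \<Rightarrow> 'a) set monoid" where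
  "fundamental_group S x =
     \<lparr>carrier = {loop_class S p | p. path p \<and> path_image p \<subseteq> S \<and> pathstart p = x \<and> pathfinish p = x},
      mult = (\<lambda>a b. \<Union>p\<in>a. \<Union>q\<in>b. loop_class S (p +++ q)),
      one = loop_class S (\<lambda>_. x)\<rparr>"

text \<open>The homomorphism induced by the inclusion of a subspace into \<open>S\<close>.\<close>

definition inclusion_hom :: "'a::topological_space set \<Rightarrow> (real \<Rightarrow> 'a) set \<Rightarrow> (real \<Rightarrow> 'a) set" where
  "inclusion_hom S a = (\<Union>p\<in>a. loop_class S p)"


section \<open>Holonomy on the 1-skeleton\<close>

text \<open>An edge path starting at a given vertex is the list of its edges, each paired with the
  vertex at which it ends.\<close>

fun edge_path ::
  "nat \<Rightarrow> nat \<Rightarrow> (nat \<Rightarrow> 'a::topological_space set set) \<Rightarrow> 'a \<Rightarrow> ('a set \<times> 'a) list \<Rightarrow> 'a \<Rightarrow> bool" where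
  "edge_path n j X v [] w \<longleftrightarrow> {v} \<in> cells_of_dim 0 (layer_cells n j X) \<and> v = w"
| "edge_path n j X v ((e, u) # p) w \<longleftrightarrow>
     {v} \<in> cells_of_dim 0 (layer_cells n j X) \<and> {u} \<in> cells_of_dim 0 (layer_cells n j X) \<and>
     e \<in> cells_of_dim 1 (layer_cells n j X) \<and> v \<in> e \<and> u \<in> e \<and> v \<noteq> u \<and>
     edge_path n j X u p w"

text \<open>The curves in the 1-skeleton traversing an edge path; they differ only by the
  parametrizations of the edges.\<close>

fun traverses :: "(real \<Rightarrow> 'a::topological_space) \<Rightarrow> 'a \<Rightarrow> ('a set \<times> 'a) list \<Rightarrow> bool" where
  "traverses \<gamma> v [] \<longleftrightarrow> \<gamma> = (\<lambda>_. v)"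
| "traverses \<gamma> v ((e, u) # p) \<longleftrightarrow>
     (\<exists>\<alpha> \<beta>. arc \<alpha> \<and> path_image \<alpha> = e \<and> pathstart \<alpha> = v \<and> pathfinish \<alpha> = u \<and>
       traverses \<beta> u p \<and> \<gamma> = \<alpha> +++ \<beta>)"

definition edge_transport ::
  "nat \<Rightarrow> nat \<Rightarrow> (nat \<Rightarrow> 'a::topological_space set set) \<Rightarrow> 'a set \<Rightarrow> 'a \<Rightarrow> ('a set \<Rightarrow> nat) \<Rightarrow> 'a set \<Rightarrow> nat" where
  "edge_transport n j X e u col =
     (\<lambda>r\<in>regions_at n j X u.
        if e \<subseteq> r then col r
        else (THE k. k \<in> {1..n + j} - col ` {s \<in> regions n j X. e \<subseteq> s}))"

fun path_transport ::
  "nat \<Rightarrow> nat \<Rightarrow> (nat \<Rightarrow> 'a::topological_space set set) \<Rightarrow> ('a set \<times> 'a) list \<Rightarrow> ('a set \<Rightarrow> nat) \<Rightarrow> 'a set \<Rightarrow> nat" where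
  "path_transport n j X [] col = col"
| "path_transport n j X ((e, u) # p) col = path_transport n j X p (edge_transport n j X e u col)"

text \<open>The permutation of a closed edge path sends the initial color of each region at the base
  vertex to its final color. As transport commutes with renaming colors, first \<open>p\<close> then \<open>q\<close>
  yields \<open>\<sigma>\<^sub>p \<circ> \<sigma>\<^sub>q\<close>, so this convention gives a homomorphism.\<close>

definition edge_path_perm ::
  "nat \<Rightarrow> nat \<Rightarrow> (nat \<Rightarrow> 'a::topological_space set set) \<Rightarrow> 'a \<Rightarrow> ('a set \<Rightarrow> nat) \<Rightarrow> ('a set \<times> 'a) list \<Rightarrow> nat \<Rightarrow> nat" where
  "edge_path_perm n j X v col p =
     (\<lambda>k. if k \<in> {1..n + j} then path_transport n j X p col (inv_into (regions_at n j X v) col k) else k)"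

definition skeleton_holonomy ::
  "nat \<Rightarrow> nat \<Rightarrow> (nat \<Rightarrow> 'a::topological_space set set) \<Rightarrow> 'a \<Rightarrow> ('a set \<Rightarrow> nat) \<Rightarrow> (real \<Rightarrow> 'a) set \<Rightarrow> nat \<Rightarrow> nat" where
  "skeleton_holonomy n j X v col a =
     (THE \<sigma>. \<exists>p \<gamma>. edge_path n j X v p v \<and> traverses \<gamma> v p \<and> \<gamma> \<in> a \<and> \<sigma> = edge_path_perm n j X v col p)"

end

theory Submission
  imports Defs "HOL-Homology.Invariance_of_Domain"
begin

text \<open>
  Call a coloring of the regions at all vertices of a cell coherent if it is invariant under
  transport along the edges of the cell. On every cell a coherent coloring is determined by its
  value at one vertex, because the boundary of the cell is connected, and every value occurs: on a
  2-cell two colors alternate around the boundary, which closes up since the number of sides is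
  even, and from dimension 3 on the coherent colorings of the proper faces form a locally constant
  sheaf on the boundary sphere, which is simply connected. Consequently coherent colorings form a
  locally constant sheaf on the whole of \<open>M\<close>, whose monodromy along an edge path is the holonomy.
  This makes the holonomy of a closed edge path invariant under homotopy in \<open>M\<close>, while every loop
  in \<open>M\<close>, as well as every loop in the 1-skeleton, can be deformed cell by cell into an edge path.
\<close>

text \<open>The holonomy of a class is read off from any edge path traversed by one of its members.
  So \<open>skeleton_holonomy\<close> makes sense for classes in \<open>M\<close> as well, and the
  extension is this same function; what needs proof is that such an edge path exists and that all
  choices agree. The obstacle is that cells are merely topological balls: neither the dimension of
  \<open>\<Inter>A\<close> nor the position of its proper faces is given. Transversality yields
  charts in which the regions through a point are told apart by comparing coordinates. In such a
  chart \<open>\<Inter>A\<close> has \<open>n + j - card A\<close> free coordinates, and at a point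
  lying in a region outside \<open>A\<close> one of them attains an extremum on the cell. Invariance
  of domain then fixes the dimension and identifies the boundary sphere with the points of the cell
  satisfying \<open>R x \<noteq> A\<close>. Three properties of this sphere are used: it is nonempty
  for cells of positive dimension (so every cell has a vertex), connected from 2-cells on (so the
  vertices of a cell are joined by its edges), and without monodromy from 3-cells on (so coherent
  colorings extend).\<close>

section \<open>Locally constant sheaves\<close>

text \<open>A locally constant sheaf is described by its stalks \<open>Fib\<close>. The points \<open>y\<close> with \<open>le y x\<close> form
  a neighbourhood of \<open>x\<close> over which it is trivial; \<open>rho y x\<close> identifies the stalks.\<close>

locale local_system =
  fixes Y :: "'y::topological_space set" and le :: "'y \<Rightarrow> 'y \<Rightarrow> bool"
    and Fib :: "'y \<Rightarrow> 'f set" and rho :: "'y \<Rightarrow> 'y \<Rightarrow> 'f \<Rightarrow> 'f"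
  assumes le_refl: "x \<in> Y \<Longrightarrow> le x x"
    and le_trans: "le x y \<Longrightarrow> le y z \<Longrightarrow> le x z"
    and open_le: "x \<in> Y \<Longrightarrow> openin (top_of_set Y) {y \<in> Y. le y x}"
    and bij_rho: "x \<in> Y \<Longrightarrow> y \<in> Y \<Longrightarrow> le y x \<Longrightarrow> bij_betw (rho y x) (Fib y) (Fib x)"
    and rho_id: "x \<in> Y \<Longrightarrow> c \<in> Fib x \<Longrightarrow> rho x x c = c"
    and rho_comp: "x \<in> Y \<Longrightarrow> y \<in> Y \<Longrightarrow> z \<in> Y \<Longrightarrow> le z y \<Longrightarrow> le y x \<Longrightarrow> c \<in> Fib z \<Longrightarrow>
           rho y x (rho z y c) = rho z x c"
begin

text \<open>A section over \<open>T\<close> of the sheaf pulled back along \<open>h\<close>. Since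
  \<open>rho\<close> maps the stalks at nearby points into the stalk at \<open>h t\<close>, all
  neighbouring values are compared inside that one stalk. Of the continuity of \<open>h\<close> only
  the consequence \<open>le (h t') (h t)\<close> is recorded.\<close>

definition sec :: "'t::topological_space set \<Rightarrow> ('t \<Rightarrow> 'y) \<Rightarrow> ('t \<Rightarrow> 'f) \<Rightarrow> bool" where
  "sec T h s \<longleftrightarrow> (\<forall>t\<in>T. h t \<in> Y \<and> s t \<in> Fib (h t) \<and>
     (\<exists>U. open U \<and> t \<in> U \<and> (\<forall>t'\<in>T \<inter> U. le (h t') (h t) \<and> rho (h t') (h t) (s t') = s t)))"

lemma rho_in: "x \<in> Y \<Longrightarrow> y \<in> Y \<Longrightarrow> le y x \<Longrightarrow> c \<in> Fib y \<Longrightarrow> rho y x c \<in> Fib x"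
  using bij_rho bij_betwE by blast

lemma rho_inj: "x \<in> Y \<Longrightarrow> y \<in> Y \<Longrightarrow> le y x \<Longrightarrow> c \<in> Fib y \<Longrightarrow> c' \<in> Fib y \<Longrightarrow>
    rho y x c = rho y x c' \<Longrightarrow> c = c'"
  using bij_rho unfolding bij_betw_def inj_on_def by blast

lemma nbhd_le:
  assumes "continuous_on T h" "h ` T \<subseteq> Y" "t \<in> T" "x \<in> Y" "le (h t) x"
  obtains U where "open U" "t \<in> U" "\<And>t'. t' \<in> T \<Longrightarrow> t' \<in> U \<Longrightarrow> le (h t') x"
proof -
  obtain G where G: "open G" "{y \<in> Y. le y x} = Y \<inter> G"
    using open_le[OF assms(4)] by (auto simp: openin_open)
  have "h t \<in> G" using assms G by blast
  then obtain U where "open U" "t \<in> U" "\<forall>t'\<in>T. t' \<in> U \<longrightarrow> h t' \<in> G"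
    using assms(1,3) G(1) unfolding continuous_on_topological by metis
  then show thesis using that assms(2) G(2) by blast
qed

lemma sec_fib: "sec T h s \<Longrightarrow> t \<in> T \<Longrightarrow> s t \<in> Fib (h t)"
  and sec_base: "sec T h s \<Longrightarrow> t \<in> T \<Longrightarrow> h t \<in> Y"
  by (simp_all add: sec_def)

lemma sec_nbhd:
  assumes "sec T h s" "t \<in> T"
  obtains U where "open U" "t \<in> U"
    "\<And>t'. t' \<in> T \<Longrightarrow> t' \<in> U \<Longrightarrow> le (h t') (h t)"
    "\<And>t'. t' \<in> T \<Longrightarrow> t' \<in> U \<Longrightarrow> rho (h t') (h t) (s t') = s t"
  using assms unfolding sec_def by (metis (no_types, lifting) Int_iff)

lemma sec_cong:
  assumes "sec T h s" "\<And>t. t \<in> T \<Longrightarrow> h t = h' t" "\<And>t. t \<in> T \<Longrightarrow> s t = s' t"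
  shows "sec T h' s'"
  using assms unfolding sec_def by (metis (no_types, lifting) Int_iff)

lemma sec_compose:
  assumes "sec T h s" "continuous_on T' g" "g ` T' \<subseteq> T"
  shows "sec T' (\<lambda>t. h (g t)) (\<lambda>t. s (g t))"
  unfolding sec_def
proof (intro ballI conjI)
  fix t assume t: "t \<in> T'"
  then have gt: "g t \<in> T" using assms by blast
  then show "h (g t) \<in> Y" "s (g t) \<in> Fib (h (g t))" using assms(1) by (auto simp: sec_def)
  obtain U where U: "open U" "g t \<in> U"
      "\<And>t'. t' \<in> T \<Longrightarrow> t' \<in> U \<Longrightarrow> le (h t') (h (g t))"
      "\<And>t'. t' \<in> T \<Longrightarrow> t' \<in> U \<Longrightarrow> rho (h t') (h (g t)) (s t') = s (g t)"
    by (rule sec_nbhd[OF assms(1) gt]) blast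
  obtain W where "open W" "t \<in> W" "\<forall>t'\<in>T'. t' \<in> W \<longrightarrow> g t' \<in> U"
    using assms(2) t U(1,2) unfolding continuous_on_topological by metis
  then show "\<exists>U. open U \<and> t \<in> U \<and> (\<forall>t'\<in>T' \<inter> U. le (h (g t')) (h (g t)) \<and>
        rho (h (g t')) (h (g t)) (s (g t')) = s (g t))"
    using U(3,4) assms(3) by (intro exI[of _ W]) auto
qed

lemma sec_subset: "sec T h s \<Longrightarrow> T' \<subseteq> T \<Longrightarrow> sec T' h s"
  by (rule sec_compose[where g = "\<lambda>t. t", simplified]) auto

lemma sec_const: "x \<in> Y \<Longrightarrow> c \<in> Fib x \<Longrightarrow> sec T (\<lambda>_. x) (\<lambda>_. c)"
  unfolding sec_def using le_refl rho_id by blast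

text \<open>The truth value of \<open>s t = s' t\<close> is locally constant: near \<open>a\<close>
  the injective map \<open>rho (h x) (h a)\<close> sends \<open>s x\<close> to \<open>s a\<close>
  and \<open>s' x\<close> to \<open>s' a\<close>.\<close>

lemma sec_unique:
  assumes "connected T" "sec T h s" "sec T h s'" "t0 \<in> T" "s t0 = s' t0" "t \<in> T"
  shows "s t = s' t"
proof -
  have "(\<lambda>t. s t = s' t) constant_on T"
  proof (rule locally_constant_imp_constant[OF assms(1)])
    fix a assume a: "a \<in> T"
    obtain U where U: "open U" "a \<in> U" "\<And>t'. t' \<in> T \<Longrightarrow> t' \<in> U \<Longrightarrow> le (h t') (h a)"
        "\<And>t'. t' \<in> T \<Longrightarrow> t' \<in> U \<Longrightarrow> rho (h t') (h a) (s t') = s a"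
      by (rule sec_nbhd[OF assms(2) a]) blast
    obtain U' where U': "open U'" "a \<in> U'" "\<And>t'. t' \<in> T \<Longrightarrow> t' \<in> U' \<Longrightarrow> rho (h t') (h a) (s' t') = s' a"
      by (rule sec_nbhd[OF assms(3) a]) blast
    have "(s x = s' x) = (s a = s' a)" if "x \<in> T \<inter> (U \<inter> U')" for x
      using that U(3,4)[of x] U'(3)[of x] rho_inj[of "h a" "h x" "s x" "s' x"] a
        sec_fib[OF assms(2)] sec_fib[OF assms(3)] sec_base[OF assms(2)] by auto
    moreover have "openin (top_of_set T) (T \<inter> (U \<inter> U'))" using U U' by auto
    moreover have "a \<in> T \<inter> (U \<inter> U')" using a U(2) U'(2) by blast
    ultimately show "\<exists>Ta. openin (top_of_set T) Ta \<and> a \<in> Ta \<and> (\<forall>x\<in>Ta. (s x = s' x) = (s a = s' a))"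
      by blast
  qed
  then show ?thesis using assms(4,5,6) unfolding constant_on_def by auto
qed

text \<open>A closed piece not containing \<open>t\<close> is invisible near \<open>t\<close>, so in
  every case two neighbourhoods of \<open>t\<close> can be intersected.\<close>

lemma sec_Un:
  assumes "sec T1 h s" "sec T2 h s"
    and "closedin (top_of_set (T1 \<union> T2)) T1" "closedin (top_of_set (T1 \<union> T2)) T2"
  shows "sec (T1 \<union> T2) h s"
proof -
  have aux: "\<exists>U. open U \<and> t \<in> U \<and> (\<forall>t'\<in>T' \<inter> U. le (h t') (h t) \<and> rho (h t') (h t) (s t') = s t)"
    if T': "sec T' h s" "closedin (top_of_set (T1 \<union> T2)) T'" "t \<in> T1 \<union> T2" for T' t
  proof (cases "t \<in> T'")
    case True then show ?thesis using T'(1) unfolding sec_def by blast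
  next
    case False
    obtain K where K: "closed K" "T' = (T1 \<union> T2) \<inter> K" using T'(2) by (auto simp: closedin_closed)
    then have "open (- K)" "t \<in> - K" "T' \<inter> - K = {}" using False T'(3) by auto
    then show ?thesis by (intro exI[of _ "- K"] conjI ballI) auto
  qed
  show ?thesis unfolding sec_def
  proof (intro ballI conjI)
    fix t assume t: "t \<in> T1 \<union> T2"
    then show "h t \<in> Y" "s t \<in> Fib (h t)" using assms by (auto simp: sec_def)
    obtain U where U: "open U" "t \<in> U" "\<forall>t'\<in>T1 \<inter> U. le (h t') (h t) \<and> rho (h t') (h t) (s t') = s t"
      using aux[OF assms(1,3) t] by blast
    obtain U' where U': "open U'" "t \<in> U'" "\<forall>t'\<in>T2 \<inter> U'. le (h t') (h t) \<and> rho (h t') (h t) (s t') = s t"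
      using aux[OF assms(2,4) t] by blast
    show "\<exists>U. open U \<and> t \<in> U \<and> (\<forall>t'\<in>(T1 \<union> T2) \<inter> U. le (h t') (h t) \<and> rho (h t') (h t) (s t') = s t)"
      using U U' by (intro exI[of _ "U \<inter> U'"]) auto
  qed
qed

text \<open>The neighbourhood \<open>V\<close> is fixed before \<open>Q\<close> and
  \<open>s0\<close> are chosen. This allows lifts over consecutive time intervals to be glued, as
  the second one starts from values not known in advance. The subdivision of the time interval is
  left to \<open>Bolzano\<close>.\<close>

lemma sec_lift_local:
  fixes H :: "real \<times> 't::topological_space \<Rightarrow> 'y"
  assumes H: "continuous_on ({0..1} \<times> P) H" "H ` ({0..1} \<times> P) \<subseteq> Y" and p0: "p0 \<in> P"
  shows "\<exists>V. open V \<and> p0 \<in> V \<and> (\<forall>Q s0. Q \<subseteq> P \<inter> V \<longrightarrow> sec Q (\<lambda>p. H (0, p)) s0 \<longrightarrow>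
     (\<exists>S. sec ({0..1} \<times> Q) H S \<and> (\<forall>p\<in>Q. S (0, p) = s0 p)))"
proof -
  define E where "E a b V \<longleftrightarrow> (\<forall>Q s0. Q \<subseteq> P \<inter> V \<longrightarrow> sec Q (\<lambda>p. H (a, p)) s0 \<longrightarrow>
     (\<exists>S. sec ({a..b} \<times> Q) H S \<and> (\<forall>p\<in>Q. S (a, p) = s0 p)))" for a b V
  define B where "B a b \<longleftrightarrow> (0 \<le> a \<longrightarrow> b \<le> 1 \<longrightarrow> (\<exists>V. open V \<and> p0 \<in> V \<and> E a b V))" for a b
  have "(0::real) \<le> 1" by simp
  then have "B 0 1"
  proof (induction rule: Bolzano)
    case (trans a b c)
    show ?case unfolding B_def
    proof (intro impI)
      assume ac: "0 \<le> a" "c \<le> 1"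
      obtain V where V: "open V" "p0 \<in> V" "E a b V" using trans ac by (auto simp: B_def)
      obtain V' where V': "open V'" "p0 \<in> V'" "E b c V'" using trans ac by (auto simp: B_def)
      have "E a c (V \<inter> V')"
        unfolding E_def
      proof (intro allI impI)
        fix Q s0 assume Q: "Q \<subseteq> P \<inter> (V \<inter> V')" and s0: "sec Q (\<lambda>p. H (a, p)) s0"
        obtain S where S: "sec ({a..b} \<times> Q) H S" "\<forall>p\<in>Q. S (a, p) = s0 p"
          using V(3) Q s0 unfolding E_def by blast
        have "sec Q (\<lambda>p. H (b, p)) (\<lambda>p. S (b, p))"
          using trans by (intro sec_compose[OF S(1), of _ "\<lambda>p. (b, p)"]) (auto intro!: continuous_intros)
        then obtain S' where S': "sec ({b..c} \<times> Q) H S'" "\<forall>p\<in>Q. S' (b, p) = S (b, p)"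
          using V'(3) Q unfolding E_def by blast
        let ?S = "\<lambda>z. if fst z \<le> b then S z else S' z"
        have "sec ({a..b} \<times> Q \<union> {b..c} \<times> Q) H ?S"
        proof (rule sec_Un)
          show "sec ({a..b} \<times> Q) H ?S" by (rule sec_cong[OF S(1)]) auto
          have "S' z = ?S z" if "z \<in> {b..c} \<times> Q" for z
            using that S'(2) by (cases z) (auto simp: not_le)
          then show "sec ({b..c} \<times> Q) H ?S" by (intro sec_cong[OF S'(1)]) auto
          have "{a..b} \<times> Q = ({a..b} \<times> Q \<union> {b..c} \<times> Q) \<inter> ({..b} \<times> UNIV)"
               "{b..c} \<times> Q = ({a..b} \<times> Q \<union> {b..c} \<times> Q) \<inter> ({b..} \<times> UNIV)"
            using trans by auto
          then show "closedin (top_of_set ({a..b} \<times> Q \<union> {b..c} \<times> Q)) ({a..b} \<times> Q)"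
               "closedin (top_of_set ({a..b} \<times> Q \<union> {b..c} \<times> Q)) ({b..c} \<times> Q)"
            by (metis closedin_closed closed_Times closed_UNIV closed_atMost,
                metis closedin_closed closed_Times closed_UNIV closed_atLeast)
        qed
        moreover have "{a..b} \<times> Q \<union> {b..c} \<times> Q = {a..c} \<times> Q" using trans by auto
        ultimately show "\<exists>S. sec ({a..c} \<times> Q) H S \<and> (\<forall>p\<in>Q. S (a, p) = s0 p)"
          using S(2) trans by (intro exI[of _ ?S]) auto
      qed
      then show "\<exists>V. open V \<and> p0 \<in> V \<and> E a c V" using V V' by (intro exI[of _ "V \<inter> V'"]) auto
    qed
  next
    case (local t0)
    define x where "x = H (t0, p0)"
    have t0: "(t0, p0) \<in> {0..1} \<times> P" using local p0 by auto
    have xY: "x \<in> Y" using t0 H unfolding x_def by blast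
    obtain U where U: "open U" "(t0, p0) \<in> U"
      "\<And>t'. t' \<in> {0..1} \<times> P \<Longrightarrow> t' \<in> U \<Longrightarrow> le (H t') x"
      using nbhd_le[OF H t0 xY] le_refl[OF xY] x_def by metis
    obtain T V where TV: "open T" "open V" "t0 \<in> T" "p0 \<in> V" "T \<times> V \<subseteq> U"
      using U by (metis open_prod_elim mem_Sigma_iff)
    obtain d where d: "d > 0" "\<And>t. \<bar>t - t0\<bar> < d \<Longrightarrow> t \<in> T"
      using TV by (auto simp: open_real)
    have "E a b V" if ab: "a \<le> t0" "t0 \<le> b" "b - a < d" "0 \<le> a" "b \<le> 1" for a b
      unfolding E_def
    proof (intro allI impI)
      fix Q s0 assume Q: "Q \<subseteq> P \<inter> V" and s0: "sec Q (\<lambda>p. H (a, p)) s0"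
      have lex: "le (H (t, p)) x" if "t \<in> {a..b}" "p \<in> Q" for t p
        using that ab Q d(2)[of t] TV by (intro U(3)) auto
      have HY: "H (t, p) \<in> Y" if "t \<in> {a..b}" "p \<in> Q" for t p
      proof -
        have "(t, p) \<in> {0..1} \<times> P" using that ab Q by auto
        then show ?thesis using H(2) by blast
      qed
      have aab: "a \<in> {a..b}" using ab by auto
      \<comment> \<open>All points of the strip are below \<open>x\<close>, so the value prescribed
        at time \<open>a\<close> is moved into the stalk at \<open>x\<close> and from there back
        into the stalk at \<open>H z\<close>.\<close>
      define S where "S z = inv_into (Fib (H z)) (rho (H z) x) (rho (H (a, snd z)) x (s0 (snd z)))" for z
      have rin: "rho (H (a, p)) x (s0 p) \<in> Fib x" if "p \<in> Q" for p
        using rho_in[OF xY HY[OF aab that] lex[OF aab that]] sec_fib[OF s0 that] by simp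
      have Sfib: "S (t, p) \<in> Fib (H (t, p))" and Sr: "rho (H (t, p)) x (S (t, p)) = rho (H (a, p)) x (s0 p)"
        if tp: "t \<in> {a..b}" "p \<in> Q" for t p
        using bij_rho[OF xY HY[OF tp] lex[OF tp]] rin[OF tp(2)]
        by (auto simp: S_def bij_betw_def inv_into_into f_inv_into_f)
      have "sec ({a..b} \<times> Q) H S"
        unfolding sec_def
      proof (intro ballI conjI)
        fix z assume z: "z \<in> {a..b} \<times> Q"
        then obtain t p where tp: "z = (t, p)" "t \<in> {a..b}" "p \<in> Q" by auto
        show "H z \<in> Y" "S z \<in> Fib (H z)" using tp HY Sfib by auto
        have cH: "continuous_on ({a..b} \<times> Q) H"
          by (rule continuous_on_subset[OF H(1)]) (use ab Q in auto)
        have HQ: "H ` ({a..b} \<times> Q) \<subseteq> Y" using HY by auto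
        obtain U1 where U1: "open U1" "z \<in> U1"
          "\<And>t'. t' \<in> {a..b} \<times> Q \<Longrightarrow> t' \<in> U1 \<Longrightarrow> le (H t') (H z)"
          by (rule nbhd_le[OF cH HQ z \<open>H z \<in> Y\<close> le_refl[OF \<open>H z \<in> Y\<close>]]) blast
        obtain U2 where U2: "open U2" "p \<in> U2"
          "\<forall>p'\<in>Q \<inter> U2. le (H (a, p')) (H (a, p)) \<and> rho (H (a, p')) (H (a, p)) (s0 p') = s0 p"
          using s0 tp(3) unfolding sec_def by blast
        have "le (H z') (H z) \<and> rho (H z') (H z) (S z') = S z"
          if z': "z' \<in> {a..b} \<times> Q" "z' \<in> U1" "snd z' \<in> U2" for z'
        proof -
          obtain t' p' where tp': "z' = (t', p')" "t' \<in> {a..b}" "p' \<in> Q" using z' by auto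
          have l: "le (H z') (H z)" using U1 z' by blast
          have "rho (H z) x (rho (H z') (H z) (S z')) = rho (H z') x (S z')"
            using tp tp' HY lex l xY Sfib by (intro rho_comp) auto
          also have "\<dots> = rho (H (a, p')) x (s0 p')" using Sr tp' by simp
          also have "\<dots> = rho (H (a, p)) x (rho (H (a, p')) (H (a, p)) (s0 p'))"
            using U2(3) z' tp tp' HY lex aab xY sec_fib[OF s0] by (intro rho_comp[symmetric]) auto
          also have "\<dots> = rho (H z) x (S z)" using U2(3) z' tp tp' Sr by auto
          finally have "rho (H z') (H z) (S z') = S z"
          proof (rule rho_inj[rotated -1])
            show "x \<in> Y" by (rule xY)
            show zY: "H z \<in> Y" and Sz: "S z \<in> Fib (H z)" by fact+
            show "le (H z) x" using lex tp by simp
            have "H z' \<in> Y" "S z' \<in> Fib (H z')" using HY[OF tp'(2,3)] Sfib[OF tp'(2,3)] tp'(1) by simp_all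
            then show "rho (H z') (H z) (S z') \<in> Fib (H z)" using rho_in zY l by blast
          qed
          then show ?thesis using l by simp
        qed
        then show "\<exists>U. open U \<and> z \<in> U \<and> (\<forall>z'\<in>({a..b} \<times> Q) \<inter> U. le (H z') (H z) \<and> rho (H z') (H z) (S z') = S z)"
          using U1 U2 tp by (intro exI[of _ "U1 \<inter> (UNIV \<times> U2)"]) (auto intro: open_Times)
      qed
      moreover have "S (a, p) = s0 p" if "p \<in> Q" for p
        using Sr[OF aab that] Sfib[OF aab that] sec_fib[OF s0 that] rho_inj[OF xY HY[OF aab that] lex[OF aab that]] by auto
      ultimately show "\<exists>S. sec ({a..b} \<times> Q) H S \<and> (\<forall>p\<in>Q. S (a, p) = s0 p)" by blast
    qed
    then show ?case using d(1) TV unfolding B_def by blast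
  qed
  then show ?thesis unfolding B_def E_def by simp
qed

text \<open>Lifting over each single parameter yields a candidate. Uniqueness over the connected
  sets \<open>{0..1} \<times> {p'}\<close> identifies it with the lifts on whole strips, which are
  sections.\<close>

lemma sec_lift:
  fixes H :: "real \<times> 't::topological_space \<Rightarrow> 'y"
  assumes H: "continuous_on ({0..1} \<times> P) H" "H ` ({0..1} \<times> P) \<subseteq> Y"
    and s0: "sec P (\<lambda>p. H (0, p)) s0"
  obtains S where "sec ({0..1} \<times> P) H S" "\<And>p. p \<in> P \<Longrightarrow> S (0, p) = s0 p"
proof -
  have "\<exists>S. sec ({0..1} \<times> {p}) H S \<and> S (0, p) = s0 p" if p: "p \<in> P" for p
    using sec_lift_local[OF H p] sec_subset[OF s0, of "{p}"] p
    by (metis Int_iff empty_subsetI insert_subset singletonI)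
  then obtain F where F: "\<And>p. p \<in> P \<Longrightarrow> sec ({0..1} \<times> {p}) H (F p)" "\<And>p. p \<in> P \<Longrightarrow> F p (0, p) = s0 p"
    by metis
  define S where "S z = F (snd z) z" for z :: "real \<times> 't"
  have "sec ({0..1} \<times> P) H S"
    unfolding sec_def
  proof (intro ballI)
    fix z :: "real \<times> 't" assume z: "z \<in> {0..1} \<times> P"
    then obtain t p where tp: "z = (t, p)" "t \<in> {0..1}" "p \<in> P" by auto
    obtain V where V: "open V" "p \<in> V" "\<forall>Q s0. Q \<subseteq> P \<inter> V \<longrightarrow> sec Q (\<lambda>p. H (0, p)) s0 \<longrightarrow>
     (\<exists>S. sec ({0..1} \<times> Q) H S \<and> (\<forall>p\<in>Q. S (0, p) = s0 p))"
      using sec_lift_local[OF H tp(3)] by blast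
    obtain S' where S': "sec ({0..1} \<times> (P \<inter> V)) H S'" "\<forall>p\<in>P \<inter> V. S' (0, p) = s0 p"
      using V(3) sec_subset[OF s0, of "P \<inter> V"] by blast
    have eq: "S' (t', p') = S (t', p')" if "t' \<in> {0..1}" "p' \<in> P \<inter> V" for t' p'
    proof -
      have c: "connected ({0..1::real} \<times> {p'})" by (intro connected_Times) auto
      have "sec ({0..1} \<times> {p'}) H S'" by (rule sec_subset[OF S'(1)]) (use that in auto)
      from sec_unique[OF c this F(1), of "(0, p')" "(t', p')"] show ?thesis
        using that S'(2) F(2) by (auto simp: S_def)
    qed
    have "sec ({0..1} \<times> (P \<inter> V)) H S" by (rule sec_cong[OF S'(1)]) (use eq in auto)
    moreover have "z \<in> {0..1} \<times> (P \<inter> V)" using tp V by auto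
    ultimately obtain U where U: "H z \<in> Y" "S z \<in> Fib (H z)" "open U" "z \<in> U"
      "\<forall>t'\<in>({0..1} \<times> (P \<inter> V)) \<inter> U. le (H t') (H z) \<and> rho (H t') (H z) (S t') = S z"
      unfolding sec_def by blast
    have "open (U \<inter> (UNIV \<times> V))" "z \<in> U \<inter> (UNIV \<times> V)"
      using U V tp by (auto intro!: open_Int open_Times)
    moreover have "\<forall>t'\<in>({0..1} \<times> P) \<inter> (U \<inter> (UNIV \<times> V)).
        le (H t') (H z) \<and> rho (H t') (H z) (S t') = S z"
    proof
      fix t' assume "t' \<in> ({0..1} \<times> P) \<inter> (U \<inter> (UNIV \<times> V))"
      then have "t' \<in> ({0..1} \<times> (P \<inter> V)) \<inter> U" by auto
      then show "le (H t') (H z) \<and> rho (H t') (H z) (S t') = S z" using U(5) by blast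
    qed
    ultimately show "H z \<in> Y \<and> S z \<in> Fib (H z) \<and> (\<exists>U. open U \<and> z \<in> U \<and>
        (\<forall>t'\<in>({0..1} \<times> P) \<inter> U. le (H t') (H z) \<and> rho (H t') (H z) (S t') = S z))"
      using U(1,2) by blast
  qed
  then show thesis using that[of S] F(2) by (simp add: S_def)
qed

text \<open>Path lifting is \<open>sec_lift\<close> with a one-point parameter space.\<close>

lemma sec_path_exists:
  assumes "path p" "path_image p \<subseteq> Y" "c \<in> Fib (pathstart p)"
  obtains s where "sec {0..1} p s" "s 0 = c"
proof -
  let ?H = "\<lambda>z::real \<times> real. p (fst z)"
  have H: "continuous_on ({0..1} \<times> {0::real}) ?H" "?H ` ({0..1} \<times> {0}) \<subseteq> Y"
    using assms(1,2) by (auto simp: path_def path_image_def intro!: continuous_on_compose2[of "{0..1}" p] continuous_intros)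
  have "sec {0} (\<lambda>q. ?H (0, q)) (\<lambda>_. c)"
    using assms(2,3) by (auto intro!: sec_const simp: pathstart_def path_image_def)
  from sec_lift[OF H this] obtain S where S: "sec ({0..1} \<times> {0}) ?H S" "S (0, 0) = c" by auto
  have "sec {0..1} (\<lambda>t. ?H (t, 0)) (\<lambda>t. S (t, 0))"
    by (rule sec_compose[OF S(1)]) (auto intro!: continuous_intros)
  then show thesis using that[of "\<lambda>t. S (t, 0)"] S(2) by simp
qed

text \<open>Lift the homotopy starting from \<open>s\<close>. Along the two sides on which the
  homotopy is constant the lift is constant too, so at the other end it is a section along
  \<open>q\<close> with the endpoint values of \<open>s\<close>.\<close>

lemma sec_homotopic_paths:
  assumes "homotopic_paths Y p q" "sec {0..1} p s" "sec {0..1} q s'" "s 0 = s' 0"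
  shows "s 1 = s' 1"
proof -
  obtain h :: "real \<times> real \<Rightarrow> 'y" where h: "continuous_on ({0..1} \<times> {0..1}) h" "h ` ({0..1} \<times> {0..1}) \<subseteq> Y"
    "\<forall>x \<in> {0..1}. h (0, x) = p x" "\<forall>x \<in> {0..1}. h (1, x) = q x"
    "\<forall>t \<in> {0..1}. h (t, 0) = p 0 \<and> h (t, 1) = p 1"
    using assms(1) unfolding homotopic_paths pathstart_def pathfinish_def o_def image_subset_iff_funcset
    by blast
  have "sec {0..1} (\<lambda>x. h (0, x)) s" by (rule sec_cong[OF assms(2)]) (use h in auto)
  from sec_lift[OF h(1,2) this] obtain S where S: "sec ({0..1} \<times> {0..1}) h S"
    "\<And>x. x \<in> {0..1} \<Longrightarrow> S (0, x) = s x" by blast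
  have const: "S (1, x) = s x" if "x = 0 \<or> x = 1" for x :: real
  proof -
    have x: "x \<in> {0..1}" using that by auto
    have a: "sec {0..1} (\<lambda>t. h (t, x)) (\<lambda>t. S (t, x))"
      by (rule sec_compose[OF S(1)]) (use that in \<open>auto intro!: continuous_intros\<close>)
    have "sec {0..1::real} (\<lambda>t. p x) (\<lambda>t. s x)"
      using sec_base[OF assms(2) x] sec_fib[OF assms(2) x] by (rule sec_const)
    then have b: "sec {0..1} (\<lambda>t. h (t, x)) (\<lambda>t. s x)"
      by (rule sec_cong) (use h(5) that in auto)
    show ?thesis using sec_unique[OF _ a b, of 0 1] S(2)[OF x] by auto
  qed
  have a: "sec {0..1} (\<lambda>x. h (1, x)) (\<lambda>x. S (1, x))"
    by (rule sec_compose[OF S(1)]) (auto intro!: continuous_intros)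
  have b: "sec {0..1} q (\<lambda>x. S (1, x))" by (rule sec_cong[OF a]) (use h in auto)
  show ?thesis using sec_unique[OF _ b assms(3), of 0 1] const assms(4) by auto
qed

section \<open>Maps along which the sheaf has no monodromy\<close>

definition trivial_over :: "'t::topological_space set \<Rightarrow> ('t \<Rightarrow> 'y) \<Rightarrow> bool" where
  "trivial_over T h \<longleftrightarrow> (\<forall>t0\<in>T. \<forall>c\<in>Fib (h t0). \<exists>s. sec T h s \<and> s t0 = c)"

text \<open>Carry \<open>c\<close> back along the track of \<open>p0\<close> to the stalk at
  \<open>f q\<close>, take the constant section with this value at time 0 and lift it along
  \<open>K\<close>. Uniqueness along the same track shows that the result takes the value
  \<open>c\<close> at \<open>p0\<close>.\<close>

lemma trivial_over_contractible:
  fixes K :: "real \<times> 't::topological_space \<Rightarrow> 't"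
  assumes K: "continuous_on ({0..1} \<times> P) K" "K ` ({0..1} \<times> P) \<subseteq> P"
    "\<And>p. p \<in> P \<Longrightarrow> K (0, p) = q" "\<And>p. p \<in> P \<Longrightarrow> K (1, p) = p"
    and f: "continuous_on P f" "f ` P \<subseteq> Y"
  shows "trivial_over P f"
  unfolding trivial_over_def
proof (intro ballI)
  fix p0 c assume p0: "p0 \<in> P" and c: "c \<in> Fib (f p0)"
  have fq: "f q \<in> Y" using K f p0 by force
  let ?g = "\<lambda>t. K (1 - t, p0)"
  have g: "continuous_on {0..1} ?g"
    by (rule continuous_on_compose2[OF K(1)]) (use p0 in \<open>auto intro!: continuous_intros\<close>)
  have gP: "?g ` {0..1} \<subseteq> P" using K(2) p0 by auto
  have "path (\<lambda>t. f (?g t))" unfolding path_def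
    by (rule continuous_on_compose2[OF f(1) g gP])
  moreover have "path_image (\<lambda>t. f (?g t)) \<subseteq> Y" using gP f(2) by (auto simp: path_image_def)
  moreover have "c \<in> Fib (pathstart (\<lambda>t. f (?g t)))" using c K p0 by (simp add: pathstart_def)
  ultimately obtain s1 where s1: "sec {0..1} (\<lambda>t. f (?g t)) s1" "s1 0 = c"
    using sec_path_exists by blast
  have c1: "s1 1 \<in> Fib (f q)" using sec_fib[OF s1(1), of 1] K(3)[OF p0] by simp
  have fK: "continuous_on ({0..1} \<times> P) (\<lambda>z. f (K z))"
    by (rule continuous_on_compose2[OF f(1) K(1,2)])
  have fKY: "(\<lambda>z. f (K z)) ` ({0..1} \<times> P) \<subseteq> Y" using f(2) K(2) by auto
  have "sec P (\<lambda>p. f (K (0, p))) (\<lambda>_. s1 1)"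
    by (rule sec_cong[OF sec_const[OF fq c1]]) (use K(3) in auto)
  from sec_lift[OF fK fKY this] obtain S where S: "sec ({0..1} \<times> P) (\<lambda>z. f (K z)) S"
    "\<And>p. p \<in> P \<Longrightarrow> S (0, p) = s1 1" by blast
  have "sec P (\<lambda>p. f (K (1, p))) (\<lambda>p. S (1, p))"
    by (rule sec_compose[OF S(1)]) (auto intro!: continuous_intros)
  then have sP: "sec P f (\<lambda>p. S (1, p))" by (rule sec_cong) (use K(4) in auto)
  have s2: "sec {0..1} (\<lambda>t. f (?g t)) (\<lambda>t. S (1 - t, p0))"
    by (rule sec_compose[OF S(1), of _ "\<lambda>t. (1 - t, p0)"]) (use p0 in \<open>auto intro!: continuous_intros\<close>)
  have "S (1 - 0, p0) = s1 0"
    using sec_unique[OF _ s2 s1(1), of 1 0] S(2)[OF p0] by auto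
  then show "\<exists>s. sec P f s \<and> s p0 = c" using sP s1(2) by auto
qed

text \<open>A van Kampen argument: sections on the two pieces are matched at one point of the
  overlap and therefore agree on all of it by connectedness.\<close>

lemma trivial_over_Un:
  assumes "trivial_over P1 f" "trivial_over P2 f" "connected (P1 \<inter> P2)" "P1 \<inter> P2 \<noteq> {}"
    "closed P1" "closed P2"
  shows "trivial_over (P1 \<union> P2) f"
proof -
  have half: "\<exists>s. sec (A \<union> B) f s \<and> s t0 = c"
    if AB: "trivial_over A f" "trivial_over B f" "connected (A \<inter> B)" "A \<inter> B \<noteq> {}"
    "closed A" "closed B" and t0: "t0 \<in> A" "c \<in> Fib (f t0)" for A B t0 c
  proof -
    obtain s where s: "sec A f s" "s t0 = c" using AB t0 unfolding trivial_over_def by blast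
    obtain e where e: "e \<in> A \<inter> B" using AB by blast
    then have "s e \<in> Fib (f e)" using sec_fib[OF s(1)] by blast
    then obtain s' where s': "sec B f s'" "s' e = s e" using AB e unfolding trivial_over_def by blast
    have eq: "s' x = s x" if "x \<in> A \<inter> B" for x
      using sec_unique[OF AB(3) sec_subset[OF s'(1)] sec_subset[OF s(1)] e s'(2) that] by auto
    let ?s = "\<lambda>x. if x \<in> A then s x else s' x"
    have "sec (A \<union> B) f ?s"
    proof (rule sec_Un)
      show "sec A f ?s" by (rule sec_cong[OF s(1)]) auto
      show "sec B f ?s" by (rule sec_cong[OF s'(1)]) (use eq in auto)
    qed (use AB in \<open>auto simp: closedin_closed\<close>)
    then show ?thesis using s(2) t0 by (intro exI[of _ ?s]) auto
  qed
  show ?thesis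
    unfolding trivial_over_def
  proof (intro ballI)
    fix t0 c assume t0: "t0 \<in> P1 \<union> P2" and c: "c \<in> Fib (f t0)"
    show "\<exists>s. sec (P1 \<union> P2) f s \<and> s t0 = c"
      using half[OF assms, of t0 c] half[OF assms(2,1), of t0 c] assms c t0
      by (auto simp: Int_commute Un_commute)
  qed
qed

lemma sec_joinpaths:
  assumes "sec {0..1} p s" "sec {0..1} q s'" "s 1 = s' 0" "pathfinish p = pathstart q"
  shows "sec {0..1} (p +++ q) (\<lambda>t. if t \<le> 1/2 then s (2 * t) else s' (2 * t - 1))"
proof -
  have 1: "sec {0..1/2} (p +++ q) (\<lambda>t. if t \<le> 1/2 then s (2 * t) else s' (2 * t - 1))"
  proof (rule sec_cong)
    show "sec {0..1/2} (\<lambda>t. p (2 * t)) (\<lambda>t. s (2 * t))"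
      by (rule sec_compose[OF assms(1)]) (auto intro!: continuous_intros)
  qed (auto simp: joinpaths_def)
  have 2: "sec {1/2..1} (p +++ q) (\<lambda>t. if t \<le> 1/2 then s (2 * t) else s' (2 * t - 1))"
  proof (rule sec_cong)
    show "sec {1/2..1} (\<lambda>t. q (2 * t - 1)) (\<lambda>t. s' (2 * t - 1))"
      by (rule sec_compose[OF assms(2)]) (auto intro!: continuous_intros)
  next
    fix t :: real assume t: "t \<in> {1/2..1}"
    then consider "2 * t = 1" | "\<not> t \<le> 1/2" by fastforce
    then show "q (2 * t - 1) = (p +++ q) t" "s' (2 * t - 1) = (if t \<le> 1/2 then s (2 * t) else s' (2 * t - 1))"
      using assms(3,4) by (cases; simp add: joinpaths_def pathstart_def pathfinish_def)+
  qed
  have "sec ({0..1/2} \<union> {1/2..1}) (p +++ q) (\<lambda>t. if t \<le> 1/2 then s (2 * t) else s' (2 * t - 1))"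
    by (rule sec_Un[OF 1 2]) (auto intro!: closed_subset)
  moreover have "{0..1/2} \<union> {1/2..1} = {0..1::real}" by auto
  ultimately show ?thesis by simp
qed

end

section \<open>Balls and spheres\<close>

abbreviation E_space :: "nat \<Rightarrow> (nat \<Rightarrow> real) set" where
  "E_space k \<equiv> topspace (Euclidean_space k)"

lemma E_space_iff: "x \<in> E_space k \<longleftrightarrow> (\<forall>i\<ge>k. x i = 0)"
  by (simp add: topspace_Euclidean_space)

lemma Euclidean_space_eq_top_of_set: "Euclidean_space k = top_of_set (E_space k)"
  by (metis Euclidean_space_def euclidean_product_topology topspace_Euclidean_space)

lemma openin_Euclidean_space_iff:
  "openin (Euclidean_space k) U \<longleftrightarrow> (\<exists>T. open T \<and> U = E_space k \<inter> T)"
  by (metis Euclidean_space_eq_top_of_set openin_open)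

text \<open>A basic open set of the product topology constrains only finitely many coordinates, so a
  single \<open>e\<close> serves for all of them.\<close>

lemma open_fun_contains_box:
  fixes T :: "(nat \<Rightarrow> real) set"
  assumes "open T" "x \<in> T"
  obtains e where "e > 0" "\<And>z. (\<And>i. \<bar>z i - x i\<bar> < e) \<Longrightarrow> z \<in> T"
proof -
  have "openin (product_topology (\<lambda>i. euclideanreal) UNIV) T"
    using assms(1) by (simp add: euclidean_product_topology)
  from product_topology_open_contains_basis[OF this assms(2)]
  obtain X where X: "x \<in> (\<Pi>\<^sub>E i\<in>UNIV. X i)" "\<And>i. openin euclideanreal (X i)"
    "finite {i. X i \<noteq> topspace euclideanreal}" "(\<Pi>\<^sub>E i\<in>UNIV. X i) \<subseteq> T"
    by blast
  let ?F = "{i. X i \<noteq> UNIV}"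
  have F: "finite ?F" using X(3) by simp
  have "\<exists>e>0. \<forall>y. \<bar>y - x i\<bar> < e \<longrightarrow> y \<in> X i" for i
    using X(1) X(2)[of i] unfolding PiE_UNIV_domain open_openin[symmetric] open_real by blast
  then obtain r where r: "\<And>i. r i > 0" "\<And>i y. \<bar>y - x i\<bar> < r i \<Longrightarrow> y \<in> X i" by metis
  define e where "e = Min (insert 1 (r ` ?F))"
  have "e > 0" unfolding e_def using F r(1) by (subst Min_gr_iff) auto
  moreover have "z \<in> T" if z: "\<And>i. \<bar>z i - x i\<bar> < e" for z
  proof -
    have "z i \<in> X i" for i
    proof (cases "i \<in> ?F")
      case True
      then have "e \<le> r i" unfolding e_def using F by (intro Min_le) auto
      then show ?thesis using r(2) z[of i] by force
    qed auto
    then show ?thesis using X(4) by auto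
  qed
  ultimately show thesis using that by blast
qed

lemma open_Euclidean_space_perturb:
  assumes "openin (Euclidean_space k) U" "x \<in> U" "i < k"
  shows "\<exists>e>0. \<forall>t. \<bar>t\<bar> < e \<longrightarrow> x(i := x i + t) \<in> U"
proof -
  obtain T where T: "open T" "U = E_space k \<inter> T" using assms(1) openin_Euclidean_space_iff by blast
  then obtain e where e: "e > 0" "\<And>z. (\<And>l. \<bar>z l - x l\<bar> < e) \<Longrightarrow> z \<in> T"
    using open_fun_contains_box assms(2) by (metis Int_iff)
  have "x(i := x i + t) \<in> E_space k" for t using assms T by (auto simp: E_space_iff)
  moreover have "x(i := x i + t) \<in> T" if "\<bar>t\<bar> < e" for t
    using that e(1) by (intro e(2)) auto
  ultimately show ?thesis using e(1) T by blast
qed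

section \<open>Invariance of domain and of dimension\<close>

lemma invariance_of_domain_on:
  assumes "openin (Euclidean_space k) U" "continuous_on U f" "f ` U \<subseteq> E_space k" "inj_on f U"
  shows "openin (Euclidean_space k) (f ` U)"
proof (rule invariance_of_domain_Euclidean_space[OF assms(1) _ assms(4)])
  have "U \<subseteq> E_space k" using assms(1) openin_subset by blast
  then show "continuous_map (subtopology (Euclidean_space k) U) (Euclidean_space k) f"
    using assms(2,3) by (simp add: cm_Euclidean_space_iff_continuous_on inf_absorb2 image_subset_iff_funcset)
qed

text \<open>If \<open>d < k\<close>, the image would be open in \<open>E_space k\<close> and so
  admit small changes of coordinate \<open>d\<close>, which vanishes on
  \<open>E_space d\<close>.\<close>

lemma invariance_of_dimension_on:
  assumes "openin (Euclidean_space k) U" "U \<noteq> {}" "continuous_on U f" "f ` U \<subseteq> E_space d" "inj_on f U"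
  shows "k \<le> d"
proof (rule ccontr)
  assume "\<not> k \<le> d"
  then have dk: "d < k" by simp
  then have sub: "f ` U \<subseteq> E_space k" using assms(4) by (force simp: E_space_iff)
  obtain x where x: "x \<in> f ` U" using assms(2) by blast
  obtain e where e: "e > 0" "\<And>t. \<bar>t\<bar> < e \<Longrightarrow> x(d := x d + t) \<in> f ` U"
    using open_Euclidean_space_perturb[OF invariance_of_domain_on[OF assms(1,3) sub assms(5)] x dk] by blast
  have "x d = 0" "(x(d := x d + e/2)) d = 0"
    using x e(2)[of "e/2"] e(1) assms(4) by (auto simp: E_space_iff subset_iff simp del: fun_upd_apply)
  then show False using e(1) by simp
qed

section \<open>Interior and boundary of topological balls\<close>

lemma std_sphere_subset_ball: "std_sphere k \<subseteq> std_ball k"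
  by (auto simp: std_sphere_def std_ball_def)

lemma openin_open_std_ball: "openin (Euclidean_space k) (std_ball k - std_sphere k)"
proof -
  have "std_ball k - std_sphere k = E_space k \<inter> {x. (\<Sum>i<k. (x i)\<^sup>2) < 1}"
    by (auto simp: std_ball_def std_sphere_def)
  moreover have "open {x::nat \<Rightarrow> real. (\<Sum>i<k. (x i)\<^sup>2) < 1}"
    by (intro open_Collect_less continuous_intros continuous_on_product_coordinates)
  ultimately show ?thesis using openin_Euclidean_space_iff by blast
qed

text \<open>Increasing the absolute value of a nonzero coordinate of a point on the sphere leads out
  of the ball.\<close>

lemma std_sphere_not_interior:
  assumes "openin (Euclidean_space k) U" "U \<subseteq> std_ball k"
  shows "U \<inter> std_sphere k = {}"
proof (rule ccontr)
  assume "U \<inter> std_sphere k \<noteq> {}"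
  then obtain p where p: "p \<in> U" "p \<in> std_sphere k" by blast
  have s1: "(\<Sum>i<k. (p i)\<^sup>2) = 1" using p by (simp add: std_sphere_def)
  then obtain i where i: "i < k" "p i \<noteq> 0"
    by (metis (mono_tags, lifting) lessThan_iff power_zero_numeral sum.neutral zero_neq_one)
  obtain e where e: "e > 0" "\<And>t. \<bar>t\<bar> < e \<Longrightarrow> p(i := p i + t) \<in> U"
    using open_Euclidean_space_perturb[OF assms(1) p(1) i(1)] by blast
  let ?t = "sgn (p i) * (e/2)"
  have "\<bar>?t\<bar> < e" using e(1) i(2) by (simp add: abs_mult abs_sgn_eq)
  then have "p(i := p i + ?t) \<in> std_ball k" using e(2) assms(2) by blast
  then have "(\<Sum>l<k. ((p(i := p i + ?t)) l)\<^sup>2) \<le> 1" by (simp add: std_ball_def)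
  moreover have "(\<Sum>l<k. ((p(i := p i + ?t)) l)\<^sup>2) = (p i + ?t)\<^sup>2 + (\<Sum>l\<in>{..<k} - {i}. (p l)\<^sup>2)"
    using i(1) by (subst sum.remove[of _ i]) (auto intro: sum.cong)
  moreover have "(\<Sum>l<k. (p l)\<^sup>2) = (p i)\<^sup>2 + (\<Sum>l\<in>{..<k} - {i}. (p l)\<^sup>2)"
    using i(1) by (subst sum.remove[of _ i]) auto
  moreover have "(p i + ?t)\<^sup>2 > (p i)\<^sup>2"
    using i(2) e(1) by (auto simp: sgn_if power2_eq_square algebra_simps intro!: mult_pos_pos add_pos_pos mult_neg_pos)
  ultimately show False using s1 by linarith
qed

text \<open>A slight radial shrinking keeps a point in \<open>U\<close> and moves it off the
  sphere.\<close>

lemma open_std_ball_dense: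
  assumes "openin (top_of_set (std_ball k)) U" "U \<noteq> {}"
  shows "U \<inter> (std_ball k - std_sphere k) \<noteq> {}"
proof -
  obtain p where p: "p \<in> U" using assms by blast
  obtain T where T: "open T" "U = std_ball k \<inter> T" using assms by (auto simp: openin_open)
  let ?q = "\<lambda>t i. t * p i"
  have "continuous_on UNIV ?q"
    by (intro continuous_on_coordinatewise_then_product continuous_intros)
  then have "open (?q -` T)" using T(1) by (simp add: open_vimage)
  moreover have "1 \<in> ?q -` T" using p T by auto
  ultimately obtain e where e: "e > 0" "\<And>t. \<bar>t - 1\<bar> < e \<Longrightarrow> t \<in> ?q -` T" unfolding open_real by metis
  \<comment> \<open>The maximum with 0 guards against large \<open>e\<close>, for which
    \<open>1 - e/2\<close> may have absolute value 1 or more.\<close>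
  define t where "t = max (1 - e/2) 0"
  have t: "0 \<le> t" "t < 1" "\<bar>t - 1\<bar> < e" using e(1) by (auto simp: t_def)
  have ps: "p \<in> E_space k" "(\<Sum>i<k. (p i)\<^sup>2) \<le> 1" using p T by (auto simp: std_ball_def)
  have "(\<Sum>i<k. (?q t i)\<^sup>2) = t\<^sup>2 * (\<Sum>i<k. (p i)\<^sup>2)" by (simp add: power_mult_distrib sum_distrib_left)
  also have "\<dots> \<le> t\<^sup>2" using ps by (simp add: mult_left_le)
  also have "\<dots> < 1" using t by (simp add: abs_square_less_1)
  finally have "?q t \<in> std_ball k - std_sphere k"
    using ps by (auto simp: std_ball_def std_sphere_def E_space_iff)
  moreover have "?q t \<in> T" using e(2)[OF t(3)] by simp
  ultimately show ?thesis using T by blast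
qed

text \<open>\<open>I\<close> singles out the points with a Euclidean neighbourhood. At the other points some coordinate
  attains an extremum, which invariance of domain rules out in the interior of a ball.\<close>

lemma ball_boundary:
  fixes C :: "'a::topological_space set"
  assumes hom: "homeomorphism (std_ball k) C f g"
    and ex: "\<exists>x\<in>C. I x"
    and int: "\<And>x. x \<in> C \<Longrightarrow> I x \<Longrightarrow> \<exists>B G. openin (Euclidean_space d) B \<and> continuous_on B G \<and>
       G ` B \<subseteq> C \<and> inj_on G B \<and> x \<in> G ` B"
    and emb: "\<And>x. x \<in> C \<Longrightarrow> \<exists>U \<Theta>. openin (top_of_set C) U \<and> x \<in> U \<and> continuous_on U \<Theta> \<and>
       \<Theta> ` U \<subseteq> E_space d \<and> inj_on \<Theta> U \<and>
       (\<not> I x \<longrightarrow> (\<exists>m<d. \<exists>\<sigma>\<in>{1, -1::real}. \<forall>u\<in>U. \<sigma> * \<Theta> u m \<le> \<sigma> * \<Theta> x m))"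
  shows "k = d" and "f ` std_sphere k = {x \<in> C. \<not> I x}"
proof -
  have f: "continuous_on (std_ball k) f" "f ` std_ball k = C" and g: "continuous_on C g" "g ` C = std_ball k"
    and gf: "\<And>p. p \<in> std_ball k \<Longrightarrow> g (f p) = p" and fg: "\<And>x. x \<in> C \<Longrightarrow> f (g x) = x"
    using hom by (auto simp: homeomorphism_def)
  have injg: "inj_on g C" and injf: "inj_on f (std_ball k)" by (metis inj_onI fg, metis inj_onI gf)
  have ballE: "std_ball k \<subseteq> E_space k" by (auto simp: std_ball_def)
  let ?O = "std_ball k - std_sphere k"
  \<comment> \<open>A nonempty open set of dimension \<open>d\<close> embeds in the ball; this will
    give \<open>d \<le> k\<close>.\<close>
  have intG: "\<exists>B. openin (Euclidean_space d) B \<and> B \<noteq> {} \<and> (\<exists>h. continuous_on B h \<and> h ` B \<subseteq> std_ball k \<and> inj_on h B \<and> g x \<in> h ` B)"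
    if x: "x \<in> C" "I x" for x
  proof -
    obtain B G where BG: "openin (Euclidean_space d) B" "continuous_on B G"
      "G ` B \<subseteq> C" "inj_on G B" "x \<in> G ` B" using int[OF x] by blast
    have "continuous_on B (g \<circ> G)" using BG g continuous_on_compose continuous_on_subset by metis
    moreover have "(g \<circ> G) ` B \<subseteq> std_ball k" using BG g by auto
    moreover have "inj_on (g \<circ> G) B" using BG injg comp_inj_on inj_on_subset by metis
    moreover have "g x \<in> (g \<circ> G) ` B" using BG(5) by auto
    ultimately show ?thesis using BG(1,5) by blast
  qed
  \<comment> \<open>Conversely an open part of the \<open>k\<close>-ball embeds in dimension
    \<open>d\<close>. Cutting down to \<open>?O\<close> makes the domain open in
    \<open>E_space k\<close>; by density it stays nonempty even if \<open>g x\<close> lies on the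
    sphere.\<close>
  have embO: "\<exists>U h. openin (Euclidean_space k) U \<and> U \<noteq> {} \<and> continuous_on U h \<and> h ` U \<subseteq> E_space d \<and> inj_on h U \<and>
      (g x \<in> ?O \<longrightarrow> g x \<in> U) \<and> (\<not> I x \<longrightarrow> (\<exists>m<d. \<exists>\<sigma>\<in>{1, -1::real}. \<forall>u\<in>U. \<sigma> * h u m \<le> \<sigma> * h (g x) m))"
    if x: "x \<in> C" for x
  proof -
    obtain U \<Theta> where U: "openin (top_of_set C) U" "x \<in> U" "continuous_on U \<Theta>"
       "\<Theta> ` U \<subseteq> E_space d" "inj_on \<Theta> U"
       "\<not> I x \<longrightarrow> (\<exists>m<d. \<exists>\<sigma>\<in>{1, -1::real}. \<forall>u\<in>U. \<sigma> * \<Theta> u m \<le> \<sigma> * \<Theta> x m)"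
      using emb[OF x] by blast
    let ?V = "std_ball k \<inter> f -` U"
    have V: "openin (top_of_set (std_ball k)) ?V"
      using continuous_openin_preimage[OF f(1), of C U] f(2) U(1) by auto
    have gV: "g x \<in> ?V" using x U(2) g(2) fg by auto
    have ne: "?V \<inter> ?O \<noteq> {}" using open_std_ball_dense[OF V] gV by blast
    obtain T where T: "open T" "?V = std_ball k \<inter> T" using V by (auto simp: openin_open)
    obtain T' where T': "open T'" "?O = E_space k \<inter> T'" using openin_open_std_ball openin_Euclidean_space_iff by metis
    have "?V \<inter> ?O = E_space k \<inter> (T \<inter> T')" using T T' ballE by blast
    then have op: "openin (Euclidean_space k) (?V \<inter> ?O)"
      unfolding openin_Euclidean_space_iff by (intro exI[of _ "T \<inter> T'"] conjI open_Int T(1) T'(1))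
    have "continuous_on (?V \<inter> ?O) (\<Theta> \<circ> f)"
      by (rule continuous_on_compose) (auto intro: continuous_on_subset[OF f(1)] continuous_on_subset[OF U(3)])
    moreover have "(\<Theta> \<circ> f) ` (?V \<inter> ?O) \<subseteq> E_space d" using U(4) by auto
    moreover have "inj_on (\<Theta> \<circ> f) (?V \<inter> ?O)"
      using injf U(5) by (auto simp: inj_on_def)
    moreover have "\<not> I x \<longrightarrow> (\<exists>m<d. \<exists>\<sigma>\<in>{1, -1::real}. \<forall>u\<in>?V \<inter> ?O. \<sigma> * (\<Theta> \<circ> f) u m \<le> \<sigma> * (\<Theta> \<circ> f) (g x) m)"
    proof
      assume "\<not> I x"
      then obtain m \<sigma> where "m < d" "\<sigma> \<in> {1, -1::real}" "\<forall>u\<in>U. \<sigma> * \<Theta> u m \<le> \<sigma> * \<Theta> x m" using U(6) by blast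
      moreover have "(\<Theta> \<circ> f) (g x) = \<Theta> x" using fg[OF x] by simp
      ultimately show "\<exists>m<d. \<exists>\<sigma>\<in>{1, -1::real}. \<forall>u\<in>?V \<inter> ?O. \<sigma> * (\<Theta> \<circ> f) u m \<le> \<sigma> * (\<Theta> \<circ> f) (g x) m"
        by (intro exI[of _ m] conjI bexI[of _ \<sigma>]) auto
    qed
    moreover have "g x \<in> ?O \<longrightarrow> g x \<in> ?V \<inter> ?O" using gV by blast
    ultimately show ?thesis using op ne by (intro exI[of _ "?V \<inter> ?O"] exI[of _ "\<Theta> \<circ> f"] conjI)
  qed
  obtain x0 where x0: "x0 \<in> C" "I x0" using ex by blast
  have "d \<le> k" using intG[OF x0] invariance_of_dimension_on ballE by (metis subset_trans)
  moreover have "k \<le> d" using embO[OF x0(1)] invariance_of_dimension_on by metis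
  ultimately show kd: "k = d" by simp
  have 1: "g x \<notin> std_sphere k" if x: "x \<in> C" "I x" for x
  proof -
    obtain B h where B: "openin (Euclidean_space k) B" "continuous_on B h" "h ` B \<subseteq> std_ball k" "inj_on h B" "g x \<in> h ` B"
      using intG[OF x] kd by metis
    then have "openin (Euclidean_space k) (h ` B)" using invariance_of_domain_on ballE by (metis subset_trans)
    then show ?thesis using std_sphere_not_interior B by blast
  qed
  have 2: "g x \<in> std_sphere k" if x: "x \<in> C" "\<not> I x" for x
  proof (rule ccontr)
    assume "g x \<notin> std_sphere k"
    then have "g x \<in> ?O" using x g by blast
    then obtain U h where U: "openin (Euclidean_space k) U" "continuous_on U h" "h ` U \<subseteq> E_space k" "inj_on h U"
      "g x \<in> U" "\<exists>m<k. \<exists>\<sigma>\<in>{1, -1::real}. \<forall>u\<in>U. \<sigma> * h u m \<le> \<sigma> * h (g x) m"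
      using embO[OF x(1)] x(2) kd by metis
    then obtain m \<sigma> where m: "m < k" "\<sigma> \<in> {1, -1::real}" "\<forall>u\<in>U. \<sigma> * h u m \<le> \<sigma> * h (g x) m" by blast
    have op: "openin (Euclidean_space k) (h ` U)" using invariance_of_domain_on[OF U(1-4)] .
    obtain e where e: "e > 0" "\<And>t. \<bar>t\<bar> < e \<Longrightarrow> (h (g x))(m := h (g x) m + t) \<in> h ` U"
      using open_Euclidean_space_perturb[OF op _ m(1), of "h (g x)"] U(5) by blast
    have "\<bar>\<sigma> * (e/2)\<bar> < e" using e(1) m(2) by auto
    then obtain u where "u \<in> U" "(h (g x))(m := h (g x) m + \<sigma> * (e/2)) = h u" using e(2) by blast
    then have "\<sigma> * (h (g x) m + \<sigma> * (e/2)) \<le> \<sigma> * h (g x) m" using m(3) by (metis fun_upd_same)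
    then show False using e(1) m(2) by (auto simp: algebra_simps)
  qed
  show "f ` std_sphere k = {x \<in> C. \<not> I x}"
  proof (intro equalityI subsetI)
    fix x assume "x \<in> f ` std_sphere k"
    then obtain p where p: "p \<in> std_sphere k" "x = f p" by blast
    then have "p \<in> std_ball k" using std_sphere_subset_ball by blast
    then show "x \<in> {x \<in> C. \<not> I x}" using 1[of x] gf[of p] f(2) p by auto
  next
    fix x assume "x \<in> {x \<in> C. \<not> I x}"
    then show "x \<in> f ` std_sphere k" using 2[of x] fg[of x] by force
  qed
qed

section \<open>Hemispheres and the topology of spheres\<close>

definition hemisphere :: "nat \<Rightarrow> real \<Rightarrow> (nat \<Rightarrow> real) set" where
  "hemisphere k \<epsilon> = {x \<in> std_sphere (Suc k). 0 \<le> \<epsilon> * x k}"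

text \<open>The linear contraction of the equatorial disc, lifted to the hemisphere.\<close>

definition hemi_contr :: "nat \<Rightarrow> real \<Rightarrow> real \<times> (nat \<Rightarrow> real) \<Rightarrow> nat \<Rightarrow> real" where
  "hemi_contr k \<epsilon> z = (\<lambda>i. if i < k then fst z * snd z i
      else if i = k then \<epsilon> * sqrt (1 - (fst z)\<^sup>2 * (\<Sum>i<k. (snd z i)\<^sup>2)) else 0)"

lemma hemi_contr:
  assumes "\<epsilon> \<in> {1, -1}"
  shows "continuous_on ({0..1} \<times> hemisphere k \<epsilon>) (hemi_contr k \<epsilon>)"
    and "hemi_contr k \<epsilon> ` ({0..1} \<times> hemisphere k \<epsilon>) \<subseteq> hemisphere k \<epsilon>"
    and "hemi_contr k \<epsilon> (0, p) = (\<lambda>i. if i = k then \<epsilon> else 0)"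
    and "p \<in> hemisphere k \<epsilon> \<Longrightarrow> hemi_contr k \<epsilon> (1, p) = p"
proof -
  have c: "continuous_on S (\<lambda>z::real \<times> (nat \<Rightarrow> real). snd z i)" for S i
    using continuous_on_compose2[OF continuous_on_product_coordinates[of i] continuous_on_snd[OF continuous_on_id]] by auto
  show "continuous_on ({0..1} \<times> hemisphere k \<epsilon>) (hemi_contr k \<epsilon>)"
  proof (rule continuous_on_coordinatewise_then_product)
    fix i
    show "continuous_on ({0..1} \<times> hemisphere k \<epsilon>) (\<lambda>z. hemi_contr k \<epsilon> z i)"
      unfolding hemi_contr_def
      by (cases "i < k"; cases "i = k") (auto intro!: continuous_intros c)
  qed
  have sq: "(\<Sum>i<k. (p i)\<^sup>2) \<le> 1" if "p \<in> hemisphere k \<epsilon>" for p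
    using that by (auto simp: hemisphere_def std_sphere_def) (smt (verit) zero_le_power2)
  have e3: "\<epsilon>\<^sup>2 = 1" using assms by auto
  have e2: "(\<epsilon> * a)\<^sup>2 = a\<^sup>2" "\<epsilon> * (\<epsilon> * a) = a" for a using assms by auto
  show "hemi_contr k \<epsilon> ` ({0..1} \<times> hemisphere k \<epsilon>) \<subseteq> hemisphere k \<epsilon>"
  proof clarify
    fix t :: real and p assume t: "t \<in> {0..1}" and p: "p \<in> hemisphere k \<epsilon>"
    have "t\<^sup>2 * (\<Sum>i<k. (p i)\<^sup>2) \<le> 1"
      using t sq[OF p] by (intro mult_le_one) (auto simp: sum_nonneg power_le_one)
    then show "hemi_contr k \<epsilon> (t, p) \<in> hemisphere k \<epsilon>"
      by (auto simp: hemisphere_def std_sphere_def hemi_contr_def E_space_iff e2 power_mult_distrib sum_distrib_left[symmetric] e3)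
  qed
  show "hemi_contr k \<epsilon> (0, p) = (\<lambda>i. if i = k then \<epsilon> else 0)"
    by (auto simp: hemi_contr_def)
  show "hemi_contr k \<epsilon> (1, p) = p" if p: "p \<in> hemisphere k \<epsilon>"
  proof
    fix i
    have "1 - (\<Sum>i<k. (p i)\<^sup>2) = (p k)\<^sup>2" "0 \<le> \<epsilon> * p k" "\<And>i. i > k \<Longrightarrow> p i = 0"
      using p by (auto simp: hemisphere_def std_sphere_def E_space_iff)
    then have "\<epsilon> * sqrt (1 - (\<Sum>i<k. (p i)\<^sup>2)) = p k"
      using assms by auto
    then show "hemi_contr k \<epsilon> (1, p) i = p i"
      using \<open>\<And>i. i > k \<Longrightarrow> p i = 0\<close> by (auto simp: hemi_contr_def)
  qed
qed

lemma closed_std_sphere: "closed (std_sphere k)"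
proof -
  have "std_sphere k = E_space k \<inter> {x. (\<Sum>i<k. (x i)\<^sup>2) = 1}" by (auto simp: std_sphere_def)
  moreover have "closed (E_space k)" using closedin_Euclidean_imp_closed by blast
  moreover have "closed {x::nat \<Rightarrow> real. (\<Sum>i<k. (x i)\<^sup>2) = 1}"
    by (intro closed_Collect_eq continuous_intros continuous_on_product_coordinates)
  ultimately show ?thesis by auto
qed

lemma closed_hemisphere: "closed (hemisphere k \<epsilon>)"
proof -
  have "hemisphere k \<epsilon> = std_sphere (Suc k) \<inter> {x. 0 \<le> \<epsilon> * x k}" by (auto simp: hemisphere_def)
  moreover have "closed {x::nat \<Rightarrow> real. 0 \<le> \<epsilon> * x k}"
    by (intro closed_Collect_le continuous_intros continuous_on_product_coordinates)
  ultimately show ?thesis using closed_std_sphere by auto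
qed

lemma hemispheres_Un: "hemisphere k 1 \<union> hemisphere k (-1) = std_sphere (Suc k)"
  by (auto simp: hemisphere_def)

lemma hemispheres_Int: "hemisphere k 1 \<inter> hemisphere k (-1) = std_sphere k"
proof (intro equalityI subsetI)
  fix x assume "x \<in> hemisphere k 1 \<inter> hemisphere k (-1)"
  then have x: "x \<in> std_sphere (Suc k)" "x k = 0" by (auto simp: hemisphere_def)
  then have "x i = 0" if "i \<ge> k" for i
    using that by (cases "i = k") (auto simp: std_sphere_def E_space_iff)
  then show "x \<in> std_sphere k" using x by (auto simp: std_sphere_def E_space_iff)
qed (auto simp: hemisphere_def std_sphere_def E_space_iff)

lemma std_sphere_nonempty: "k \<ge> 1 \<Longrightarrow> std_sphere k \<noteq> {}"
proof -
  assume "k \<ge> 1"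
  then have "(\<lambda>i. if i = 0 then 1 else 0) \<in> std_sphere k"
    by (auto simp: std_sphere_def E_space_iff if_distrib[of "\<lambda>x. x\<^sup>2"] cong: if_cong)
  then show ?thesis by blast
qed

text \<open>Every point is joined to the pole by its track under the contraction.\<close>

lemma connected_hemisphere:
  assumes "\<epsilon> \<in> {1, -1}" shows "connected (hemisphere k \<epsilon>)"
proof (rule connectedI_const)
  fix P :: "(nat \<Rightarrow> real) \<Rightarrow> bool"
  assume P: "continuous_on (hemisphere k \<epsilon>) P"
  have "P p = P (\<lambda>i. if i = k then \<epsilon> else 0)" if p: "p \<in> hemisphere k \<epsilon>" for p
  proof -
    have "continuous_on {0..1} (\<lambda>t. hemi_contr k \<epsilon> (t, p))"
      by (rule continuous_on_compose2[OF hemi_contr(1)[OF assms]]) (use p in \<open>auto intro!: continuous_intros\<close>)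
    then have c: "continuous_on {0..1} (\<lambda>t. P (hemi_contr k \<epsilon> (t, p)))"
      by (rule continuous_on_compose2[OF P]) (use hemi_contr(2)[OF assms] p in auto)
    have "(\<lambda>t. P (hemi_contr k \<epsilon> (t, p))) constant_on {0..1}"
      using connectedD_const[OF _ c] by (auto simp: constant_on_def)
    then have "P (hemi_contr k \<epsilon> (0, p)) = P (hemi_contr k \<epsilon> (1, p))"
      unfolding constant_on_def by force
    then show ?thesis using hemi_contr(3,4)[OF assms] p by simp
  qed
  then show "\<exists>c. \<forall>s\<in>hemisphere k \<epsilon>. P s = c" by blast
qed

text \<open>\<open>std_sphere k\<close> has dimension \<open>k - 1\<close>, so the bound excludes
  the two-point sphere.\<close>

lemma connected_std_sphere:
  assumes "k \<ge> 2" shows "connected (std_sphere k)"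
proof -
  obtain m where m: "k = Suc m" "m \<ge> 1" using assms by (cases k) auto
  show ?thesis unfolding m hemispheres_Un[symmetric]
    by (rule connected_Un) (use connected_hemisphere std_sphere_nonempty m hemispheres_Int in auto)
qed

text \<open>This stands for simple connectivity of the sphere: the hemispheres are contractible and
  meet in the equator \<open>std_sphere m\<close>, which is connected because
  \<open>m \<ge> 2\<close>.\<close>

lemma (in local_system) trivial_over_std_sphere:
  assumes "k \<ge> 3" "continuous_on (std_sphere k) f" "f ` std_sphere k \<subseteq> Y"
  shows "trivial_over (std_sphere k) f"
proof -
  obtain m where m: "k = Suc m" "m \<ge> 2" using assms(1) by (cases k) auto
  have hemi: "trivial_over (hemisphere m \<epsilon>) f" if \<epsilon>: "\<epsilon> \<in> {1, -1}" for \<epsilon>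
  proof (rule trivial_over_contractible[OF hemi_contr(1,2)[OF \<epsilon>]])
    show "continuous_on (hemisphere m \<epsilon>) f" "f ` hemisphere m \<epsilon> \<subseteq> Y"
      using assms(2,3) m by (auto simp: hemisphere_def intro: continuous_on_subset)
  qed (use hemi_contr(3,4)[OF \<epsilon>] in auto)
  show ?thesis unfolding m hemispheres_Un[symmetric]
    by (rule trivial_over_Un)
      (use hemi connected_std_sphere[OF m(2)] std_sphere_nonempty m closed_hemisphere hemispheres_Int in auto)
qed

section \<open>Paths in balls, and balls of dimension 0 and 1\<close>

lemma std_ball_convex:
  assumes "p \<in> std_ball k" "q \<in> std_ball k" "t \<in> {0..1}"
  shows "(\<lambda>i. (1 - t) * p i + t * q i) \<in> std_ball k"
proof -
  have "((1 - t) * p i + t * q i)\<^sup>2 \<le> (1 - t) * (p i)\<^sup>2 + t * (q i)\<^sup>2" for i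
  proof -
    have "(1 - t) * (p i)\<^sup>2 + t * (q i)\<^sup>2 - ((1 - t) * p i + t * q i)\<^sup>2 = (t * (1 - t)) * (p i - q i)\<^sup>2"
      by (simp add: power2_eq_square algebra_simps)
    moreover have "\<dots> \<ge> 0" using assms(3) by (intro mult_nonneg_nonneg) auto
    ultimately show ?thesis by linarith
  qed
  then have "(\<Sum>i<k. ((1 - t) * p i + t * q i)\<^sup>2) \<le> (\<Sum>i<k. (1 - t) * (p i)\<^sup>2 + t * (q i)\<^sup>2)"
    by (intro sum_mono)
  also have "\<dots> = (1 - t) * (\<Sum>i<k. (p i)\<^sup>2) + t * (\<Sum>i<k. (q i)\<^sup>2)"
    by (simp add: sum.distrib sum_distrib_left)
  also have "\<dots> \<le> 1"
    using assms by (intro convex_bound_le) (auto simp: std_ball_def)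
  finally show ?thesis using assms by (auto simp: std_ball_def E_space_iff)
qed

text \<open>The straight-line homotopy in the convex standard ball, transported to
  \<open>C\<close>.\<close>

lemma is_ball_homotopic_paths:
  assumes "is_ball k C" "path p" "path q" "path_image p \<subseteq> C" "path_image q \<subseteq> C"
    "pathstart p = pathstart q" "pathfinish p = pathfinish q"
  shows "homotopic_paths C p q"
proof -
  obtain g f where fg: "homeomorphism C (std_ball k) g f"
    using assms(1) by (auto simp: is_ball_def homeomorphic_def)
  then have f: "continuous_on (std_ball k) f" "f ` std_ball k = C" and g: "continuous_on C g" "g ` C = std_ball k"
    and fg': "\<And>x. x \<in> C \<Longrightarrow> f (g x) = x"
    by (auto simp: homeomorphism_def)
  have pq: "continuous_on {0..1} p" "continuous_on {0..1} q" "p ` {0..1} \<subseteq> C" "q ` {0..1} \<subseteq> C"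
    "p 0 = q 0" "p 1 = q 1"
    using assms by (auto simp: path_def path_image_def pathstart_def pathfinish_def)
  let ?m = "\<lambda>z i. (1 - fst z) * g (p (snd z)) i + fst z * g (q (snd z)) i"
  have gp: "continuous_on ({0..1} \<times> {0..1}) (\<lambda>z::real\<times>real. g (p (snd z)) i)"
    "continuous_on ({0..1} \<times> {0..1}) (\<lambda>z::real\<times>real. g (q (snd z)) i)" for i
  proof -
    have "continuous_on C (\<lambda>x. g x i)" using g(1) by (rule continuous_on_product_then_coordinatewise)
    moreover have "continuous_on ({0..1} \<times> {0..1}) (\<lambda>z::real\<times>real. p (snd z))"
      "continuous_on ({0..1} \<times> {0..1}) (\<lambda>z::real\<times>real. q (snd z))"
      by (rule continuous_on_compose2[OF pq(1)] continuous_on_compose2[OF pq(2)]; auto intro!: continuous_intros)+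
    ultimately show "continuous_on ({0..1} \<times> {0..1}) (\<lambda>z::real\<times>real. g (p (snd z)) i)"
    "continuous_on ({0..1} \<times> {0..1}) (\<lambda>z::real\<times>real. g (q (snd z)) i)"
      using pq(3,4) by (auto intro!: continuous_on_compose2[of C "\<lambda>x. g x i"])
  qed
  have cm: "continuous_on ({0..1} \<times> {0..1}) ?m"
    by (intro continuous_on_coordinatewise_then_product continuous_intros gp)
  have mb: "?m z \<in> std_ball k" if "z \<in> {0..1} \<times> {0..1}" for z
  proof (rule std_ball_convex)
    have "p (snd z) \<in> C" "q (snd z) \<in> C" using that pq(3,4) by auto
    then show "g (p (snd z)) \<in> std_ball k" "g (q (snd z)) \<in> std_ball k" using g(2) by blast+
  qed (use that in auto)
  have "continuous_on ({0..1} \<times> {0..1}) (\<lambda>z. f (?m z))"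
    by (rule continuous_on_compose2[OF f(1) cm]) (use mb in auto)
  moreover have "(\<lambda>z. f (?m z)) \<in> ({0..1} \<times> {0..1}) \<rightarrow> C" using mb f(2) by blast
  moreover have "f (g (p x)) = p x" "f (g (q x)) = q x" if "x \<in> {0..1}" for x
    using that pq(3,4) by (auto intro!: fg')
  ultimately show ?thesis
    unfolding homotopic_paths
    by (intro exI[of _ "\<lambda>z. f (?m z)"])
      (use pq(5,6) in \<open>auto simp: pathstart_def pathfinish_def algebra_simps\<close>)
qed

lemma is_ball_path_connected:
  assumes "is_ball k C" "x \<in> C" "y \<in> C"
  obtains p where "path p" "path_image p \<subseteq> C" "pathstart p = x" "pathfinish p = y"
proof -
  obtain g f where fg: "homeomorphism C (std_ball k) g f"
    using assms(1) by (auto simp: is_ball_def homeomorphic_def)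
  then have f: "continuous_on (std_ball k) f" "f ` std_ball k = C" and g: "g ` C = std_ball k"
    and fg': "\<And>x. x \<in> C \<Longrightarrow> f (g x) = x"
    by (auto simp: homeomorphism_def)
  let ?m = "\<lambda>t i. (1 - t) * g x i + t * g y i"
  have cm: "continuous_on {0..1} ?m"
    by (intro continuous_on_coordinatewise_then_product continuous_intros)
  have mb: "?m t \<in> std_ball k" if "t \<in> {0..1}" for t
    using that assms g by (intro std_ball_convex) auto
  have "continuous_on {0..1} (\<lambda>t. f (?m t))"
    by (rule continuous_on_compose2[OF f(1) cm]) (use mb in auto)
  moreover have "(\<lambda>t. f (?m t)) ` {0..1} \<subseteq> C" using mb f(2) by blast
  ultimately show thesis
    using that[of "\<lambda>t. f (?m t)"] fg' assms(2,3)
    by (simp add: path_def path_image_def pathstart_def pathfinish_def)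
qed

lemma std_ball_0: "std_ball 0 = {\<lambda>_. 0}"
  by (auto simp: std_ball_def E_space_iff)

lemma std_sphere_1: "std_sphere 1 = {(\<lambda>i. if i = 0 then 1 else 0), (\<lambda>i. if i = 0 then -1 else 0)}"
proof (intro equalityI subsetI)
  fix x assume "x \<in> std_sphere 1"
  then have "(x 0)\<^sup>2 = 1" "\<forall>i\<ge>1. x i = 0" by (auto simp: std_sphere_def E_space_iff)
  then have "(x 0 = 1 \<or> x 0 = -1)" "\<And>i. i \<noteq> 0 \<Longrightarrow> x i = 0" by (auto simp: power2_eq_1_iff)
  then show "x \<in> {(\<lambda>i. if i = 0 then 1 else 0), (\<lambda>i. if i = 0 then -1 else 0)}" by (auto simp: fun_eq_iff)
qed (auto simp: std_sphere_def E_space_iff)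

lemma std_ball_1_arc:
  fixes C :: "'a::t2_space set"
  assumes hom: "homeomorphism (std_ball 1) C f g" and uw: "f ` std_sphere 1 = {u, w}"
  obtains a where "arc a" "path_image a = C" "pathstart a = u" "pathfinish a = w"
proof -
  have f: "continuous_on (std_ball 1) f" "f ` std_ball 1 = C"
    and gf: "\<And>p. p \<in> std_ball 1 \<Longrightarrow> g (f p) = p"
    using hom by (auto simp: homeomorphism_def)
  let ?m = "\<lambda>t::real. \<lambda>i::nat. if i = 0 then 2 * t - 1 else 0"
  have ball: "std_ball 1 = ?m ` {0..1}"
  proof (intro equalityI subsetI)
    fix x assume "x \<in> std_ball 1"
    then have x: "(x 0)\<^sup>2 \<le> 1" "\<And>i. i \<noteq> 0 \<Longrightarrow> x i = 0" by (auto simp: std_ball_def E_space_iff)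
    then have "\<bar>x 0\<bar> \<le> 1" by (simp add: abs_square_le_1)
    then show "x \<in> ?m ` {0..1}" using x(2) by (intro image_eqI[of _ _ "(x 0 + 1) / 2"]) (auto simp: fun_eq_iff field_simps)
  next
    fix x assume "x \<in> ?m ` {0..1}"
    then show "x \<in> std_ball 1" by (auto simp: std_ball_def E_space_iff abs_square_le_1)
  qed
  have cm: "continuous_on {0..1} ?m"
  proof (rule continuous_on_coordinatewise_then_product)
    fix i :: nat show "continuous_on {0..1} (\<lambda>t. ?m t i)" by (cases "i = 0") (auto intro!: continuous_intros)
  qed
  define a where "a t = f (?m t)" for t
  have pa: "path a" unfolding path_def a_def
    by (rule continuous_on_compose2[OF f(1) cm]) (use ball in auto)
  have im: "path_image a = C" unfolding path_image_def a_def using f(2) ball by auto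
  have "inj_on a {0..1}"
  proof (rule inj_onI)
    fix s t assume "s \<in> {0..1}" "t \<in> {0..1}" "a s = a t"
    then have "g (f (?m s)) = g (f (?m t))" "?m s \<in> std_ball 1" "?m t \<in> std_ball 1"
      using ball unfolding a_def by auto
    then have "?m s = ?m t" using gf by simp
    from fun_cong[OF this, of 0] show "s = t" by simp
  qed
  then have arc: "arc a" using pa by (simp add: arc_def)
  have "f ` std_sphere 1 = {a 1, a 0}"
    unfolding std_sphere_1 a_def image_insert image_empty by (simp cong: if_cong)
  then have "{a 0, a 1} = {u, w}" using uw by (simp add: insert_commute)
  \<comment> \<open>The homeomorphism may match the endpoints in either order; in the second case
    the arc is reversed.\<close>
  then consider "a 0 = u" "a 1 = w" | "a 0 = w" "a 1 = u" by (auto simp: doubleton_eq_iff)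
  then show thesis
  proof cases
    case 1 then show thesis using that[of a] arc im by (simp add: pathstart_def pathfinish_def)
  next
    case 2 then show thesis using that[of "reversepath a"] arc im
      by (simp add: arc_reversepath pathstart_def[of a] pathfinish_def[of a])
  qed
qed

section \<open>Cells of a layered complex\<close>

text \<open>\<open>card_v\<close> is what the cell structure needs of the coloring at the base
  vertex: so many distinct regions at one point exclude that a region belongs to two layers.\<close>

locale layered_complex =
  fixes n j :: nat and M :: "'a::t2_space set" and X :: "nat \<Rightarrow> 'a set set" and v :: 'a
  assumes ecpx: "layer_ecpx n M j X"
    and conn: "connected M"
    and vM: "v \<in> M"
    and card_v: "card (regions_at n j X v) = n + j"
begin

abbreviation L :: "nat \<Rightarrow> 'a set set" where "L i \<equiv> cells_of_dim n (X i)"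
abbreviation Rg :: "'a set set" where "Rg \<equiv> regions n j X"
abbreviation R :: "'a \<Rightarrow> 'a set set" where "R x \<equiv> regions_at n j X x"

section \<open>Fan charts\<close>

definition star :: "nat \<Rightarrow> 'a \<Rightarrow> 'a set set" where "star i x = {r \<in> L i. x \<in> r}"

text \<open>Cells are handled through such sets of regions rather than as point sets; dimension and
  incidence can then be read off from cardinality and inclusion.\<close>

definition hits :: "'a set set \<Rightarrow> bool" where
  "hits A \<longleftrightarrow> A \<subseteq> Rg \<and> (\<forall>i<j. A \<inter> L i \<noteq> {})"

text \<open>The function \<open>y\<close> of \<open>transverse_at\<close>. It is called the height
  of \<open>s\<close> below: near \<open>x\<close>, a region of layer \<open>i\<close> through
  \<open>x\<close> is the set where its own height is maximal, and \<open>b i\<close> is normalized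
  to height 0.\<close>

definition fan_coord :: "('a \<Rightarrow> nat \<Rightarrow> real) \<Rightarrow> (nat \<Rightarrow> 'a set) \<Rightarrow> (nat \<times> 'a set \<Rightarrow> nat) \<Rightarrow> nat \<Rightarrow> 'a set \<Rightarrow> 'a \<Rightarrow> real" where
  "fan_coord \<psi> b c i s u = (if s = b i then 0 else \<psi> u (c (i, s)))"

text \<open>The witnesses of \<open>transverse_at\<close> at \<open>x\<close>, together with an
  inverse \<open>g\<close> of the chart.\<close>

definition fan_chart where
  "fan_chart x U \<psi> g b c \<longleftrightarrow> openin (top_of_set M) U \<and> x \<in> U \<and> openin (Euclidean_space n) (\<psi> ` U) \<and>
     homeomorphism U (\<psi> ` U) \<psi> g \<and> (\<forall>i<j. b i \<in> star i x) \<and>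
     inj_on c (SIGMA i:{..<j}. star i x - {b i}) \<and>
     c ` (SIGMA i:{..<j}. star i x - {b i}) \<subseteq> {..<n} \<and>
     (\<forall>i<j. \<forall>r\<in>star i x. \<forall>u\<in>U. u \<in> r \<longleftrightarrow> (\<forall>s\<in>star i x. fan_coord \<psi> b c i s u \<le> fan_coord \<psi> b c i r u)) \<and>
     (\<forall>i<j. \<forall>r\<in>L i. x \<notin> r \<longrightarrow> r \<inter> U = {})"

lemma j_pos: "1 \<le> j"
  using ecpx by (simp add: layer_ecpx_def layer_cpx_def)

lemma cell_complex: "i < j \<Longrightarrow> cell_complex_on M (X i)"
  using ecpx by (simp add: layer_ecpx_def layer_cpx_def cpx_def)

lemma finite_Rg: "finite Rg"
  using cell_complex by (auto simp: regions_def cells_of_dim_def cell_complex_on_def)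

lemma region_subset: "r \<in> Rg \<Longrightarrow> r \<subseteq> M"
  using cell_complex by (fastforce simp: regions_def cells_of_dim_def cell_complex_on_def)

lemma R_eq: "R x = (\<Union>i<j. star i x)"
  by (auto simp: regions_at_def regions_def star_def)

lemma finite_star: "i < j \<Longrightarrow> finite (star i x)"
  using cell_complex by (auto simp: star_def cells_of_dim_def cell_complex_on_def)

lemma fan_chart_exists:
  assumes "x \<in> M"
  shows "\<exists>U \<psi> g b c. fan_chart x U \<psi> g b c"
proof -
  have "transverse_at n M j X x" using ecpx assms by (simp add: layer_ecpx_def layer_cpx_def)
  then have "\<exists>U \<psi> b c. chart_on n M U \<psi> \<and> x \<in> U \<and> (\<forall>i<j. b i \<in> star i x) \<and>
     inj_on c (SIGMA i:{..<j}. star i x - {b i}) \<and>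
     c ` (SIGMA i:{..<j}. star i x - {b i}) \<subseteq> {..<n} \<and>
     (\<forall>i<j. \<forall>r\<in>L i. r \<inter> U = (if x \<in> r then {u \<in> U. \<forall>s\<in>star i x. fan_coord \<psi> b c i s u \<le> fan_coord \<psi> b c i r u} else {}))"
    unfolding transverse_at_def Let_def star_def fan_coord_def .
  then obtain U \<psi> b c where *: "chart_on n M U \<psi>" "x \<in> U" "\<forall>i<j. b i \<in> star i x"
     "inj_on c (SIGMA i:{..<j}. star i x - {b i})"
     "c ` (SIGMA i:{..<j}. star i x - {b i}) \<subseteq> {..<n}"
     "\<forall>i<j. \<forall>r\<in>L i. r \<inter> U = (if x \<in> r then {u \<in> U. \<forall>s\<in>star i x. fan_coord \<psi> b c i s u \<le> fan_coord \<psi> b c i r u} else {})"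
    by (elim exE conjE) (rule that)
  have ch: "openin (top_of_set M) U" "openin (Euclidean_space n) (\<psi> ` U)"
     "homeomorphic_map (top_of_set U) (subtopology (Euclidean_space n) (\<psi> ` U)) \<psi>"
    using *(1) by (auto simp: chart_on_def)
  have "subtopology (Euclidean_space n) (\<psi> ` U) = top_of_set (\<psi> ` U)"
    using ch(2) openin_subset by (metis Euclidean_space_eq_top_of_set subtopology_subtopology inf.absorb2)
  then obtain g where "homeomorphism U (\<psi> ` U) \<psi> g"
    using ch(3) unfolding homeomorphic_map_maps by (auto simp: homeomorphic_maps_iff_homeomorphism)
  moreover have "\<forall>i<j. \<forall>r\<in>star i x. \<forall>u\<in>U. u \<in> r \<longleftrightarrow> (\<forall>s\<in>star i x. fan_coord \<psi> b c i s u \<le> fan_coord \<psi> b c i r u)"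
  proof (intro allI impI ballI)
    fix i r u assume i: "i < j" "r \<in> star i x" "u \<in> U"
    then have "r \<inter> U = {u \<in> U. \<forall>s\<in>star i x. fan_coord \<psi> b c i s u \<le> fan_coord \<psi> b c i r u}"
      using *(6) by (simp add: star_def)
    then show "u \<in> r \<longleftrightarrow> (\<forall>s\<in>star i x. fan_coord \<psi> b c i s u \<le> fan_coord \<psi> b c i r u)" using i(3) by blast
  qed
  moreover have "\<forall>i<j. \<forall>r\<in>L i. x \<notin> r \<longrightarrow> r \<inter> U = {}" using *(6) by simp
  ultimately show ?thesis unfolding fan_chart_def using *(2-5) ch(1,2)
    by (intro exI[of _ U] exI[of _ \<psi>] exI[of _ g] exI[of _ b] exI[of _ c] conjI) assumption+
qed

context
  fixes x U \<psi> g b c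
  assumes fc: "fan_chart x U \<psi> g b c"
begin

lemma fc_U: "openin (top_of_set M) U" "x \<in> U" "openin (Euclidean_space n) (\<psi> ` U)"
  and fc_hom: "homeomorphism U (\<psi> ` U) \<psi> g"
  and fc_b: "i < j \<Longrightarrow> b i \<in> star i x"
  and fc_inj: "inj_on c (SIGMA i:{..<j}. star i x - {b i})"
  and fc_c: "c ` (SIGMA i:{..<j}. star i x - {b i}) \<subseteq> {..<n}"
  and fc_mem: "i < j \<Longrightarrow> r \<in> star i x \<Longrightarrow> u \<in> U \<Longrightarrow>
     u \<in> r \<longleftrightarrow> (\<forall>s\<in>star i x. fan_coord \<psi> b c i s u \<le> fan_coord \<psi> b c i r u)"
  and fc_disj: "i < j \<Longrightarrow> r \<in> L i \<Longrightarrow> x \<notin> r \<Longrightarrow> r \<inter> U = {}"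
  using fc unfolding fan_chart_def by (elim conjE; simp)+

lemma fc_homD: "continuous_on U \<psi>" "continuous_on (\<psi> ` U) g" "u \<in> U \<Longrightarrow> g (\<psi> u) = u"
   "z \<in> \<psi> ` U \<Longrightarrow> \<psi> (g z) = z" "z \<in> \<psi> ` U \<Longrightarrow> g z \<in> U" "\<psi> ` U \<subseteq> E_space n" "U \<subseteq> M"
  using fc_hom fc_U openin_subset[OF fc_U(3)] openin_subset[OF fc_U(1)] by (auto simp: homeomorphism_def)

text \<open>The point \<open>x\<close> lies in all regions of its star, so all heights at
  \<open>x\<close> are maximal and equal that of \<open>b i\<close>.\<close>

lemma fc_zero: "i < j \<Longrightarrow> s \<in> star i x \<Longrightarrow> fan_coord \<psi> b c i s x = 0"
proof -
  assume i: "i < j" and s: "s \<in> star i x"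
  have "fan_coord \<psi> b c i s x \<le> fan_coord \<psi> b c i (b i) x"
    using fc_mem[OF i fc_b[OF i] fc_U(2)] fc_b[OF i] s by (auto simp: star_def)
  moreover have "fan_coord \<psi> b c i (b i) x \<le> fan_coord \<psi> b c i s x"
    using fc_mem[OF i s fc_U(2)] fc_b[OF i] s by (auto simp: star_def)
  ultimately show ?thesis by (simp add: fan_coord_def)
qed

lemma fc_zero': "i < j \<Longrightarrow> s \<in> star i x - {b i} \<Longrightarrow> \<psi> x (c (i, s)) = 0"
  using fc_zero[of i s] by (auto simp: fan_coord_def)

lemma fc_R_subset: "u \<in> U \<Longrightarrow> R u \<subseteq> R x"
  using fc_disj by (auto simp: regions_at_def regions_def)

lemma fc_c_less: "i < j \<Longrightarrow> s \<in> star i x - {b i} \<Longrightarrow> c (i, s) < n"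
  using imageI[of "(i, s)" "SIGMA i:{..<j}. star i x - {b i}" c] subsetD[OF fc_c] by simp

lemma fc_c_eq: "i < j \<Longrightarrow> s \<in> star i x - {b i} \<Longrightarrow> i' < j \<Longrightarrow> s' \<in> star i' x - {b i'} \<Longrightarrow>
    c (i, s) = c (i', s') \<longleftrightarrow> i = i' \<and> s = s'"
  using inj_on_eq_iff[OF fc_inj, of "(i, s)" "(i', s')"] by simp

text \<open>The regions other than the \<open>b i\<close> occupy distinct coordinates, of which
  there are \<open>n\<close>, and each layer contributes one \<open>b i\<close>.\<close>

lemma fc_card: "card (SIGMA i:{..<j}. star i x) = card (SIGMA i:{..<j}. star i x - {b i}) + j"
  "card (SIGMA i:{..<j}. star i x - {b i}) \<le> n"
proof -
  have "card (star i x) = card (star i x - {b i}) + 1" if "i < j" for i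
    using finite_star[OF that] fc_b[OF that] by (metis Suc_eq_plus1 card.remove)
  then have "(\<Sum>i<j. card (star i x)) = (\<Sum>i<j. card (star i x - {b i}) + 1)"
    by (intro sum.cong) auto
  then show "card (SIGMA i:{..<j}. star i x) = card (SIGMA i:{..<j}. star i x - {b i}) + j"
    using finite_star by (simp add: sum_Suc)
  show "card (SIGMA i:{..<j}. star i x - {b i}) \<le> n"
    using card_inj_on_le[OF fc_inj fc_c] by simp
qed

text \<open>Independence of the normal directions: one height can be varied while all others, in all
  layers, stay 0.\<close>

lemma fc_perturb:
  assumes "i < j" "s \<in> star i x - {b i}"
  obtains e where "e > 0" "\<And>t. \<bar>t\<bar> < e \<Longrightarrow> \<exists>u\<in>U. \<forall>i'<j. \<forall>s'\<in>star i' x.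
      fan_coord \<psi> b c i' s' u = (if i' = i \<and> s' = s then t else 0)"
proof -
  have "\<psi> x \<in> \<psi> ` U" using fc_U by blast
  from open_Euclidean_space_perturb[OF fc_U(3) this fc_c_less[OF assms]]
  obtain e where e: "e > 0" "\<And>t. \<bar>t\<bar> < e \<Longrightarrow> (\<psi> x)(c (i, s) := \<psi> x (c (i, s)) + t) \<in> \<psi> ` U" by blast
  show thesis
  proof (rule that[OF e(1)])
    fix t :: real assume t: "\<bar>t\<bar> < e"
    let ?z = "(\<psi> x)(c (i, s) := \<psi> x (c (i, s)) + t)"
    have "fan_coord \<psi> b c i' s' (g ?z) = (if i' = i \<and> s' = s then t else 0)"
      if "i' < j" "s' \<in> star i' x" for i' s'
    proof (cases "s' = b i'")
      case True
      then show ?thesis using assms by (auto simp: fan_coord_def)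
    next
      case False
      then have s': "s' \<in> star i' x - {b i'}" using that by blast
      show ?thesis
        using False fc_homD(4)[OF e(2)[OF t]] fc_c_eq[OF that(1) s' assms] fc_zero'[OF assms] fc_zero'[OF that(1) s']
        by (auto simp: fan_coord_def)
    qed
    then show "\<exists>u\<in>U. \<forall>i'<j. \<forall>s'\<in>star i' x. fan_coord \<psi> b c i' s' u = (if i' = i \<and> s' = s then t else 0)"
      using fc_homD(5)[OF e(2)[OF t]] by blast
  qed
qed

end

lemma card_stars_le: "x \<in> M \<Longrightarrow> card (SIGMA i:{..<j}. star i x) \<le> n + j"
  using fan_chart_exists[of x] fc_card[of x] by auto

lemma R_eq_image: "R x = snd ` (SIGMA i:{..<j}. star i x)"
  by (force simp: R_eq)

text \<open>A region belonging to two layers would be open and hence equal to \<open>M\<close>; then fewer than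
  \<open>n + j\<close> regions would meet at \<open>v\<close>.\<close>

lemma layers_disjoint:
  assumes "i < j" "i' < j" "i \<noteq> i'"
  shows "L i \<inter> L i' = {}"
proof (rule ccontr)
  assume "L i \<inter> L i' \<noteq> {}"
  then obtain r where r: "r \<in> L i" "r \<in> L i'" by blast
  have rM: "r \<subseteq> M" using r assms by (intro region_subset) (auto simp: regions_def)
  have star: "star i x = {r}" if x: "x \<in> r" for x
  proof (rule ccontr)
    assume "star i x \<noteq> {r}"
    moreover have rs: "r \<in> star i x" "r \<in> star i' x" using r x by (auto simp: star_def)
    ultimately obtain s where s: "s \<in> star i x" "s \<noteq> r" by blast
    obtain U \<psi> g b c where fc: "fan_chart x U \<psi> g b c" using fan_chart_exists rM x by blast
    \<comment> \<open>In layer \<open>i\<close> the height of \<open>s\<close> is to exceed that of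
      \<open>r\<close>. If \<open>s\<close> is the region of constant height 0, then
      \<open>r\<close> is lowered instead of raising \<open>s\<close>. The heights in layer
      \<open>i'\<close> remain 0, so the displaced point stays in \<open>r\<close> when
      \<open>r\<close> is regarded as a region of layer \<open>i'\<close>.\<close>
    define q where "q = (if s = b i then r else s)"
    have q: "q \<in> star i x - {b i}" using s rs by (auto simp: q_def)
    obtain e where e: "e > 0" "\<And>t. \<bar>t\<bar> < e \<Longrightarrow> \<exists>u\<in>U. \<forall>i'<j. \<forall>s'\<in>star i' x.
      fan_coord \<psi> b c i' s' u = (if i' = i \<and> s' = q then t else 0)"
      using fc_perturb[OF fc assms(1) q] by blast
    have "\<bar>if s = b i then - e/2 else e/2\<bar> < e" using e(1) by auto
    then obtain u where u: "u \<in> U" "\<And>i' s'. i' < j \<Longrightarrow> s' \<in> star i' x \<Longrightarrow>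
      fan_coord \<psi> b c i' s' u = (if i' = i \<and> s' = q then (if s = b i then - e/2 else e/2) else 0)"
      using e(2) by blast
    have "u \<in> r" using fc_mem[OF fc assms(2) rs(2) u(1)] u(2)[OF assms(2)] assms(3) rs by auto
    moreover have "u \<notin> r" using fc_mem[OF fc assms(1) rs(1) u(1)] u(2)[OF assms(1)] rs s e(1)
      by (auto simp: q_def intro!: bexI[of _ s])
    ultimately show False by blast
  qed
  have nbhd: "\<exists>U. openin (top_of_set M) U \<and> x \<in> U \<and> U \<subseteq> r" if x: "x \<in> r" for x
  proof -
    obtain U \<psi> g b c where fc: "fan_chart x U \<psi> g b c" using fan_chart_exists rM x by blast
    have "U \<subseteq> r" using fc_mem[OF fc assms(1)] star[OF x] by auto
    then show ?thesis using fc_U[OF fc] by blast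
  qed
  have op: "openin (top_of_set M) r" by (subst openin_subopen) (use nbhd in blast)
  have nbhd': "\<exists>U. openin (top_of_set M) U \<and> x \<in> U \<and> U \<subseteq> M - r" if x: "x \<in> M - r" for x
  proof -
    obtain U \<psi> g b c where fc: "fan_chart x U \<psi> g b c" using fan_chart_exists x by blast
    have "U \<subseteq> M - r" using fc_disj[OF fc assms(1) r(1)] x fc_homD(7)[OF fc] by auto
    then show ?thesis using fc_U[OF fc] by blast
  qed
  have "openin (top_of_set M) (M - r)" by (subst openin_subopen) (use nbhd' in blast)
  then have cl: "closedin (top_of_set M) r" using rM by (simp add: closedin_def)
  have "r \<noteq> {}"
  proof -
    have "r homeomorphic std_ball n" using r by (auto simp: cells_of_dim_def is_ball_def)
    moreover have "(\<lambda>_. 0) \<in> std_ball n" by (auto simp: std_ball_def E_space_iff)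
    ultimately show ?thesis by (auto simp: homeomorphic_def homeomorphism_def)
  qed
  then have "r = M" using conn op cl by (auto simp: connected_clopen)
  then have in_v: "(i, r) \<in> (SIGMA i:{..<j}. star i v)" "(i', r) \<in> (SIGMA i:{..<j}. star i v)"
    using r vM assms by (auto simp: star_def)
  have fin: "finite (SIGMA i:{..<j}. star i v)" using finite_star by auto
  have "card (snd ` (SIGMA i:{..<j}. star i v)) \<ge> card (SIGMA i:{..<j}. star i v)"
    using card_stars_le[OF vM] card_v R_eq_image by metis
  then have "inj_on snd (SIGMA i:{..<j}. star i v)"
    using fin card_image_le[OF fin, of snd] by (intro eq_card_imp_inj_on) auto
  then show False using in_v assms(3) by (force simp: inj_on_def)
qed

section \<open>Cells in a fan chart\<close>

lemma hits_R: "x \<in> M \<Longrightarrow> hits (R x)"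
proof -
  assume "x \<in> M"
  then obtain U \<psi> g b c where fc: "fan_chart x U \<psi> g b c" using fan_chart_exists by blast
  have "R x \<inter> L i \<noteq> {}" if "i < j" for i
    using fc_b[OF fc that] that by (auto simp: R_eq star_def)
  then show "hits (R x)" by (auto simp: hits_def regions_at_def)
qed

lemma R_subset: "R x \<subseteq> Rg"
  by (auto simp: regions_at_def)

lemma finite_R: "finite (R x)"
  using finite_Rg R_subset finite_subset by blast

lemma nbhd_R:
  assumes "x \<in> M"
  obtains U where "openin (top_of_set M) U" "x \<in> U" "\<And>u. u \<in> U \<Longrightarrow> R u \<subseteq> R x"
proof -
  obtain U \<psi> g b c where fc: "fan_chart x U \<psi> g b c" using fan_chart_exists assms by blast
  show thesis using that[OF fc_U(1,2)[OF fc] fc_R_subset[OF fc]] .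
qed

lemma hits_subset_M:
  assumes "hits A" shows "\<Inter>A \<subseteq> M"
proof -
  obtain r where "r \<in> A" using assms j_pos by (force simp: hits_def)
  then show ?thesis using assms region_subset by (force simp: hits_def)
qed

text \<open>Disjointness of the layers allows \<open>A\<close> to be counted layer by layer.\<close>

lemma hits_card:
  assumes "hits A"
  shows "card (SIGMA i:{..<j}. A \<inter> L i) = card A"
proof -
  have "A = (\<Union>i<j. A \<inter> L i)" using assms unfolding hits_def regions_def by blast
  also have "\<dots> = snd ` (SIGMA i:{..<j}. A \<inter> L i)" by force
  finally have "A = snd ` (SIGMA i:{..<j}. A \<inter> L i)" .
  moreover have "inj_on snd (SIGMA i:{..<j}. A \<inter> L i)"
  proof (rule inj_onI, clarsimp)
    fix i i' r assume "i < j" "i' < j" "r \<in> L i" "r \<in> L i'"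
    then show "i = i'" using layers_disjoint[of i i'] by blast
  qed
  ultimately show ?thesis using card_image by metis
qed

lemma mem_Inter_iff: "A \<subseteq> Rg \<Longrightarrow> x \<in> \<Inter>A \<longleftrightarrow> A \<subseteq> R x"
  by (auto simp: regions_at_def)

context
  fixes x U \<psi> g b c A
  assumes fc: "fan_chart x U \<psi> g b c" and A: "hits A" "A \<subseteq> R x"
begin

text \<open>On the cell \<open>\<Inter>A\<close> the fan coordinates of the regions in \<open>A\<close> of one layer all agree with the one
  of \<open>base_of\<close>, so that the coordinates in \<open>killed\<close> are redundant.\<close>

definition base_of :: "nat \<Rightarrow> 'a set" where
  "base_of i = (if b i \<in> A then b i else (SOME r. r \<in> A \<inter> L i))"

definition killed :: "(nat \<times> 'a set) set" where
  "killed = (SIGMA i:{..<j}. A \<inter> L i - {base_of i})"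

lemma base_of: "i < j \<Longrightarrow> base_of i \<in> A \<inter> L i"
proof -
  assume i: "i < j"
  then have "\<exists>r. r \<in> A \<inter> L i" using A(1) by (auto simp: hits_def)
  from someI_ex[OF this] show ?thesis
    using fc_b[OF fc i] by (auto simp: base_of_def star_def)
qed

lemma A_star: "r \<in> A \<Longrightarrow> r \<in> L i \<Longrightarrow> r \<in> star i x"
  using A(2) by (auto simp: star_def regions_at_def)

text \<open>Because \<open>base_of\<close> prefers \<open>b i\<close>, every killed region differs
  from \<open>b i\<close> and hence owns a coordinate.\<close>

lemma killed_sub: "killed \<subseteq> (SIGMA i:{..<j}. star i x - {b i})"
  using A_star by (auto simp: killed_def base_of_def split: if_splits)

lemma card_killed: "card killed + j = card A"
proof -
  have fin: "finite (A \<inter> L i)" for i using A(2) finite_R finite_subset by blast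
  have "card (A \<inter> L i) = card (A \<inter> L i - {base_of i}) + 1" if "i < j" for i
    using fin base_of[OF that] by (metis Suc_eq_plus1 card.remove)
  then have "(\<Sum>i<j. card (A \<inter> L i)) = (\<Sum>i<j. card (A \<inter> L i - {base_of i}) + 1)"
    by (intro sum.cong) auto
  then have "card (SIGMA i:{..<j}. A \<inter> L i) = card killed + j"
    unfolding killed_def using fin by (simp add: sum_Suc)
  then show ?thesis using hits_card[OF A(1)] by simp
qed

text \<open>The number of coordinates left free will turn out to be the dimension of
  \<open>\<Inter>A\<close>.\<close>

lemma card_free: "card ({..<n} - c ` killed) = n + j - card A" and card_A_le: "card A \<le> n + j"
proof -
  have "finite (SIGMA i:{..<j}. star i x - {b i})"
    by (rule finite_SigmaI) (use finite_star in auto)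
  then have fin: "finite killed" using killed_sub finite_subset by blast
  have "card (c ` killed) = card killed" using inj_on_subset[OF fc_inj[OF fc] killed_sub] by (rule card_image)
  moreover have sub: "c ` killed \<subseteq> {..<n}" using killed_sub fc_c[OF fc] by blast
  ultimately have "card ({..<n} - c ` killed) = n - card killed" using fin by (simp add: card_Diff_subset)
  moreover have "card killed \<le> n" using \<open>card (c ` killed) = card killed\<close> sub card_mono[OF _ sub] by simp
  ultimately show "card ({..<n} - c ` killed) = n + j - card A" "card A \<le> n + j" using card_killed by auto
qed

lemma not_killed: "i < j \<Longrightarrow> s \<in> star i x - {b i} \<Longrightarrow> s \<notin> A \<or> s = base_of i \<Longrightarrow> c (i, s) \<in> {..<n} - c ` killed"
proof -
  assume i: "i < j" and s: "s \<in> star i x - {b i}" "s \<notin> A \<or> s = base_of i"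
  have "(i, s) \<notin> killed" using s by (auto simp: killed_def)
  then have "c (i, s) \<notin> c ` killed"
    using inj_on_image_mem_iff[OF fc_inj[OF fc] _ killed_sub, of "(i, s)"] i s by auto
  then show ?thesis using fc_c_less[OF fc i s(1)] by auto
qed

text \<open>Provides hypothesis \<open>emb\<close> of \<open>ball_boundary\<close>: on the cell the
  free coordinates determine all others, and if a region outside \<open>A\<close> passes through
  \<open>x\<close>, one free coordinate is bounded on one side with the bound attained at
  \<open>x\<close>.\<close>

lemma embedding_exists:
  "\<exists>W \<Theta>. openin (top_of_set (\<Inter>A)) W \<and> x \<in> W \<and> continuous_on W \<Theta> \<and>
       \<Theta> ` W \<subseteq> E_space (n + j - card A) \<and> inj_on \<Theta> W \<and>
       (R x \<noteq> A \<longrightarrow> (\<exists>m<n + j - card A. \<exists>\<sigma>\<in>{1, -1::real}. \<forall>u\<in>W. \<sigma> * \<Theta> u m \<le> \<sigma> * \<Theta> x m))"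
proof -
  let ?d = "n + j - card A" and ?J = "{..<n} - c ` killed" and ?W = "U \<inter> \<Inter>A"
  obtain e where e: "bij_betw e {..<?d} ?J"
    using card_free ex_bij_betw_nat_finite[of ?J] by (auto simp: lessThan_atLeast0)
  define \<Theta> where "\<Theta> u m = (if m < ?d then \<psi> u (e m) else 0)" for u m
  have xA: "x \<in> \<Inter>A" using A by (auto simp: regions_at_def)
  have AM: "\<Inter>A \<subseteq> M" using hits_subset_M A by blast
  have "openin (top_of_set (\<Inter>A)) ?W"
    using fc_U(1)[OF fc] AM by (auto simp: openin_open)
  moreover have "x \<in> ?W" using xA fc_U[OF fc] by blast
  moreover have "continuous_on ?W \<Theta>"
  proof (rule continuous_on_coordinatewise_then_product)
    fix m
    have "continuous_on ?W (\<lambda>u. \<psi> u (e m))"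
      by (rule continuous_on_product_then_coordinatewise) (rule continuous_on_subset[OF fc_homD(1)[OF fc]], blast)
    then show "continuous_on ?W (\<lambda>u. \<Theta> u m)" by (cases "m < ?d") (auto simp: \<Theta>_def)
  qed
  moreover have "\<Theta> ` ?W \<subseteq> E_space ?d" by (auto simp: \<Theta>_def E_space_iff)
  moreover have "inj_on \<Theta> ?W"
  proof (rule inj_onI)
    fix u u' assume u: "u \<in> ?W" "u' \<in> ?W" and eq: "\<Theta> u = \<Theta> u'"
    have J: "\<psi> u l = \<psi> u' l" if "l \<in> ?J" for l
    proof -
      have "l \<in> e ` {..<?d}" using e that by (simp add: bij_betw_def)
      then obtain m where "m < ?d" "e m = l" by auto
      then show ?thesis using fun_cong[OF eq, of m] by (simp add: \<Theta>_def)
    qed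
    \<comment> \<open>The point \<open>w\<close> lies in \<open>s\<close> and in
      \<open>base_of i\<close>, so both heights are maximal at \<open>w\<close>.\<close>
    have K: "\<psi> w (c (i, s)) = fan_coord \<psi> b c i (base_of i) w" if "(i, s) \<in> killed" "w \<in> ?W" for i s w
    proof -
      have si: "i < j" "s \<in> star i x - {b i}" "s \<in> A" using that(1) killed_sub by (auto simp: killed_def)
      have bs: "base_of i \<in> star i x" "base_of i \<in> A" using base_of[OF si(1)] A_star by auto
      have "w \<in> s" "w \<in> base_of i" using that(2) si bs by auto
      then have "fan_coord \<psi> b c i s w = fan_coord \<psi> b c i (base_of i) w"
        using fc_mem[OF fc si(1), of s w] fc_mem[OF fc si(1) bs(1), of w] that(2) si bs by (auto intro: antisym)
      then show ?thesis using si by (simp add: fan_coord_def)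
    qed
    have "\<psi> u l = \<psi> u' l" for l
    proof (cases "l \<in> c ` killed")
      case True
      then obtain i s where si: "(i, s) \<in> killed" "l = c (i, s)" by auto
      then have i: "i < j" by (auto simp: killed_def)
      have "fan_coord \<psi> b c i (base_of i) u = fan_coord \<psi> b c i (base_of i) u'"
        using J[OF not_killed[OF i, of "base_of i"]] base_of[OF i] A_star by (auto simp: fan_coord_def)
      then show ?thesis using K si u by simp
    next
      case False
      show ?thesis
      proof (cases "l < n")
        case True then show ?thesis using J False by auto
      next
        case False
        have "\<psi> u \<in> E_space n" "\<psi> u' \<in> E_space n" using fc_homD(6)[OF fc] u by blast+
        then show ?thesis using False by (auto simp: E_space_iff)
      qed
    qed
    then have "\<psi> u = \<psi> u'" by auto
    then show "u = u'" using fc_homD(3)[OF fc] u by (metis IntD1)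
  qed
  moreover have "\<exists>m<?d. \<exists>\<sigma>\<in>{1, -1::real}. \<forall>u\<in>?W. \<sigma> * \<Theta> u m \<le> \<sigma> * \<Theta> x m" if RA: "R x \<noteq> A"
  proof -
    obtain r i where r: "i < j" "r \<in> star i x" "r \<notin> A" using RA A(2) unfolding R_eq by blast
    have bs: "base_of i \<in> star i x" "base_of i \<in> A" using base_of[OF r(1)] A_star by auto
    \<comment> \<open>If \<open>b i\<close> is in \<open>A\<close>, its height 0 is maximal on the
      cell, so the height of the additional region \<open>r\<close> is at most 0 there. Otherwise
      the height of \<open>base_of i\<close> is maximal on the cell, hence at least the height 0 of
      \<open>b i\<close>.\<close>
    have "\<exists>s \<sigma>. s \<in> star i x - {b i} \<and> (s \<notin> A \<or> s = base_of i) \<and> \<sigma> \<in> {1, -1::real} \<and>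
       (\<forall>u\<in>?W. \<sigma> * \<psi> u (c (i, s)) \<le> 0)"
    proof (cases "b i \<in> A")
      case True
      have "\<psi> u (c (i, r)) \<le> 0" if u: "u \<in> ?W" for u
        using fc_mem[OF fc r(1) fc_b[OF fc r(1)], of u] u True r by (auto simp: fan_coord_def split: if_splits)
      then show ?thesis using r True by (intro exI[of _ r] exI[of _ 1]) auto
    next
      case False
      have "- \<psi> u (c (i, base_of i)) \<le> 0" if u: "u \<in> ?W" for u
      proof -
        have "fan_coord \<psi> b c i (b i) u \<le> fan_coord \<psi> b c i (base_of i) u"
          using fc_mem[OF fc r(1) bs(1), of u] u bs fc_b[OF fc r(1)] by auto
        moreover have "base_of i \<noteq> b i" using bs False by auto
        ultimately show ?thesis by (simp add: fan_coord_def)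
      qed
      then show ?thesis using bs False by (intro exI[of _ "base_of i"] exI[of _ "-1"]) auto
    qed
    then obtain s \<sigma> where s: "s \<in> star i x - {b i}" "s \<notin> A \<or> s = base_of i" "\<sigma> \<in> {1, -1::real}"
       "\<forall>u\<in>?W. \<sigma> * \<psi> u (c (i, s)) \<le> 0" by blast
    have "c (i, s) \<in> e ` {..<?d}" using not_killed[OF r(1) s(1,2)] e by (simp add: bij_betw_def)
    then obtain m where m: "m < ?d" "e m = c (i, s)" by auto
    have "\<Theta> x m = 0" using m fc_zero'[OF fc r(1) s(1)] by (simp add: \<Theta>_def)
    moreover have "\<sigma> * \<Theta> u m \<le> 0" if "u \<in> ?W" for u using s(4) that m by (auto simp: \<Theta>_def)
    ultimately show ?thesis using m(1) s(3) by (intro exI[of _ m] conjI bexI[of _ \<sigma>]) auto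
  qed
  ultimately show ?thesis by blast
qed

text \<open>Provides hypothesis \<open>int\<close> of \<open>ball_boundary\<close>. When no further
  region passes through \<open>x\<close>, every region of the star other than the \<open>b i\<close>
  is killed. Setting the killed coordinates to 0 makes all heights 0, so the free ones can vary
  without leaving the cell.\<close>

lemma interior_chart_exists:
  assumes "R x = A"
  shows "\<exists>B G. openin (Euclidean_space (n + j - card A)) B \<and> continuous_on B G \<and>
       G ` B \<subseteq> \<Inter>A \<and> inj_on G B \<and> x \<in> G ` B"
proof -
  let ?d = "n + j - card A" and ?J = "{..<n} - c ` killed"
  obtain e where e: "bij_betw e {..<?d} ?J"
    using card_free ex_bij_betw_nat_finite[of ?J] by (auto simp: lessThan_atLeast0)
  define e' where "e' = the_inv_into {..<?d} e"
  have ee': "e (e' l) = l" "e' l < ?d" if "l \<in> ?J" for l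
    using f_the_inv_into_f_bij_betw[OF e] bij_betwE[OF bij_betw_the_inv_into[OF e]] that by (auto simp: e'_def)
  have e'e: "e' (e m) = m" "e m \<in> ?J" if "m < ?d" for m
    using the_inv_into_f_f[of e "{..<?d}" m] e that by (auto simp: e'_def bij_betw_def)
  define spread where "spread z l = (if l \<in> ?J then z (e' l) else 0)" for z :: "nat \<Rightarrow> real" and l
  obtain T where T: "open T" "\<psi> ` U = E_space n \<inter> T" using fc_U(3)[OF fc] openin_Euclidean_space_iff by blast
  have spE: "spread z \<in> E_space n" for z by (auto simp: spread_def E_space_iff)
  define B where "B = E_space ?d \<inter> spread -` T"
  have spc: "continuous_on UNIV spread"
  proof (rule continuous_on_coordinatewise_then_product)
    fix l show "continuous_on UNIV (\<lambda>z. spread z l)"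
      by (cases "l \<in> ?J") (auto simp: spread_def)
  qed
  have Bo: "openin (Euclidean_space ?d) B"
    unfolding B_def openin_Euclidean_space_iff using open_vimage[OF T(1) spc] by blast
  have BU: "spread z \<in> \<psi> ` U" if "z \<in> B" for z using that T spE by (auto simp: B_def)
  have base_b: "base_of i = b i" if "i < j" for i
    using assms fc_b[OF fc that] that by (auto simp: base_of_def R_eq)
  have starA: "star i x \<subseteq> A" if "i < j" for i using assms that by (auto simp: R_eq)
  have kill: "(i, s) \<in> killed" if "i < j" "s \<in> star i x - {b i}" for i s
    using that starA[OF that(1)] base_b[OF that(1)] by (auto simp: killed_def star_def)
  have y0: "fan_coord \<psi> b c i s (g (spread z)) = 0" if "i < j" "s \<in> star i x" "z \<in> B" for i s z
  proof (cases "s = b i")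
    case False
    then have "c (i, s) \<notin> ?J" using kill[OF that(1), of s] that by auto
    then show ?thesis using False fc_homD(4)[OF fc BU[OF that(3)]] by (auto simp: fan_coord_def spread_def)
  qed (simp add: fan_coord_def)
  have "continuous_on B (\<lambda>z. g (spread z))"
    by (rule continuous_on_compose2[OF fc_homD(2)[OF fc] continuous_on_subset[OF spc]]) (use BU in auto)
  moreover have "(\<lambda>z. g (spread z)) ` B \<subseteq> \<Inter>A"
  proof clarify
    fix z r assume z: "z \<in> B" and "r \<in> A"
    then obtain i where i: "i < j" "r \<in> star i x" using assms by (auto simp: R_eq)
    show "g (spread z) \<in> r"
      using fc_mem[OF fc i fc_homD(5)[OF fc BU[OF z]]] y0[OF i(1) _ z] i(2) by auto
  qed
  moreover have "inj_on (\<lambda>z. g (spread z)) B"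
  proof (rule inj_onI)
    fix z z' assume z: "z \<in> B" "z' \<in> B" and "g (spread z) = g (spread z')"
    then have eq: "spread z = spread z'" using fc_homD(4)[OF fc] BU by metis
    show "z = z'"
    proof
      fix m
      show "z m = z' m"
      proof (cases "m < ?d")
        case True
        then show ?thesis using fun_cong[OF eq, of "e m"] e'e[OF True] by (simp add: spread_def)
      next
        case False
        then show ?thesis using z by (auto simp: B_def E_space_iff)
      qed
    qed
  qed
  moreover have "x \<in> (\<lambda>z. g (spread z)) ` B"
  proof -
    define z where "z m = (if m < ?d then \<psi> x (e m) else 0)" for m
    have "spread z = \<psi> x"
    proof
      fix l
      consider "l \<in> ?J" | "l \<in> c ` killed" | "l \<ge> n" by fastforce
      then show "spread z l = \<psi> x l"
      proof cases
        case 1 then show ?thesis using ee'[OF 1] by (simp add: spread_def z_def)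
      next
        case 2
        then obtain i s where "(i, s) \<in> killed" "l = c (i, s)" by auto
        then show ?thesis using fc_zero'[OF fc, of i s] killed_sub by (auto simp: spread_def)
      next
        case 3
        then show ?thesis using fc_homD(6)[OF fc] fc_U(2)[OF fc] by (auto simp: spread_def E_space_iff subset_iff)
      qed
    qed
    moreover have "z \<in> E_space ?d" by (auto simp: z_def E_space_iff)
    moreover have "\<psi> x \<in> T" using T fc_U(2)[OF fc] by blast
    ultimately have "z \<in> B" "g (spread z) = x" using fc_homD(3)[OF fc fc_U(2)[OF fc]] by (auto simp: B_def)
    then show ?thesis by force
  qed
  ultimately show ?thesis using Bo by blast
qed

lemma interior_point_exists: "\<exists>u\<in>U. R u = A"
proof -
  let ?S = "SIGMA i:{..<j}. star i x - {b i}"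
  \<comment> \<open>a small displacement giving the regions in \<open>A\<close> the strictly largest fan coordinate\<close>
  define val where "val i s = (if s \<in> A then 1 else 0) - (if b i \<in> A then 1 else (0::real))" for i s
  define \<delta> where "\<delta> l = (if l \<in> c ` ?S then (case inv_into ?S c l of (i, s) \<Rightarrow> val i s) else 0)" for l
  have \<delta>: "\<delta> (c (i, s)) = val i s" if "i < j" "s \<in> star i x - {b i}" for i s
  proof -
    have S: "(i, s) \<in> ?S" using that by simp
    show ?thesis using inv_into_f_f[OF fc_inj[OF fc] S] imageI[OF S, of c] by (simp add: \<delta>_def)
  qed
  have val1: "\<bar>val i s\<bar> \<le> 1" for i s by (auto simp: val_def)
  have \<delta>1: "\<bar>\<delta> l\<bar> \<le> 1" for l using val1 by (auto simp: \<delta>_def split: prod.split)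
  obtain T where T: "open T" "\<psi> ` U = E_space n \<inter> T" using fc_U(3)[OF fc] openin_Euclidean_space_iff by blast
  have xT: "\<psi> x \<in> T" "\<psi> x \<in> E_space n" using T fc_U(2)[OF fc] by blast+
  obtain e where e: "e > 0" "\<And>z. (\<And>i. \<bar>z i - \<psi> x i\<bar> < e) \<Longrightarrow> z \<in> T"
    using open_fun_contains_box[OF T(1) xT(1)] by blast
  define z where "z l = \<psi> x l + e/2 * \<delta> l" for l
  have "z \<in> T"
  proof (rule e(2))
    fix l have "e / 2 * \<bar>\<delta> l\<bar> \<le> e / 2" using \<delta>1[of l] e(1) by (simp add: mult_left_le)
    then show "\<bar>z l - \<psi> x l\<bar> < e" using e(1) by (simp add: z_def abs_mult)
  qed
  moreover have "z \<in> E_space n"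
  proof -
    have "\<delta> l = 0" if "l \<ge> n" for l using that fc_c[OF fc] by (auto simp: \<delta>_def)
    then show ?thesis using xT(2) by (auto simp: E_space_iff z_def)
  qed
  ultimately have zU: "z \<in> \<psi> ` U" using T by blast
  have y: "fan_coord \<psi> b c i s (g z) = e/2 * val i s" if "i < j" "s \<in> star i x" for i s
  proof (cases "s = b i")
    case False
    then show ?thesis
      using that \<delta>[OF that(1), of s] fc_zero'[OF fc that(1), of s] fc_homD(4)[OF fc zU]
      by (auto simp: fan_coord_def z_def)
  qed (auto simp: fan_coord_def val_def)
  have mem: "g z \<in> r \<longleftrightarrow> r \<in> A" if i: "i < j" "r \<in> star i x" for i r
  proof -
    have "g z \<in> r \<longleftrightarrow> (\<forall>s\<in>star i x. val i s \<le> val i r)"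
      using fc_mem[OF fc i fc_homD(5)[OF fc zU]] y[OF i(1)] i(2) e(1) by simp
    also have "\<dots> \<longleftrightarrow> r \<in> A"
    proof
      assume *: "\<forall>s\<in>star i x. val i s \<le> val i r"
      have "base_of i \<in> star i x" "base_of i \<in> A" using base_of[OF i(1)] A_star by auto
      then show "r \<in> A" using * by (force simp: val_def split: if_splits)
    qed (auto simp: val_def)
    finally show ?thesis .
  qed
  have "R (g z) = A"
  proof
    show "R (g z) \<subseteq> A"
    proof
      fix r assume r: "r \<in> R (g z)"
      then obtain i where "i < j" "r \<in> star i x"
        using fc_R_subset[OF fc fc_homD(5)[OF fc zU]] by (auto simp: R_eq)
      then show "r \<in> A" using mem r by (auto simp: regions_at_def)
    qed
    show "A \<subseteq> R (g z)"
    proof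
      fix r assume r: "r \<in> A"
      then obtain i where "i < j" "r \<in> star i x" using A(2) by (auto simp: R_eq)
      then show "r \<in> R (g z)" using mem r A by (auto simp: regions_at_def)
    qed
  qed
  then show ?thesis using fc_homD(5)[OF fc zU] by blast
qed

end

section \<open>Dimension and boundary of cells; contraction towards a point\<close>

lemma cell_dim_boundary:
  assumes A: "hits A" and hom: "homeomorphism (std_ball k) (\<Inter>A) f g" and ne: "\<Inter>A \<noteq> {}"
  shows "k + card A = n + j" "f ` std_sphere k = {x \<in> \<Inter>A. R x \<noteq> A}"
proof -
  have chart: "\<exists>U \<psi> g b c. fan_chart x U \<psi> g b c" "A \<subseteq> R x" if "x \<in> \<Inter>A" for x
    using that fan_chart_exists[of x] hits_subset_M[OF A] mem_Inter_iff[of A x] A by (auto simp: hits_def)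
  have ex: "\<exists>x\<in>\<Inter>A. R x = A"
  proof -
    obtain x where x: "x \<in> \<Inter>A" using ne by blast
    obtain u where "R u = A" using interior_point_exists[OF _ A chart(2)[OF x]] chart(1)[OF x] by blast
    then have "u \<in> \<Inter>A" by (auto simp: regions_at_def)
    then show ?thesis using \<open>R u = A\<close> by blast
  qed
  have int: "\<exists>B G. openin (Euclidean_space (n + j - card A)) B \<and> continuous_on B G \<and>
       G ` B \<subseteq> \<Inter>A \<and> inj_on G B \<and> x \<in> G ` B" if x: "x \<in> \<Inter>A" "R x = A" for x
  proof -
    obtain U \<psi> g b c where fc: "fan_chart x U \<psi> g b c" using chart(1)[OF x(1)] by blast
    show ?thesis by (rule interior_chart_exists[OF fc A chart(2)[OF x(1)] x(2)])
  qed
  have emb: "\<exists>U \<Theta>. openin (top_of_set (\<Inter>A)) U \<and> x \<in> U \<and> continuous_on U \<Theta> \<and>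
       \<Theta> ` U \<subseteq> E_space (n + j - card A) \<and> inj_on \<Theta> U \<and>
       (R x \<noteq> A \<longrightarrow> (\<exists>m<n + j - card A. \<exists>\<sigma>\<in>{1, -1::real}. \<forall>u\<in>U. \<sigma> * \<Theta> u m \<le> \<sigma> * \<Theta> x m))"
    if x: "x \<in> \<Inter>A" for x
  proof -
    obtain U \<psi> g b c where fc: "fan_chart x U \<psi> g b c" using chart(1)[OF x] by blast
    show ?thesis by (rule embedding_exists[OF fc A chart(2)[OF x]])
  qed
  have "card A \<le> n + j"
    using ne chart card_A_le[OF _ A] by blast
  moreover have "k = n + j - card A" "f ` std_sphere k = {x \<in> \<Inter>A. R x \<noteq> A}"
    \<comment> \<open>Here the predicate \<open>I x\<close> of \<open>ball_boundary\<close> is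
      \<open>R x = A\<close>.\<close>
    using ball_boundary[OF hom ex int emb] by auto
  ultimately show "k + card A = n + j" "f ` std_sphere k = {x \<in> \<Inter>A. R x \<noteq> A}" by auto
qed

lemma cell_ball:
  assumes A: "hits A" "\<Inter>A \<noteq> {}"
  obtains k f g where "homeomorphism (std_ball k) (\<Inter>A) f g" "k + card A = n + j"
     "f ` std_sphere k = {x \<in> \<Inter>A. R x \<noteq> A}"
proof -
  have "A \<noteq> {}" using A j_pos by (force simp: hits_def)
  then obtain k where "is_ball k (\<Inter>A)"
    using ecpx A unfolding layer_ecpx_def layer_cpx_def hits_def by blast
  then obtain f g where h: "homeomorphism (std_ball k) (\<Inter>A) f g"
    by (metis is_ball_def homeomorphic_def homeomorphic_sym)
  show thesis by (rule that[OF h cell_dim_boundary[OF A(1) h A(2)]])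
qed

lemma cell_dim:
  assumes A: "hits A" "\<Inter>A \<noteq> {}"
  shows "is_ball k (\<Inter>A) \<longleftrightarrow> k + card A = n + j"
proof
  assume "is_ball k (\<Inter>A)"
  then obtain f g where "homeomorphism (std_ball k) (\<Inter>A) f g"
    by (metis is_ball_def homeomorphic_def homeomorphic_sym)
  then show "k + card A = n + j" using cell_dim_boundary(1)[OF A(1) _ A(2)] by blast
next
  assume k: "k + card A = n + j"
  obtain k' f g where "homeomorphism (std_ball k') (\<Inter>A) f g" "k' + card A = n + j"
    by (rule cell_ball[OF A])
  moreover have "k' = k" using k calculation(2) by simp
  ultimately show "is_ball k (\<Inter>A)" by (metis is_ball_def homeomorphic_def homeomorphic_sym)
qed

lemma cell_interior_point:
  assumes A: "hits A" "\<Inter>A \<noteq> {}"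
  obtains u where "u \<in> \<Inter>A" "R u = A"
proof -
  obtain x where x: "x \<in> \<Inter>A" using A by blast
  then have AR: "A \<subseteq> R x" using mem_Inter_iff[of A x] A(1) unfolding hits_def by blast
  obtain U \<psi> g b c where "fan_chart x U \<psi> g b c" using fan_chart_exists x hits_subset_M[OF A(1)] by blast
  then obtain u where "R u = A" using interior_point_exists[OF _ A(1) AR] by blast
  moreover then have "u \<in> \<Inter>A" by (auto simp: regions_at_def)
  ultimately show thesis using that by blast
qed

text \<open>Contract linearly in a fan chart towards \<open>x\<close>, where all heights are 0. At
  time \<open>t\<close> every height is multiplied by \<open>1 - t\<close>, so the comparisons of
  heights, and with them the regions containing the point, do not change before time 1.\<close>

lemma local_contraction:
  assumes x: "x \<in> M"
  obtains W and K :: "real \<times> 'a \<Rightarrow> 'a" where "openin (top_of_set M) W" "x \<in> W" "continuous_on ({0..1} \<times> W) K"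
    "\<And>u. u \<in> W \<Longrightarrow> K (0, u) = u" "\<And>u. u \<in> W \<Longrightarrow> K (1, u) = x"
    "\<And>t u. u \<in> W \<Longrightarrow> 0 \<le> t \<Longrightarrow> t < 1 \<Longrightarrow> R (K (t, u)) = R u" "\<And>u. u \<in> W \<Longrightarrow> R u \<subseteq> R x"
proof -
  obtain U \<psi> g b c where fc: "fan_chart x U \<psi> g b c" using fan_chart_exists[OF x] by blast
  obtain T where T: "open T" "\<psi> ` U = E_space n \<inter> T" using fc_U(3)[OF fc] openin_Euclidean_space_iff by blast
  have xT: "\<psi> x \<in> T" "\<psi> x \<in> E_space n" using T fc_U(2)[OF fc] by blast+
  obtain e where e: "e > 0" "\<And>z. (\<And>i. \<bar>z i - \<psi> x i\<bar> < e) \<Longrightarrow> z \<in> T"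
    using open_fun_contains_box[OF T(1) xT(1)] by blast
  \<comment> \<open>A box is convex, so the contraction does not leave the chart. Only the first
    \<open>n\<close> coordinates are constrained, which keeps the box open.\<close>
  define Bx where "Bx = (\<Inter>l<n. {z. \<bar>z l - \<psi> x l\<bar> < e})"
  have "open Bx" unfolding Bx_def
    by (intro open_INT ballI open_Collect_less continuous_intros continuous_on_product_coordinates) auto
  define W where "W = U \<inter> \<psi> -` Bx"
  have WU: "W \<subseteq> U" by (auto simp: W_def)
  have "openin (top_of_set U) W"
    unfolding W_def using \<open>open Bx\<close> fc_homD(1)[OF fc] by (intro continuous_openin_preimage_gen)
  then have Wo: "openin (top_of_set M) W" using fc_U(1)[OF fc] openin_trans by blast
  have xW: "x \<in> W" using fc_U(2)[OF fc] e(1) by (auto simp: W_def Bx_def)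
  define m where "m z l = (1 - fst z) * \<psi> (snd z) l + fst z * \<psi> x l" for z :: "real \<times> 'a" and l
  define K where "K z = g (m z)" for z
  have mU: "m (t, u) \<in> \<psi> ` U" if u: "u \<in> W" and t: "0 \<le> t" "t \<le> 1" for t u
  proof -
    have uE: "\<psi> u \<in> E_space n" using fc_homD(6)[OF fc] u WU by blast
    have "\<bar>m (t, u) l - \<psi> x l\<bar> < e" for l
    proof (cases "l < n")
      case True
      then have *: "\<bar>\<psi> u l - \<psi> x l\<bar> < e" using u by (auto simp: W_def Bx_def)
      have "m (t, u) l - \<psi> x l = (1 - t) * (\<psi> u l - \<psi> x l)" by (simp add: m_def algebra_simps)
      then have "\<bar>m (t, u) l - \<psi> x l\<bar> = (1 - t) * \<bar>\<psi> u l - \<psi> x l\<bar>" using t by (simp add: abs_mult)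
      also have "\<dots> \<le> \<bar>\<psi> u l - \<psi> x l\<bar>" using t by (simp add: mult_left_le_one_le)
      finally show ?thesis using * by simp
    next
      case False
      then show ?thesis using uE xT(2) e(1) by (auto simp: m_def E_space_iff)
    qed
    then have "m (t, u) \<in> T" by (rule e(2))
    moreover have "m (t, u) \<in> E_space n" using uE xT(2) by (auto simp: m_def E_space_iff)
    ultimately show ?thesis using T by blast
  qed
  have cm: "continuous_on ({0..1} \<times> W) m"
  proof (rule continuous_on_coordinatewise_then_product)
    fix l
    have "continuous_on W (\<lambda>u. \<psi> u l)"
      by (rule continuous_on_product_then_coordinatewise[OF continuous_on_subset[OF fc_homD(1)[OF fc] WU]])
    then have "continuous_on ({0..1} \<times> W) (\<lambda>z::real\<times>'a. \<psi> (snd z) l)"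
      by (rule continuous_on_compose2) (auto intro!: continuous_intros)
    then show "continuous_on ({0..1} \<times> W) (\<lambda>z. m z l)" unfolding m_def by (intro continuous_intros)
  qed
  have cK: "continuous_on ({0..1} \<times> W) K" unfolding K_def
    by (rule continuous_on_compose2[OF fc_homD(2)[OF fc] cm]) (use mU in auto)
  have K0: "K (0, u) = u" if "u \<in> W" for u
  proof -
    have "m (0, u) = \<psi> u" by (simp add: m_def fun_eq_iff)
    then show ?thesis using fc_homD(3)[OF fc] WU that by (auto simp: K_def)
  qed
  have K1: "K (1, u) = x" for u
  proof -
    have "m (1, u) = \<psi> x" by (simp add: m_def fun_eq_iff)
    then show ?thesis using fc_homD(3)[OF fc fc_U(2)[OF fc]] by (simp add: K_def)
  qed
  have KU: "K (t, u) \<in> U" if "u \<in> W" "0 \<le> t" "t \<le> 1" for t u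
    using mU[OF that] fc_homD(5)[OF fc] by (simp add: K_def)
  have KR: "R (K (t, u)) = R u" if u: "u \<in> W" and t: "0 \<le> t" "t < 1" for t u
  proof -
    have uU: "u \<in> U" using u WU by blast
    have KU': "K (t, u) \<in> U" using KU u t by auto
    have y: "fan_coord \<psi> b c i s (K (t, u)) = (1 - t) * fan_coord \<psi> b c i s u" if "i < j" "s \<in> star i x" for i s
      using fc_homD(4)[OF fc mU[OF u t(1)]] t fc_zero'[OF fc that(1), of s] that(2)
      by (auto simp: fan_coord_def K_def m_def)
    have mem: "K (t, u) \<in> r \<longleftrightarrow> u \<in> r" if i: "i < j" "r \<in> star i x" for i r
      using fc_mem[OF fc i uU] fc_mem[OF fc i KU'] y[OF i(1)] i(2) t by (simp add: mult_le_cancel_left)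
    have "R w = {r \<in> R x. w \<in> r}" if "w \<in> U" for w
      using fc_R_subset[OF fc that] by (auto simp: regions_at_def)
    then have "R (K (t, u)) = {r \<in> R x. K (t, u) \<in> r}" "R u = {r \<in> R x. u \<in> r}" using uU KU' by blast+
    moreover have "K (t, u) \<in> r \<longleftrightarrow> u \<in> r" if "r \<in> R x" for r using that mem by (auto simp: R_eq)
    ultimately show ?thesis by blast
  qed
  show thesis
  proof (rule that[of W K])
    show "R u \<subseteq> R x" if "u \<in> W" for u using fc_R_subset[OF fc] WU that by blast
  qed (use Wo xW cK K0 K1 KR in auto)
qed

end

section \<open>Coherent colorings\<close>

text \<open>\<open>D\<close> is the incidence relation between the sides and the vertices of a polygon. The proof walks
  around the polygon by \<open>\<phi>\<close>; the walk cannot return to a side in the reverse direction, so its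
  period is the number of sides.\<close>

lemma even_cycle_two_coloring:
  fixes D :: "('q \<times> 'w) set" and other_end :: "'q \<Rightarrow> 'w \<Rightarrow> 'w" and other_side :: "'w \<Rightarrow> 'q \<Rightarrow> 'q"
  assumes fin: "finite D"
    and oe: "\<And>r w. (r, w) \<in> D \<Longrightarrow> (r, other_end r w) \<in> D \<and> other_end r w \<noteq> w"
    and oe_only: "\<And>r w w'. (r, w) \<in> D \<Longrightarrow> (r, w') \<in> D \<Longrightarrow> w' = w \<or> w' = other_end r w"
    and os: "\<And>r w. (r, w) \<in> D \<Longrightarrow> (other_side w r, w) \<in> D \<and> other_side w r \<noteq> r"
    and os_only: "\<And>r r' w. (r, w) \<in> D \<Longrightarrow> (r', w) \<in> D \<Longrightarrow> r' = r \<or> r' = other_side w r"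
    and conn: "\<And>P. P \<subseteq> fst ` D \<Longrightarrow> P \<noteq> {} \<Longrightarrow>
        (\<And>r r' w. r \<in> P \<Longrightarrow> (r, w) \<in> D \<Longrightarrow> (r', w) \<in> D \<Longrightarrow> r' \<in> P) \<Longrightarrow> P = fst ` D"
    and ev: "even (card (fst ` D))"
  shows "\<exists>h::'q \<Rightarrow> bool. \<forall>r r' w. (r, w) \<in> D \<longrightarrow> (r', w) \<in> D \<longrightarrow> r \<noteq> r' \<longrightarrow> h r \<noteq> h r'"
proof (cases "D = {}")
  case False
  then obtain d0 where d0: "d0 \<in> D" by blast
  have oo: "other_end r (other_end r w) = w" if "(r, w) \<in> D" for r w
    using oe[OF that] oe_only[of r "other_end r w" w] oe[of r "other_end r w"] that by metis
  have ss: "other_side w (other_side w r) = r" if "(r, w) \<in> D" for r w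
    using os[OF that] os_only[of "other_side w r" w r] that by metis
  \<comment> \<open>Elements of \<open>D\<close> are flags of a side and one of its vertices.
    \<open>\<phi>\<close> changes the side at the vertex and then moves to the far end of the new
    side; \<open>\<rho>\<close> reverses a flag.\<close>
  define \<phi> where "\<phi> d = (other_side (snd d) (fst d), other_end (other_side (snd d) (fst d)) (snd d))" for d :: "'q \<times> 'w"
  define \<rho> where "\<rho> d = (fst d, other_end (fst d) (snd d))" for d :: "'q \<times> 'w"
  have \<phi>D: "\<phi> d \<in> D" if "d \<in> D" for d using that os oe by (cases d) (auto simp: \<phi>_def)
  have \<rho>D: "\<rho> d \<in> D" if "d \<in> D" for d using that oe by (cases d) (auto simp: \<rho>_def)
  have \<rho>\<phi>: "\<rho> (\<phi> d) = (other_side (snd d) (fst d), snd d)" if "d \<in> D" for d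
    using that os oo by (cases d) (auto simp: \<phi>_def \<rho>_def)
  \<comment> \<open>Reversal conjugates \<open>\<phi>\<close> into its inverse. This gives
    injectivity of \<open>\<phi>\<close> and the descent in \<open>no_rev\<close>.\<close>
  have \<phi>\<rho>\<phi>: "\<phi> (\<rho> (\<phi> d)) = \<rho> d" if "d \<in> D" for d
    unfolding \<rho>\<phi>[OF that] using that by (cases d) (simp add: \<phi>_def \<rho>_def ss)
  have \<rho>\<rho>: "\<rho> (\<rho> d) = d" if "d \<in> D" for d using that oo by (cases d) (auto simp: \<rho>_def)
  have \<phi>inj: "d = d'" if "d \<in> D" "d' \<in> D" "\<phi> d = \<phi> d'" for d d'
  proof -
    have "\<rho> d = \<rho> d'" using \<phi>\<rho>\<phi>[OF that(1)] \<phi>\<rho>\<phi>[OF that(2)] that(3) by simp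
    then show ?thesis using \<rho>\<rho> that by metis
  qed
  have itD: "(\<phi> ^^ k) d \<in> D" if "d \<in> D" for k d using that \<phi>D by (induction k) auto
  \<comment> \<open>Removing one step at either end of a walk from \<open>d\<close> to its reverse
    leaves a walk from \<open>\<phi> d\<close> to its reverse, shorter by two. Lengths 0 and 1 are
    excluded by \<open>oe\<close> and \<open>os\<close>.\<close>
  have no_rev: "d \<in> D \<Longrightarrow> (\<phi> ^^ k) d \<noteq> \<rho> d" for k d
  proof (induction k arbitrary: d rule: less_induct)
    case (less k)
    consider "k = 0" | "k = 1" | m where "k = Suc (Suc m)" by (metis One_nat_def not0_implies_Suc)
    then show ?case
    proof cases
      case 1 then show ?thesis using oe[of "fst d" "snd d"] less(2) by (auto simp: \<rho>_def prod_eq_iff dest: sym)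
    next
      case 2 then show ?thesis using os[of "fst d" "snd d"] less(2) by (auto simp: \<rho>_def \<phi>_def)
    next
      case (3 m)
      show ?thesis
      proof
        assume eq: "(\<phi> ^^ k) d = \<rho> d"
        have "\<phi> ((\<phi> ^^ m) (\<phi> d)) = \<phi> (\<rho> (\<phi> d))"
          using eq \<phi>\<rho>\<phi>[OF less(2)] unfolding 3 by (simp add: funpow_swap1)
        then have "(\<phi> ^^ m) (\<phi> d) = \<rho> (\<phi> d)"
          using \<phi>inj itD \<phi>D \<rho>D less(2) by blast
        then show False using less(1)[of m "\<phi> d"] 3 \<phi>D less(2) by simp
      qed
    qed
  qed
  have cancel: "(\<phi> ^^ k) d0 = d0" if "(\<phi> ^^ (a + k)) d0 = (\<phi> ^^ a) d0" for a k
    using that by (induction a) (auto intro: \<phi>inj itD d0)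
  have "\<not> inj_on (\<lambda>k. (\<phi> ^^ k) d0) UNIV"
    using fin itD[OF d0] by (metis finite_imageD finite_subset image_subsetI infinite_UNIV_nat)
  then obtain a b where ab: "(\<phi> ^^ a) d0 = (\<phi> ^^ b) d0" "a < b" by (metis linorder_inj_onI' linorder_neqE_nat)
  then have "(\<phi> ^^ (b - a)) d0 = d0" using cancel[of a "b - a"] by simp
  then have ex: "\<exists>p>0. (\<phi> ^^ p) d0 = d0" using ab(2) by (intro exI[of _ "b - a"]) auto
  define p where "p = (LEAST p. p > 0 \<and> (\<phi> ^^ p) d0 = d0)"
  have p: "p > 0" "(\<phi> ^^ p) d0 = d0" using LeastI_ex[OF ex] by (auto simp: p_def)
  have pmin: "(\<phi> ^^ k) d0 \<noteq> d0" if "0 < k" "k < p" for k using that not_less_Least unfolding p_def by blast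
  define q where "q k = fst ((\<phi> ^^ k) d0)" for k
  define e where "e k = snd ((\<phi> ^^ k) d0)" for k
  have qe: "(\<phi> ^^ k) d0 = (q k, e k)" "(q k, e k) \<in> D" for k using itD[OF d0, of k] by (auto simp: q_def e_def)
  have step: "q (Suc k) = other_side (e k) (q k)" "e (Suc k) = other_end (q (Suc k)) (e k)" for k
    using qe(1)[of "Suc k"] qe(1)[of k] by (auto simp: \<phi>_def)
  \<comment> \<open>A side met twice within one period is met with the same vertex, against
    minimality of \<open>p\<close>, or with the other one, which is a reversal.\<close>
  have qdist: "q a \<noteq> q b" if "a < b" "b < p" for a b
  proof
    assume eq: "q a = q b"
    then have "e b = e a \<or> e b = other_end (q a) (e a)"
      using oe_only[OF qe(2)[of a], of "e b"] qe(2)[of b] by simp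
    then show False
    proof
      assume "e b = e a"
      then have "(\<phi> ^^ (a + (b - a))) d0 = (\<phi> ^^ a) d0" using qe(1) eq that by simp
      from cancel[OF this] show False using pmin[of "b - a"] that by simp
    next
      assume "e b = other_end (q a) (e a)"
      then have "(\<phi> ^^ b) d0 = \<rho> ((\<phi> ^^ a) d0)" using qe(1) eq by (simp add: \<rho>_def)
      moreover have "(\<phi> ^^ b) d0 = (\<phi> ^^ (b - a)) ((\<phi> ^^ a) d0)"
        using that by (metis funpow_add le_add_diff_inverse2 less_imp_le o_apply)
      ultimately show False using no_rev[OF itD[OF d0]] by metis
    qed
  qed
  have per: "q (k + p) = q k" "e (k + p) = e k" for k
    using p(2) by (simp_all add: q_def e_def funpow_add)
  have qmod: "q (a + m * p) = q a" for a m
  proof (induction m)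
    case (Suc m)
    have "a + Suc m * p = (a + m * p) + p" by simp
    then show ?case using per(1)[of "a + m * p"] Suc by metis
  qed simp
  let ?P = "q ` {..<p}"
  have inP: "q k \<in> ?P" for k
  proof -
    have "q k = q (k mod p)" using qmod[of "k mod p" "k div p"] by simp
    then show ?thesis using p(1) by auto
  qed
  \<comment> \<open>The two vertices of side \<open>q k\<close> are those of times \<open>k\<close>
    and \<open>k - 1\<close>; adding the period \<open>p\<close> avoids the predecessor of
    0.\<close>
  have ends: "w = e k \<or> w = e (k + p - 1)" and prev: "q (Suc (k + p - 1)) = q k" if "(q k, w) \<in> D" for k w
  proof -
    show prev: "q (Suc (k + p - 1)) = q k" using per(1)[of k] p(1) by simp
    have "e (Suc (k + p - 1)) = e k" using per(2)[of k] p(1) by simp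
    then have "e k = other_end (q k) (e (k + p - 1))" using step(2)[of "k + p - 1"] prev by simp
    moreover have D': "(q k, e (k + p - 1)) \<in> D"
      using os[OF qe(2)[of "k + p - 1"]] step(1)[of "k + p - 1"] prev by simp
    ultimately show "w = e k \<or> w = e (k + p - 1)" using oe_only[OF D' that] by auto
  qed
  have "?P = fst ` D"
  proof (rule conn)
    show "?P \<subseteq> fst ` D" using qe(2) by force
    show "?P \<noteq> {}" using p(1) by auto
    fix r r' w assume r: "r \<in> ?P" "(r, w) \<in> D" "(r', w) \<in> D"
    then obtain k where k: "r = q k" by blast
    have "r' = r \<or> r' = other_side w r" using os_only r by blast
    moreover have "other_side w r \<in> ?P"
    proof (rule disjE[OF ends[of k w]])
      show "(q k, w) \<in> D" using r k by simp
      assume "w = e k" then show ?thesis using step(1)[of k] inP[of "Suc k"] k by simp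
    next
      assume w: "w = e (k + p - 1)"
      have "q k = other_side w (q (k + p - 1))" using step(1)[of "k + p - 1"] prev[of k w] r k w by simp
      then have "other_side w r = q (k + p - 1)" using ss[OF qe(2)[of "k + p - 1"]] w k by simp
      then show ?thesis using inP by simp
    qed
    ultimately show "r' \<in> ?P" using r by blast
  qed
  moreover have inj: "inj_on q {..<p}" using qdist by (auto simp: inj_on_def) (metis linorder_neqE_nat)+
  ultimately have evp: "even p" using ev card_image[OF inj] by simp
  \<comment> \<open>Parity of the position in the walk, consistent where the walk closes up since
    \<open>p\<close> is even.\<close>
  define h where "h r = even (the_inv_into {..<p} q r)" for r
  have hq: "h (q k) = even k" for k
  proof -
    have "q k = q (k mod p)" using qmod[of "k mod p" "k div p"] by simp
    then have "h (q k) = even (k mod p)" using the_inv_into_f_f[OF inj, of "k mod p"] p(1) by (simp add: h_def)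
    then show ?thesis using evp by (metis dvd_mod_iff)
  qed
  show ?thesis
  proof (intro exI[of _ h] allI impI)
    fix r r' w assume r: "(r, w) \<in> D" "(r', w) \<in> D" "r \<noteq> r'"
    have "r \<in> ?P" using \<open>?P = fst ` D\<close> r(1) by force
    then obtain k where k: "r = q k" by blast
    have r': "r' = other_side w r" using os_only[OF r(1,2)] r(3) by blast
    show "h r \<noteq> h r'"
    proof (rule disjE[OF ends[of k w]])
      show "(q k, w) \<in> D" using r k by simp
      assume "w = e k" then show ?thesis using step(1)[of k] k r' hq[of k] hq[of "Suc k"] by simp
    next
      assume w: "w = e (k + p - 1)"
      have "q k = other_side w (q (k + p - 1))" using step(1)[of "k + p - 1"] prev[of k w] r k w by simp
      then have "r' = q (k + p - 1)" using ss[OF qe(2)[of "k + p - 1"]] w k r' by simp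
      then show ?thesis using k hq[of k] hq[of "k + p - 1"] evp p(1) by simp
    qed
  qed
qed auto

context layered_complex
begin

section \<open>Vertices and edges of cells\<close>

definition V :: "'a set" where "V = {x \<in> M. card (R x) = n + j}"

text \<open>Through \<open>hits\<close> the common regions define a cell, which is nonempty as it
  contains \<open>u\<close> and \<open>w\<close>; having \<open>n + j - 1\<close> regions, it is an
  edge.\<close>

definition adj :: "'a \<Rightarrow> 'a \<Rightarrow> bool" where
  "adj u w \<longleftrightarrow> u \<in> V \<and> w \<in> V \<and> u \<noteq> w \<and> hits (R u \<inter> R w) \<and> Suc (card (R u \<inter> R w)) = n + j"

definition cell :: "'a set set \<Rightarrow> bool" where "cell A \<longleftrightarrow> hits A \<and> \<Inter>A \<noteq> {}"

definition VC :: "'a set set \<Rightarrow> 'a set" where "VC A = V \<inter> \<Inter>A"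

definition arel :: "'a set set \<Rightarrow> ('a \<times> 'a) set" where
  "arel A = {(u, w). adj u w \<and> u \<in> \<Inter>A \<and> w \<in> \<Inter>A}"

lemma adj_sym: "adj u w \<Longrightarrow> adj w u"
  by (auto simp: adj_def Int_commute)

lemma arel_mono: "A \<subseteq> B \<Longrightarrow> arel B \<subseteq> arel A"
  by (auto simp: arel_def)

lemma arel_VC: "(u, w) \<in> arel A \<Longrightarrow> u \<in> VC A \<and> w \<in> VC A"
  by (auto simp: arel_def adj_def VC_def)

lemma VC_mono: "A \<subseteq> B \<Longrightarrow> VC B \<subseteq> VC A"
  by (auto simp: VC_def)

lemma cell_R: "x \<in> M \<Longrightarrow> cell (R x)"
  using hits_R by (auto simp: cell_def regions_at_def)

lemma mem_Inter_R: "x \<in> \<Inter>(R x)"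
  by (auto simp: regions_at_def)

lemma cell_sub: "cell A \<Longrightarrow> A \<subseteq> Rg"
  by (simp add: cell_def hits_def)

lemma cell_subset_M: "cell A \<Longrightarrow> \<Inter>A \<subseteq> M"
  using hits_subset_M by (simp add: cell_def)

lemma cell_finite: "cell A \<Longrightarrow> finite A"
  using cell_sub finite_Rg finite_subset by blast

lemma Inter_iff_R: "cell A \<Longrightarrow> x \<in> \<Inter>A \<longleftrightarrow> A \<subseteq> R x"
  using mem_Inter_iff[of A x] cell_sub[of A] by blast

lemma cell_card_le: "cell A \<Longrightarrow> card A \<le> n + j"
  unfolding cell_def by (erule conjE, erule cell_ball) auto

lemma card_R_le: "x \<in> M \<Longrightarrow> card (R x) \<le> n + j"
  using cell_R cell_card_le by blast

lemma R_psubset_card: "cell A \<Longrightarrow> x \<in> \<Inter>A \<Longrightarrow> R x \<noteq> A \<Longrightarrow> card A < card (R x)"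
  using Inter_iff_R[of A x] finite_R psubset_card_mono[of "R x" A] by auto

lemma cell_full:
  assumes "cell A" "card A = n + j" "x \<in> \<Inter>A"
  shows "R x = A" "x \<in> V" "\<Inter>A = {x}"
proof -
  have xM: "x \<in> M" using cell_subset_M assms by blast
  show RA: "R x = A"
    using Inter_iff_R[OF assms(1)] assms card_R_le[OF xM] card_seteq[OF finite_R, of A x] by auto
  then show "x \<in> V" using assms(2) xM by (simp add: V_def)
  obtain k f g where h: "homeomorphism (std_ball k) (\<Inter>A) f g" "k + card A = n + j"
    using assms(1) unfolding cell_def by (elim conjE) (rule cell_ball)
  then have "k = 0" using assms(2) by simp
  then have "\<Inter>A = f ` {\<lambda>_. 0}" using h(1) std_ball_0 by (auto simp: homeomorphism_def)
  then show "\<Inter>A = {x}" using assms(3) by auto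
qed

lemma vertex_cell: "w \<in> V \<Longrightarrow> \<Inter>(R w) = {w}"
  using cell_full(3)[of "R w" w] cell_R mem_Inter_R by (auto simp: V_def)

lemma VC_vertex: "w \<in> V \<Longrightarrow> VC (R w) = {w}"
  using vertex_cell by (auto simp: VC_def)

lemma V_eq_iff: "u \<in> V \<Longrightarrow> w \<in> V \<Longrightarrow> R u = R w \<longleftrightarrow> u = w"
  using vertex_cell by (metis singleton_inject)

lemma cell_boundary_nonempty:
  assumes "cell A" "card A < n + j"
  obtains x where "x \<in> \<Inter>A" "R x \<noteq> A"
proof -
  obtain k f g where h: "homeomorphism (std_ball k) (\<Inter>A) f g" "k + card A = n + j"
     "f ` std_sphere k = {x \<in> \<Inter>A. R x \<noteq> A}"
    using assms(1) unfolding cell_def by (elim conjE) (rule cell_ball)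
  then have "std_sphere k \<noteq> {}" using std_sphere_nonempty assms(2) by simp
  then show thesis using that h(3) by blast
qed

text \<open>Descend through the boundary: a boundary point lies in more regions, hence in a smaller
  cell, whose vertices are vertices of \<open>\<Inter>A\<close>.\<close>

lemma VC_nonempty: "cell A \<Longrightarrow> VC A \<noteq> {}"
proof (induction "n + j - card A" arbitrary: A rule: less_induct)
  case less
  show ?case
  proof (cases "card A = n + j")
    case True
    then show ?thesis using cell_full[OF less(2) True] less(2) by (auto simp: VC_def cell_def)
  next
    case False
    then have lt: "card A < n + j" using cell_card_le[OF less(2)] by simp
    obtain x where x: "x \<in> \<Inter>A" "R x \<noteq> A" using cell_boundary_nonempty[OF less(2) lt] .
    have xM: "x \<in> M" using cell_subset_M[OF less(2)] x by blast
    have "card A < card (R x)" using R_psubset_card[OF less(2) x] .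
    then have "VC (R x) \<noteq> {}" using less(1)[of "R x"] cell_R[OF xM] lt by simp
    moreover have "A \<subseteq> R x" using Inter_iff_R[OF less(2)] x by blast
    ultimately show ?thesis using VC_mono by blast
  qed
qed

text \<open>The two boundary points of the 1-ball lie in a further region, and one more region
  already makes a vertex. Distinct vertices have distinct sets of regions, so their common regions
  are no more than those of the edge.\<close>

lemma edge_structure:
  assumes "cell E" "Suc (card E) = n + j"
  obtains u w f g where "u \<noteq> w" "VC E = {u, w}" "E = R u \<inter> R w" "adj u w"
    "homeomorphism (std_ball 1) (\<Inter>E) f g" "f ` std_sphere 1 = {u, w}"
proof -
  obtain k f g where h: "homeomorphism (std_ball k) (\<Inter>E) f g" "k + card E = n + j"
     "f ` std_sphere k = {x \<in> \<Inter>E. R x \<noteq> E}"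
    using assms(1) unfolding cell_def by (elim conjE) (rule cell_ball)
  have k: "k = 1" using h(2) assms(2) by simp
  let ?p = "\<lambda>i::nat. if i = 0 then (1::real) else 0" and ?m = "\<lambda>i::nat. if i = 0 then (-1::real) else 0"
  have pm: "?p \<in> std_ball 1" "?m \<in> std_ball 1" "std_sphere 1 = {?p, ?m}"
    using std_sphere_1 std_sphere_subset_ball[of 1] by (blast, blast, blast)
  have "?p 0 \<noteq> ?m 0" by simp
  then have "?p \<noteq> ?m" by metis
  then have ne: "f ?p \<noteq> f ?m" using h(1) pm k unfolding homeomorphism_def by metis
  define u w where "u = f ?p" and "w = f ?m"
  have uw: "f ` std_sphere 1 = {u, w}" unfolding pm(3) u_def w_def by simp
  then have bd: "{x \<in> \<Inter>E. R x \<noteq> E} = {u, w}" using h(3) k by simp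
  have V: "x \<in> V" "E \<subseteq> R x" if "x \<in> {u, w}" for x
  proof -
    have x: "x \<in> \<Inter>E" "R x \<noteq> E" using that bd by blast+
    have xM: "x \<in> M" using x cell_subset_M assms(1) by blast
    show "x \<in> V" using R_psubset_card[OF assms(1) x] card_R_le[OF xM] assms(2) xM by (simp add: V_def)
    show "E \<subseteq> R x" using Inter_iff_R[OF assms(1)] x by blast
  qed
  have Vuw: "u \<in> V" "w \<in> V" "E \<subseteq> R u" "E \<subseteq> R w" using V by blast+
  then have cuw: "card (R u) = n + j" "card (R w) = n + j" by (simp_all add: V_def)
  have "u \<noteq> w" using ne u_def w_def by simp
  then have "R u \<noteq> R w" using V_eq_iff Vuw by blast
  then have "\<not> R u \<subseteq> R w" using card_subset_eq[OF finite_R] cuw by metis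
  then have "R u \<inter> R w \<subset> R u" by blast
  then have "card (R u \<inter> R w) < n + j" using psubset_card_mono[OF finite_R] cuw by metis
  then have "card (R u \<inter> R w) \<le> card E" using assms(2) by simp
  then have E: "E = R u \<inter> R w"
    using Vuw card_seteq[of "R u \<inter> R w" E] finite_R by simp
  have "adj u w" unfolding adj_def using Vuw \<open>u \<noteq> w\<close> assms E[symmetric] by (simp add: cell_def)
  moreover have "VC E = {u, w}"
  proof
    show "VC E \<subseteq> {u, w}"
    proof
      fix x assume x: "x \<in> VC E"
      then have "R x \<noteq> E" using assms(2) by (auto simp: VC_def V_def)
      then show "x \<in> {u, w}" using bd x unfolding VC_def by blast
    qed
    show "{u, w} \<subseteq> VC E" using Vuw(1,2) bd unfolding VC_def by blast
  qed
  ultimately show thesis using that[of u w f g] ne uw E h(1) k u_def w_def by simp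
qed

lemma adj_cell: "adj u w \<Longrightarrow> cell (R u \<inter> R w)"
  using mem_Inter_R by (fastforce simp: adj_def cell_def)

lemma adj_edge_VC: "adj u w \<Longrightarrow> VC (R u \<inter> R w) = {u, w}"
proof -
  assume a: "adj u w"
  obtain u' w' where "VC (R u \<inter> R w) = {u', w'}"
    using edge_structure[OF adj_cell[OF a]] a unfolding adj_def by metis
  moreover have "u \<in> VC (R u \<inter> R w)" "w \<in> VC (R u \<inter> R w)" "u \<noteq> w"
    using a mem_Inter_R by (auto simp: VC_def adj_def)
  ultimately show ?thesis by auto
qed

text \<open>From dimension 2 on the boundary sphere is connected. Assign to each boundary point the
  vertices of the smallest cell containing it. Whether all of these can be reached from
  \<open>u\<close> is locally constant: the smallest cell of a point near \<open>a\<close> contains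
  that of \<open>a\<close>, and its vertices are connected by induction.\<close>

lemma vertices_connected:
  assumes "cell A" "u \<in> VC A" "w \<in> VC A"
  shows "(u, w) \<in> (arel A)\<^sup>*"
  using assms
proof (induction "n + j - card A" arbitrary: A u w rule: less_induct)
  case less
  consider "card A = n + j" | "Suc (card A) = n + j" | "card A + 2 \<le> n + j"
    using cell_card_le[OF less(2)] by linarith
  then show ?case
  proof cases
    case 1
    then have "u = w" using cell_full(3)[OF less(2) 1, of u] less(3,4) by (auto simp: VC_def)
    then show ?thesis by simp
  next
    case 2
    obtain u' w' where e: "VC A = {u', w'}" "adj u' w'" using edge_structure[OF less(2) 2] by metis
    then have "(u', w') \<in> arel A" "(w', u') \<in> arel A" using adj_sym by (auto simp: arel_def VC_def)
    then show ?thesis using e less(3,4) by auto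
  next
    case 3
    obtain k f g where h: "homeomorphism (std_ball k) (\<Inter>A) f g" "k + card A = n + j"
       "f ` std_sphere k = {x \<in> \<Inter>A. R x \<noteq> A}"
      using less(2) unfolding cell_def by (elim conjE) (rule cell_ball)
    let ?B = "{x \<in> \<Inter>A. R x \<noteq> A}"
    have cB: "connected ?B" unfolding h(3)[symmetric]
      by (intro connected_continuous_image connected_std_sphere continuous_on_subset[OF _ std_sphere_subset_ball])
        (use h 3 in \<open>auto simp: homeomorphism_def\<close>)
    have BM: "x \<in> M" "A \<subseteq> R x" "n + j - card (R x) < n + j - card A" if "x \<in> ?B" for x
      using that cell_subset_M[OF less(2)] Inter_iff_R[OF less(2)] R_psubset_card[OF less(2), of x] 3 by auto
    define P where "P x \<longleftrightarrow> (\<forall>z\<in>VC (R x). (u, z) \<in> (arel A)\<^sup>*)" for x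
    have "P constant_on ?B"
    proof (rule locally_constant_imp_constant[OF cB])
      fix a assume a: "a \<in> ?B"
      obtain U where U: "openin (top_of_set M) U" "a \<in> U" "\<And>y. y \<in> U \<Longrightarrow> R y \<subseteq> R a"
        using nbhd_R[OF BM(1)[OF a]] by blast
      have "P y = P a" if y: "y \<in> ?B \<inter> U" for y
      proof
        have sub: "R y \<subseteq> R a" using U y by blast
        show "P a" if "P y" using that VC_mono[OF sub] by (auto simp: P_def)
        show "P y" if Pa: "P a"
          unfolding P_def
        proof
          fix z assume z: "z \<in> VC (R y)"
          obtain z0 where z0: "z0 \<in> VC (R a)" using VC_nonempty[OF cell_R[OF BM(1)[OF a]]] by blast
          have yB: "y \<in> ?B" using y by blast
          have "(z0, z) \<in> (arel (R y))\<^sup>*"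
            using less(1)[OF BM(3)[OF yB] cell_R[OF BM(1)[OF yB]] _ z] z0 VC_mono[OF sub] by blast
          then have "(z0, z) \<in> (arel A)\<^sup>*" using rtrancl_mono[OF arel_mono[OF BM(2)[OF yB]]] by blast
          moreover have "(u, z0) \<in> (arel A)\<^sup>*" using Pa z0 by (simp add: P_def)
          ultimately show "(u, z) \<in> (arel A)\<^sup>*" by simp
        qed
      qed
      moreover have "openin (top_of_set ?B) (?B \<inter> U)"
      proof -
        have "?B \<subseteq> M" using BM by blast
        obtain T where "open T" "U = M \<inter> T" using U(1) by (auto simp: openin_open)
        then have "?B \<inter> U = ?B \<inter> T" using \<open>?B \<subseteq> M\<close> by blast
        then show ?thesis using \<open>open T\<close> openin_open by blast
      qed
      ultimately show "\<exists>T. openin (top_of_set ?B) T \<and> a \<in> T \<and> (\<forall>x\<in>T. P x = P a)"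
        using a U(2) by (intro exI[of _ "?B \<inter> U"]) blast
    qed
    moreover have VB: "z \<in> ?B" "VC (R z) = {z}" if "z \<in> VC A" for z
      using that 3 VC_vertex by (auto simp: VC_def V_def)
    moreover have "P u" using VB(2)[OF less(3)] by (simp add: P_def)
    ultimately have "P w" using less(3,4) unfolding constant_on_def by metis
    then show ?thesis using VB(2)[OF less(4)] by (simp add: P_def)
  qed
qed

end

context layered_complex
begin

section \<open>Colorings at vertices and coherence on cells\<close>

definition Col :: "'a \<Rightarrow> ('a set \<Rightarrow> nat) set" where
  "Col w = {c \<in> extensional (R w). bij_betw c (R w) {1..n + j}}"

text \<open>Agreement on the common regions is all there is to transport along an edge, since just
  one color remains for the one new region.\<close>

definition coh :: "'a set set \<Rightarrow> ('a \<Rightarrow> 'a set \<Rightarrow> nat) \<Rightarrow> bool" where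
  "coh A s \<longleftrightarrow> (\<forall>w\<in>VC A. s w \<in> Col w) \<and> (\<forall>(u, w)\<in>arel A. \<forall>r\<in>R u \<inter> R w. s u r = s w r)"

text \<open>Surjectivity of evaluation at a vertex; the matching injectivity holds on every cell by
  \<open>coh_unique\<close>.\<close>

definition good :: "'a set set \<Rightarrow> bool" where
  "good A \<longleftrightarrow> (\<forall>u\<in>VC A. \<forall>c\<in>Col u. \<exists>s. coh A s \<and> s u = c)"

lemma cohD:
  assumes "coh A s"
  shows "w \<in> VC A \<Longrightarrow> s w \<in> Col w" "(u, w) \<in> arel A \<Longrightarrow> r \<in> R u \<Longrightarrow> r \<in> R w \<Longrightarrow> s u r = s w r"
  using assms unfolding coh_def by blast+

lemma coh_mono:
  assumes "A \<subseteq> B" "coh A s" shows "coh B s"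
  using assms(2) VC_mono[OF assms(1)] arel_mono[OF assms(1)] unfolding coh_def by blast

lemma coh_cong:
  assumes "coh A s" "\<And>w. w \<in> VC A \<Longrightarrow> s w = s' w" shows "coh A s'"
  unfolding coh_def
proof (intro conjI ballI, goal_cases)
  case (1 w) then show ?case using cohD(1)[OF assms(1)] assms(2) by metis
next
  case (2 p)
  then obtain u w where p: "p = (u, w)" "(u, w) \<in> arel A" by (cases p) auto
  then have "u \<in> VC A" "w \<in> VC A" using arel_VC by blast+
  then show ?case using cohD(2)[OF assms(1) p(2)] assms(2) p(1) by auto
qed

text \<open>Only one region of \<open>R w\<close> lies outside \<open>E\<close>, and it must receive
  the one color left over.\<close>

lemma Col_unique:
  assumes "c \<in> Col w" "c' \<in> Col w" "E \<subseteq> R w" "Suc (card E) = n + j" "w \<in> V" "\<And>r. r \<in> E \<Longrightarrow> c r = c' r"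
  shows "c = c'"
proof -
  have b: "bij_betw c (R w) {1..n + j}" "bij_betw c' (R w) {1..n + j}" using assms(1,2) by (auto simp: Col_def)
  have "card (R w - E) = 1"
    using assms(3,4,5) finite_R by (simp add: card_Diff_subset finite_subset[OF assms(3) finite_R] V_def)
  then obtain r0 where r0: "R w - E = {r0}" using card_1_singletonE by blast
  then have Rw: "R w = insert r0 E" "r0 \<notin> E" "r0 \<in> R w" using assms(3) by blast+
  have "c ` E = c' ` E" using assms(6) by (auto intro!: image_cong)
  moreover have "{1..n + j} - c ` E = {c r0}" "{1..n + j} - c' ` E = {c' r0}"
    using b Rw unfolding bij_betw_def inj_on_def by auto
  ultimately have "c r0 = c' r0" by auto
  then have "c r = c' r" if "r \<in> R w" for r using that assms(6) Rw by auto
  then show ?thesis using assms(1,2) by (intro extensionalityI[of _ "R w"]) (auto simp: Col_def)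
qed

lemma Col_transport:
  assumes "adj u w" "c \<in> Col u"
  obtains c' where "c' \<in> Col w" "\<And>r. r \<in> R u \<Longrightarrow> r \<in> R w \<Longrightarrow> c r = c' r"
proof -
  let ?E = "R u \<inter> R w"
  have V: "card (R u) = n + j" "card (R w) = n + j" "Suc (card ?E) = n + j" using assms(1) by (auto simp: adj_def V_def)
  have "card (R u - ?E) = 1" "card (R w - ?E) = 1"
    using V finite_R by (simp_all add: card_Diff_subset)
  then obtain p q where p: "R u - ?E = {p}" and q: "R w - ?E = {q}" using card_1_singletonE by metis
  have Ru: "R u = insert p ?E" "p \<notin> ?E" and Rw: "R w = insert q ?E" "q \<notin> ?E" using p q by blast+
  have b: "bij_betw c (insert p ?E) {1..n + j}" using assms(2) Ru(1) unfolding Col_def by simp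
  define c' where "c' = (\<lambda>r\<in>R w. if r = q then c p else c r)"
  have cE: "c' r = c r" if "r \<in> ?E" for r using that Rw by (auto simp: c'_def)
  have cq: "c' q = c p" using q by (auto simp: c'_def)
  have "inj_on c' (R w)"
  proof -
    have "inj_on c' ?E" using b cE by (auto simp: bij_betw_def inj_on_def)
    moreover have "c' q \<notin> c' ` ?E"
    proof
      assume "c' q \<in> c' ` ?E"
      then obtain r where "r \<in> ?E" "c p = c r" using cq cE by auto
      then have "p = r" using b unfolding bij_betw_def by (auto dest: inj_onD)
      then show False using Ru(2) \<open>r \<in> ?E\<close> by blast
    qed
    ultimately have "inj_on c' (insert q ?E)" using Rw(2) by (simp add: inj_on_insert)
    then show ?thesis by (subst Rw(1))
  qed
  moreover have "c' ` R w = {1..n + j}"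
  proof -
    have "c' ` ?E = c ` ?E" using cE by (rule image_cong[OF refl])
    then have "c' ` R w = c ` insert p ?E" using cq Rw(1) by (metis image_insert)
    then show ?thesis using b by (simp add: bij_betw_def)
  qed
  ultimately have "c' \<in> Col w" by (auto simp: Col_def bij_betw_def c'_def)
  then show thesis using that[of c'] cE by auto
qed

lemma coh_unique:
  assumes "cell A" "coh A s" "coh A s'" "u \<in> VC A" "s u = s' u" "w \<in> VC A"
  shows "s w = s' w"
  using vertices_connected[OF assms(1,4,6)]
proof (induction rule: rtrancl_induct)
  case base then show ?case by (rule assms(5))
next
  case (step y z)
  have yz: "y \<in> VC A" "z \<in> VC A" "adj y z" using arel_VC[OF step(2)] step(2) by (auto simp: arel_def)
  show ?case
  proof (rule Col_unique)
    show "s z \<in> Col z" "s' z \<in> Col z" using cohD(1) assms yz by blast+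
    show "R y \<inter> R z \<subseteq> R z" "Suc (card (R y \<inter> R z)) = n + j" "z \<in> V" using yz by (auto simp: adj_def)
    show "s z r = s' z r" if "r \<in> R y \<inter> R z" for r
      using cohD(2)[OF assms(2) step(2)] cohD(2)[OF assms(3) step(2)] step(3) that by (metis Int_iff)
  qed
qed

lemma good_full: "cell A \<Longrightarrow> card A = n + j \<Longrightarrow> good A"
proof -
  assume A: "cell A" "card A = n + j"
  have one: "w = u" if "u \<in> VC A" "w \<in> VC A" for u w
    using that cell_full(3)[OF A, of u] by (auto simp: VC_def)
  show "good A"
    unfolding good_def
  proof (intro ballI)
    fix u c assume u: "u \<in> VC A" "c \<in> Col u"
    have "(a, b) \<notin> arel A" for a b
      using arel_VC[of a b A] one by (auto simp: arel_def adj_def)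
    then have "coh A (\<lambda>_. c)" using one[OF u(1)] u unfolding coh_def by blast
    then show "\<exists>s. coh A s \<and> s u = c" by auto
  qed
qed

lemma good_edge: "cell A \<Longrightarrow> Suc (card A) = n + j \<Longrightarrow> good A"
proof -
  assume A: "cell A" "Suc (card A) = n + j"
  show "good A"
    unfolding good_def
  proof (intro ballI)
    fix u c assume u: "u \<in> VC A" "c \<in> Col u"
    obtain u' w' where e: "VC A = {u', w'}" "adj u' w'" by (rule edge_structure[OF A]) blast
    have "\<exists>w. VC A = {u, w} \<and> adj u w"
    proof (cases "u = u'")
      case True then show ?thesis using e by blast
    next
      case False
      then have "u = w'" using u(1) e(1) by simp
      then show ?thesis using e(1) adj_sym[OF e(2)] by (intro exI[of _ u']) (simp add: insert_commute)
    qed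
    then obtain w where w: "VC A = {u, w}" "adj u w" by blast
    obtain c' where c': "c' \<in> Col w" "\<And>r. r \<in> R u \<Longrightarrow> r \<in> R w \<Longrightarrow> c r = c' r"
      using Col_transport[OF w(2) u(2)] by blast
    have "u \<noteq> w" using w(2) by (simp add: adj_def)
    let ?s = "\<lambda>x. if x = u then c else c'"
    have "coh A ?s"
      unfolding coh_def
    proof (intro conjI ballI, goal_cases)
      case (1 x) then show ?case using w u c' by auto
    next
      case (2 p)
      then obtain a b where p: "p = (a, b)" "(a, b) \<in> arel A" by (cases p) auto
      then have "a \<in> {u, w}" "b \<in> {u, w}" "a \<noteq> b" using arel_VC[OF p(2)] w(1) by (auto simp: arel_def adj_def)
      then show ?case using p(1) c'(2) \<open>u \<noteq> w\<close> by auto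
    qed
    then show "\<exists>s. coh A s \<and> s u = c" by auto
  qed
qed

text \<open>The sides of the polygon \<open>\<Inter>A\<close> correspond to the regions outside
  \<open>A\<close> that meet it, and exactly two of these pass through each vertex. So
  \<open>D\<close> is the incidence relation of a polygon, whose number of sides is even by
  hypothesis.\<close>

lemma two_cell_two_coloring:
  assumes A: "cell A" "card A + 2 = n + j"
  obtains h :: "'a set \<Rightarrow> bool" where "\<And>w r r'. w \<in> VC A \<Longrightarrow> r \<in> R w - A \<Longrightarrow> r' \<in> R w - A \<Longrightarrow> r \<noteq> r' \<Longrightarrow> h r \<noteq> h r'"
proof -
  define D where "D = {(r, w). w \<in> VC A \<and> r \<in> R w - A}"
  have finA: "finite A" using cell_finite[OF A(1)] .
  have AR: "A \<subseteq> R w" "card (R w) = n + j" "w \<in> V" if "w \<in> VC A" for w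
    using that Inter_iff_R[OF A(1), of w] by (auto simp: VC_def V_def)
  have c2: "card (R w - A) = 2" if "w \<in> VC A" for w
    using AR[OF that] finA A(2) by (simp add: card_Diff_subset)
  have ins: "cell (insert r A)" "Suc (card (insert r A)) = n + j" if "r \<in> Rg" "r \<notin> A" "\<Inter>(insert r A) \<noteq> {}" for r
    using that A finA by (auto simp: cell_def hits_def)
  have Dside: "r \<in> Rg" "r \<notin> A" "\<Inter>(insert r A) \<noteq> {}" if "(r, w) \<in> D" for r w
    using that by (auto simp: D_def VC_def regions_at_def)
  have Dends: "{w. (r, w) \<in> D} = VC (insert r A)" if "r \<in> Rg" "r \<notin> A" for r
    using that by (auto simp: D_def VC_def regions_at_def)
  have e2: "card (VC (insert r A)) = 2" if "r \<in> Rg" "r \<notin> A" "\<Inter>(insert r A) \<noteq> {}" for r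
    by (rule edge_structure[OF ins[OF that]]) (unfold card_2_iff, blast)
  define other_end where "other_end r w = (THE w'. VC (insert r A) - {w} = {w'})" for r w
  define other_side where "other_side w r = (THE r'. R w - A - {r} = {r'})" for r w
  have the1: "B - {a} = {THE a'. B - {a} = {a'}}" if "card B = 2" "a \<in> B" for a :: 'x and B
  proof -
    have "card (B - {a}) = 1" using that by (simp add: card_Diff_singleton_if)
    then obtain x where "B - {a} = {x}" using card_1_singletonE by blast
    then show ?thesis by auto
  qed
  have oe: "VC (insert r A) - {w} = {other_end r w}" if "(r, w) \<in> D" for r w
    unfolding other_end_def using the1[OF e2[OF Dside[OF that]], of w] Dends[OF Dside(1,2)[OF that]] that by blast
  have os: "R w - A - {r} = {other_side w r}" if "(r, w) \<in> D" for r w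
    unfolding other_side_def using the1[OF c2, of w r] that by (auto simp: D_def)
  have Dfst: "fst ` D = {r \<in> Rg. r \<notin> A \<and> \<Inter>(insert r A) \<noteq> {}}" (is "_ = ?Q")
  proof
    show "fst ` D \<subseteq> ?Q" using Dside by fastforce
    show "?Q \<subseteq> fst ` D"
    proof
      fix r assume r: "r \<in> ?Q"
      then have "VC (insert r A) \<noteq> {}" using VC_nonempty[OF ins(1)] by blast
      then obtain w where "(r, w) \<in> D" using Dends[of r] r by blast
      then show "r \<in> fst ` D" by force
    qed
  qed
  have edges: "{e \<in> cells_of_dim 1 (layer_cells n j X). e \<subseteq> \<Inter>A} = (\<lambda>r. \<Inter>(insert r A)) ` ?Q"
  proof (intro equalityI subsetI)
    fix e assume "e \<in> {e \<in> cells_of_dim 1 (layer_cells n j X). e \<subseteq> \<Inter>A}"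
    then obtain E where E: "e = \<Inter>E" "cell E" "is_ball 1 e" "e \<subseteq> \<Inter>A"
      by (auto simp: cells_of_dim_def layer_cells_def cell_def hits_def)
    have cE: "Suc (card E) = n + j" using cell_dim[of E 1] E by (simp add: cell_def)
    obtain u where u: "u \<in> \<Inter>E" "R u = E" using E(2) cell_interior_point unfolding cell_def by metis
    then have AE: "A \<subseteq> E" using E Inter_iff_R[OF A(1), of u] by blast
    then have "card (E - A) = 1" using cE A(2) finA by (simp add: card_Diff_subset)
    then obtain r where "E - A = {r}" using card_1_singletonE by blast
    then have "E = insert r A" "r \<notin> A" using AE by blast+
    then show "e \<in> (\<lambda>r. \<Inter>(insert r A)) ` ?Q" using E by (auto simp: cell_def hits_def)
  next
    fix e assume "e \<in> (\<lambda>r. \<Inter>(insert r A)) ` ?Q"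
    then obtain r where r: "r \<in> ?Q" "e = \<Inter>(insert r A)" by blast
    then have c: "cell (insert r A)" "Suc (card (insert r A)) = n + j" using ins by blast+
    then have "is_ball 1 e" using cell_dim[of "insert r A" 1] r(2) by (simp add: cell_def)
    moreover have "e \<in> layer_cells n j X" using c(1) r(2) unfolding layer_cells_def cell_def hits_def by blast
    ultimately show "e \<in> {e \<in> cells_of_dim 1 (layer_cells n j X). e \<subseteq> \<Inter>A}" using r(2) by (auto simp: cells_of_dim_def)
  qed
  \<comment> \<open>An interior point of an edge lies in no region outside
    \<open>insert r A\<close>, so the edge determines \<open>r\<close> and counting edges amounts to
    counting sides.\<close>
  have inj: "inj_on (\<lambda>r. \<Inter>(insert r A)) ?Q"
  proof (rule inj_onI)
    fix r r' assume r: "r \<in> ?Q" "r' \<in> ?Q" "\<Inter>(insert r A) = \<Inter>(insert r' A)"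
    have c: "cell (insert r A)" using ins r(1) by blast
    obtain u where u: "u \<in> \<Inter>(insert r A)" "R u = insert r A"
      using c cell_interior_point unfolding cell_def by metis
    then have "u \<in> r'" using r(3) by auto
    then have "r' \<in> R u" using r(2) by (simp add: regions_at_def)
    then show "r = r'" using u(2) r(2) by auto
  qed
  have "\<Inter>A \<in> cells_of_dim 2 (layer_cells n j X)"
    using cell_dim[of A 2] A unfolding cells_of_dim_def layer_cells_def cell_def hits_def by (auto simp: add.commute)
  then have "even (card ((\<lambda>r. \<Inter>(insert r A)) ` ?Q))"
    using ecpx edges unfolding layer_ecpx_def by metis
  then have ev: "even (card (fst ` D))" using card_image[OF inj] Dfst by simp
  have finD: "finite D"
  proof -
    have "finite (fst ` D)" unfolding Dfst using finite_Rg by simp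
    moreover have "finite {w. (r, w) \<in> D}" for r
    proof (cases "r \<in> fst ` D")
      case True
      then show ?thesis using Dends[of r] e2[of r] unfolding Dfst by (metis (mono_tags, lifting) card.infinite mem_Collect_eq zero_neq_numeral)
    next
      case False
      then have "{w. (r, w) \<in> D} = {}" by force
      then show ?thesis by simp
    qed
    ultimately have "finite (SIGMA r:fst ` D. {w. (r, w) \<in> D})" by blast
    moreover have "D \<subseteq> (SIGMA r:fst ` D. {w. (r, w) \<in> D})" by force
    ultimately show ?thesis using finite_subset by blast
  qed
  \<comment> \<open>Adjacent vertices have a side in common, so a set of sides closed under change
    of side at a vertex spreads along the edges to all vertices.\<close>
  have conn: "P = fst ` D" if P: "P \<subseteq> fst ` D" "P \<noteq> {}"
    "\<And>r r' w. r \<in> P \<Longrightarrow> (r, w) \<in> D \<Longrightarrow> (r', w) \<in> D \<Longrightarrow> r' \<in> P" for P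
  proof
    show "fst ` D \<subseteq> P"
    proof
      fix r1 assume "r1 \<in> fst ` D"
      then obtain w where w: "(r1, w) \<in> D" by force
      obtain r0 where r0: "r0 \<in> P" using P(2) by blast
      then obtain u where u: "(r0, u) \<in> D" using P(1) by force
      have "(u, w) \<in> (arel A)\<^sup>*" using vertices_connected[OF A(1)] u w by (auto simp: D_def)
      then have "\<forall>r. (r, w) \<in> D \<longrightarrow> r \<in> P"
      proof (induction rule: rtrancl_induct)
        case base then show ?case using P(3)[OF r0 u] by blast
      next
        case (step y z)
        have yz: "y \<in> VC A" "z \<in> VC A" "adj y z" using arel_VC[OF step(2)] step(2) by (auto simp: arel_def)
        have "card A < card (R y \<inter> R z)" using yz(3) A(2) by (simp add: adj_def)
        then obtain q where "q \<in> R y \<inter> R z" "q \<notin> A" using finA card_mono by (metis leD subsetI)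
        then have "(q, y) \<in> D" "(q, z) \<in> D" using yz by (auto simp: D_def)
        then show ?case using P(3) step(3) by blast
      qed
      then show "r1 \<in> P" using w by blast
    qed
  qed (use P in blast)
  have "\<exists>h::'a set \<Rightarrow> bool. \<forall>r r' w. (r, w) \<in> D \<longrightarrow> (r', w) \<in> D \<longrightarrow> r \<noteq> r' \<longrightarrow> h r \<noteq> h r'"
  proof (rule even_cycle_two_coloring[OF finD, of other_end other_side])
    fix r w assume d: "(r, w) \<in> D"
    have VCD: "VC (insert r A) = {w. (r, w) \<in> D}" using Dends[OF Dside(1,2)[OF d]] by simp
    show "(r, other_end r w) \<in> D \<and> other_end r w \<noteq> w" using oe[OF d] VCD by blast
    show "w' = w \<or> w' = other_end r w" if "(r, w') \<in> D" for w' using oe[OF d] VCD that by blast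
    have w: "w \<in> VC A" using d by (simp add: D_def)
    show "(other_side w r, w) \<in> D \<and> other_side w r \<noteq> r" using os[OF d] w unfolding D_def by blast
    show "r' = r \<or> r' = other_side w r" if "(r', w) \<in> D" for r' using os[OF d] that unfolding D_def by blast
  next
    fix P assume "P \<subseteq> fst ` D" "P \<noteq> {}"
      "\<And>r r' w. r \<in> P \<Longrightarrow> (r, w) \<in> D \<Longrightarrow> (r', w) \<in> D \<Longrightarrow> r' \<in> P"
    then show "P = fst ` D" by (rule conn)
  qed (rule ev)
  then obtain h :: "'a set \<Rightarrow> bool" where "\<forall>r r' w. (r, w) \<in> D \<longrightarrow> (r', w) \<in> D \<longrightarrow> r \<noteq> r' \<longrightarrow> h r \<noteq> h r'" by blast
  then show thesis by (intro that[of h]) (unfold D_def, blast)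
qed

text \<open>Regions of \<open>A\<close> keep their colors, and the two remaining colors go to the
  sides according to their class under \<open>h\<close>. A single function on regions induces the
  colorings at all vertices, so coherence is automatic.\<close>

lemma good_two_cell:
  assumes A: "cell A" "card A + 2 = n + j"
  shows "good A"
  unfolding good_def
proof (intro ballI)
  fix u c assume u: "u \<in> VC A" "c \<in> Col u"
  obtain h :: "'a set \<Rightarrow> bool" where h: "\<And>w r r'. w \<in> VC A \<Longrightarrow> r \<in> R w - A \<Longrightarrow> r' \<in> R w - A \<Longrightarrow> r \<noteq> r' \<Longrightarrow> h r \<noteq> h r'"
    using two_cell_two_coloring[OF A] by blast
  have AR: "A \<subseteq> R w" "card (R w - A) = 2" if "w \<in> VC A" for w
    using that Inter_iff_R[OF A(1), of w] cell_finite[OF A(1)] A(2) by (auto simp: VC_def V_def card_Diff_subset)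
  obtain p p' where p: "R u - A = {p, p'}" "p \<noteq> p'" using AR(2)[OF u(1)] by (auto simp: card_2_iff)
  have hp: "h p \<noteq> h p'" using h[OF u(1)] p by blast
  have Ru: "R u = insert p (insert p' A)" "p \<notin> A" "p' \<notin> A" using p AR(1)[OF u(1)] by blast+
  have b: "bij_betw c (R u) {1..n + j}" using u(2) by (simp add: Col_def)
  define \<gamma> where "\<gamma> r = (if r \<in> A then c r else if h r = h p then c p else c p')" for r
  define s where "s w = restrict \<gamma> (R w)" for w
  have "s w \<in> Col w" if w: "w \<in> VC A" for w
  proof -
    obtain q0 q1 where q01: "R w - A = {q0, q1}" "q0 \<noteq> q1" using AR(2)[OF w] by (auto simp: card_2_iff)
    have "h q0 \<noteq> h q1" using h[OF w] q01 by blast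
    then obtain q q' where q: "R w - A = {q, q'}" "h q = h p" "h q' \<noteq> h p"
      using q01(1) by (cases "h q0 = h p") (metis, metis insert_commute)
    have Rw: "R w = insert q (insert q' A)" "q \<notin> A" "q' \<notin> A" "q \<noteq> q'" using q AR(1)[OF w] by blast+
    \<comment> \<open>\<open>t\<close> matches the regions at \<open>w\<close> with those at
      \<open>u\<close>, sides of equal class with each other, so \<open>s w\<close> inherits
      bijectivity from \<open>c\<close>.\<close>
    define t where "t r = (if r = q then p else if r = q' then p' else r)" for r
    have "bij_betw t (R w) (R u)" unfolding bij_betw_def inj_on_def Rw(1) Ru(1)
      using Rw(2-4) Ru(2,3) p(2) by (auto simp: t_def image_iff)
    then have "bij_betw (c \<circ> t) (R w) {1..n + j}" using b by (rule bij_betw_trans)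
    moreover have "s w r = (c \<circ> t) r" if "r \<in> R w" for r
      using that q Rw unfolding s_def \<gamma>_def t_def by auto
    ultimately have "bij_betw (s w) (R w) {1..n + j}" using bij_betw_cong[of "R w" "s w" "c \<circ> t"] by blast
    then show ?thesis by (simp add: Col_def s_def)
  qed
  then have "coh A s" unfolding coh_def by (auto simp: s_def)
  moreover have "s u = c"
  proof (rule extensionalityI[of _ "R u"])
    show "c \<in> extensional (R u)" using u(2) by (simp add: Col_def)
    show "s u r = c r" if "r \<in> R u" for r using that Ru hp by (auto simp: s_def \<gamma>_def)
  qed (simp add: s_def)
  ultimately show "\<exists>s. coh A s \<and> s u = c" by blast
qed

text \<open>The stalk at \<open>x\<close> consists of the coherent colorings of the smallest cell containing \<open>x\<close>.\<close>

definition leR :: "'a \<Rightarrow> 'a \<Rightarrow> bool" where "leR y x \<longleftrightarrow> R y \<subseteq> R x"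

definition FibR :: "'a \<Rightarrow> ('a \<Rightarrow> 'a set \<Rightarrow> nat) set" where
  "FibR x = {s \<in> extensional (VC (R x)). coh (R x) s}"

text \<open>If \<open>R y \<subseteq> R x\<close>, the smallest cell at \<open>x\<close> is
  contained in the one at \<open>y\<close>; hence the direction of restriction.\<close>

definition rhoR :: "'a \<Rightarrow> 'a \<Rightarrow> ('a \<Rightarrow> 'a set \<Rightarrow> nat) \<Rightarrow> 'a \<Rightarrow> 'a set \<Rightarrow> nat" where
  "rhoR y x s = restrict s (VC (R x))"

lemma restrict_FibR: "coh (R x) s \<Longrightarrow> restrict s (VC (R x)) \<in> FibR x"
  using coh_cong[of "R x" s "restrict s (VC (R x))"] by (simp add: FibR_def)

text \<open>Restriction is injective by \<open>coh_unique\<close> and surjective because the larger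
  cell is good. A general \<open>Y\<close> allows the use on the boundary of a cell, before all
  cells are known to be good.\<close>

lemma local_system_cells:
  assumes YM: "Y \<subseteq> M" and gd: "\<And>x. x \<in> Y \<Longrightarrow> good (R x)"
  shows "local_system Y leR FibR rhoR"
proof
  fix x assume x: "x \<in> Y"
  show "leR x x" by (simp add: leR_def)
  show "rhoR x x c = c" if "c \<in> FibR x" for c
    using that by (simp add: rhoR_def FibR_def extensional_restrict)
  show "openin (top_of_set Y) {y \<in> Y. leR y x}"
  proof (subst openin_subopen, intro ballI)
    fix a assume a: "a \<in> {y \<in> Y. leR y x}"
    obtain U where U: "openin (top_of_set M) U" "a \<in> U" "\<And>y. y \<in> U \<Longrightarrow> R y \<subseteq> R a"
      using nbhd_R[of a] a YM by blast
    obtain T where T: "open T" "U = M \<inter> T" using U(1) by (auto simp: openin_open)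
    have "openin (top_of_set Y) (Y \<inter> T)" using T(1) by (simp add: openin_open_Int)
    moreover have "a \<in> Y \<inter> T" using a U(2) T by blast
    moreover have "Y \<inter> T \<subseteq> {y \<in> Y. leR y x}"
      using U(3) T(2) YM a unfolding leR_def by blast
    ultimately show "\<exists>T. openin (top_of_set Y) T \<and> a \<in> T \<and> T \<subseteq> {y \<in> Y. leR y x}" by blast
  qed
next
  fix x y assume x: "x \<in> Y" and y: "y \<in> Y" and "leR y x"
  then have sub: "R y \<subseteq> R x" by (simp add: leR_def)
  have cx: "cell (R x)" "cell (R y)" using x y YM cell_R by blast+
  obtain u where u: "u \<in> VC (R x)" using VC_nonempty[OF cx(1)] by blast
  then have u': "u \<in> VC (R y)" using VC_mono[OF sub] by blast
  show "bij_betw (rhoR y x) (FibR y) (FibR x)"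
    unfolding bij_betw_def
  proof
    show "inj_on (rhoR y x) (FibR y)"
    proof (rule inj_onI)
      fix s s' assume s: "s \<in> FibR y" "s' \<in> FibR y" "rhoR y x s = rhoR y x s'"
      have "s u = s' u" using fun_cong[OF s(3), of u] u by (simp add: rhoR_def)
      then have "s w = s' w" if "w \<in> VC (R y)" for w
        using coh_unique[OF cx(2) _ _ u' _ that] s(1,2) by (simp add: FibR_def)
      then show "s = s'" using s(1,2) by (intro extensionalityI[of _ "VC (R y)"]) (auto simp: FibR_def)
    qed
    show "rhoR y x ` FibR y = FibR x"
    proof (intro equalityI subsetI)
      fix s assume "s \<in> rhoR y x ` FibR y"
      then show "s \<in> FibR x" using restrict_FibR coh_mono[OF sub] by (auto simp: rhoR_def FibR_def)
    next
      fix s assume s: "s \<in> FibR x"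
      then have "s u \<in> Col u" using cohD(1) u by (auto simp: FibR_def)
      then obtain s' where s': "coh (R y) s'" "s' u = s u" using gd[OF y] u' unfolding good_def by blast
      let ?s = "restrict s' (VC (R y))"
      have F: "?s \<in> FibR y" using restrict_FibR s'(1) by blast
      have "s w = rhoR y x ?s w" if w: "w \<in> VC (R x)" for w
      proof -
        have "s w = s' w" using coh_unique[OF cx(1) _ coh_mono[OF sub s'(1)] u _ w, of s] s s'(2) by (simp add: FibR_def)
        then show ?thesis using w VC_mono[OF sub] by (auto simp: rhoR_def)
      qed
      then have "s = rhoR y x ?s"
        using s by (intro extensionalityI[of _ "VC (R x)"]) (auto simp: FibR_def rhoR_def)
      then show "s \<in> rhoR y x ` FibR y" using F by blast
    qed
  qed
next
  fix x y z c assume "leR z y" "leR y x"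
  then have "VC (R x) \<subseteq> VC (R y)" using VC_mono by (simp add: leR_def)
  then show "rhoR y x (rhoR z y c) = rhoR z x c" by (simp add: rhoR_def restrict_restrict inf_absorb2)
qed (auto simp: leR_def)

text \<open>Supplies the sections over single edges with which sections obtained by lifting are
  compared.\<close>

lemma sec_coh:
  assumes ls: "local_system Y leR FibR rhoR" and h: "continuous_on T h" "h ` T \<subseteq> Y"
    and B: "cell B" "coh B s" "h ` T \<subseteq> \<Inter>B"
  shows "local_system.sec Y leR FibR rhoR T h (\<lambda>t. restrict s (VC (R (h t))))"
proof -
  interpret local_system Y leR FibR rhoR by (rule ls)
  show ?thesis
    unfolding sec_def
  proof (intro ballI conjI)
    fix t assume t: "t \<in> T"
    then show "h t \<in> Y" using h by blast
    have "B \<subseteq> R (h t)" using t B(3) Inter_iff_R[OF B(1)] by blast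
    then show "restrict s (VC (R (h t))) \<in> FibR (h t)" using restrict_FibR coh_mono B(2) by blast
    obtain U where U: "open U" "t \<in> U" "\<And>t'. t' \<in> T \<Longrightarrow> t' \<in> U \<Longrightarrow> leR (h t') (h t)"
      by (rule nbhd_le[OF h t \<open>h t \<in> Y\<close> le_refl[OF \<open>h t \<in> Y\<close>]]) blast
    have "leR (h t') (h t) \<and> rhoR (h t') (h t) (restrict s (VC (R (h t')))) = restrict s (VC (R (h t)))"
      if "t' \<in> T \<inter> U" for t'
    proof -
      have l: "leR (h t') (h t)" using U(3) that by blast
      then have "VC (R (h t)) \<subseteq> VC (R (h t'))" using VC_mono by (simp add: leR_def)
      then show ?thesis using l by (simp add: rhoR_def restrict_restrict inf_absorb2)
    qed
    then show "\<exists>U. open U \<and> t \<in> U \<and> (\<forall>t'\<in>T \<inter> U. leR (h t') (h t) \<and>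
        rhoR (h t') (h t) (restrict s (VC (R (h t')))) = restrict s (VC (R (h t))))"
      using U(1,2) by blast
  qed
qed

lemma cell_connected: "cell A \<Longrightarrow> connected (\<Inter>A)"
proof -
  assume A: "cell A"
  then obtain k where "is_ball k (\<Inter>A)" using cell_dim[of A "n + j - card A"] cell_card_le[OF A] by (auto simp: cell_def)
  then have "path_connected (\<Inter>A)" unfolding path_connected_def by (metis is_ball_path_connected)
  then show ?thesis by (rule path_connected_imp_connected)
qed

text \<open>A section on the boundary sphere has to be turned into a coherent coloring of the
  vertices. Over an edge it agrees with the coherent coloring of that edge having the same value at
  one end, because the edge is connected.\<close>

lemma good_higher_cell:
  assumes A: "cell A" "card A + 3 \<le> n + j"
    and IH: "\<And>B. cell B \<Longrightarrow> card A < card B \<Longrightarrow> good B"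
  shows "good A"
  unfolding good_def
proof (intro ballI)
  fix u c assume u: "u \<in> VC A" "c \<in> Col u"
  obtain k f g where h: "homeomorphism (std_ball k) (\<Inter>A) f g" "k + card A = n + j"
     "f ` std_sphere k = {x \<in> \<Inter>A. R x \<noteq> A}"
    using A(1) unfolding cell_def by (elim conjE) (rule cell_ball)
  have fg: "continuous_on (std_ball k) f" "continuous_on (\<Inter>A) g" "g ` (\<Inter>A) = std_ball k"
    "\<And>x. x \<in> \<Inter>A \<Longrightarrow> f (g x) = x" "\<And>p. p \<in> std_ball k \<Longrightarrow> g (f p) = p"
    using h(1) by (auto simp: homeomorphism_def)
  define Y where "Y = {x \<in> \<Inter>A. R x \<noteq> A}"
  have YM: "Y \<subseteq> M" using cell_subset_M[OF A(1)] by (auto simp: Y_def)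
  have gY: "good (R x)" if "x \<in> Y" for x
    using that IH[of "R x"] cell_R[of x] YM R_psubset_card[OF A(1), of x] by (auto simp: Y_def)
  have ls: "local_system Y leR FibR rhoR" by (rule local_system_cells[OF YM gY])
  interpret local_system Y leR FibR rhoR by (rule ls)
  have gsph: "g x \<in> std_sphere k" if "x \<in> Y" for x
  proof -
    obtain p where p: "p \<in> std_sphere k" "x = f p" using h(3) \<open>x \<in> Y\<close> unfolding Y_def by blast
    then show ?thesis using fg(5) std_sphere_subset_ball by (metis subsetD)
  qed
  have VY: "w \<in> Y" "VC (R w) = {w}" if "w \<in> VC A" for w
    using that A(2) VC_vertex by (auto simp: VC_def V_def Y_def)
  have triv: "trivial_over (std_sphere k) f"
  proof (rule trivial_over_std_sphere)
    show "3 \<le> k" using h(2) A(2) by simp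
    show "continuous_on (std_sphere k) f" using continuous_on_subset[OF fg(1) std_sphere_subset_ball] .
    show "f ` std_sphere k \<subseteq> Y" using h(3) by (simp add: Y_def)
  qed
  have fgw: "f (g w) = w" if "w \<in> Y" for w using that fg(4) by (simp add: Y_def)
  have coh_u: "coh (R u) (\<lambda>_. c)"
  proof -
    show ?thesis using VY(2)[OF u(1)] u(2) by (auto simp: coh_def)
  qed
  have "restrict (\<lambda>_. c) (VC (R u)) \<in> FibR (f (g u))"
    using restrict_FibR[OF coh_u] fgw[OF VY(1)[OF u(1)]] by simp
  then obtain S where S: "sec (std_sphere k) f S" "S (g u) = restrict (\<lambda>_. c) (VC (R u))"
    using triv gsph[OF VY(1)[OF u(1)]] unfolding trivial_over_def by blast
  \<comment> \<open>The smallest cell at a vertex \<open>w\<close> has \<open>w\<close> as its only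
    vertex, so an element of the stalk there amounts to one coloring.\<close>
  define s where "s w = S (g w) w" for w
  have SF: "S (g w) \<in> FibR w" if "w \<in> VC A" for w
    using sec_fib[OF S(1) gsph[OF VY(1)[OF that]]] fgw[OF VY(1)[OF that]] by simp
  have "coh A s"
    unfolding coh_def
  proof (intro conjI ballI, goal_cases)
    case (1 w)
    then have "coh (R w) (S (g w))" "w \<in> VC (R w)" using SF VY(2) by (auto simp: FibR_def)
    then show ?case using cohD(1) by (simp add: s_def)
  next
    case (2 p)
    then obtain a b where p: "p = (a, b)" "(a, b) \<in> arel A" by (cases p) auto
    have ab: "a \<in> VC A" "b \<in> VC A" "adj a b" using arel_VC[OF p(2)] p(2) by (auto simp: arel_def)
    let ?E = "R a \<inter> R b"
    have cE: "cell ?E" "Suc (card ?E) = n + j" using adj_cell ab(3) by (auto simp: adj_def)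
    have AE: "A \<subseteq> ?E" using ab Inter_iff_R[OF A(1)] by (auto simp: VC_def)
    have EY: "\<Inter>?E \<subseteq> Y"
    proof
      fix x assume x: "x \<in> \<Inter>?E"
      then have "?E \<subseteq> R x" using Inter_iff_R[OF cE(1)] by blast
      then have "card ?E \<le> card (R x)" using card_mono[OF finite_R] by blast
      then have "R x \<noteq> A" using cE(2) A(2) by auto
      then show "x \<in> Y" using x AE by (auto simp: Y_def)
    qed
    have EV: "a \<in> VC ?E" "b \<in> VC ?E" using adj_edge_VC[OF ab(3)] by blast+
    have arE: "(a, b) \<in> arel ?E" using EV ab(3) by (auto simp: arel_def VC_def)
    have "s a \<in> Col a" using cohD(1)[of "R a" "S (g a)" a] SF[OF ab(1)] VY(2)[OF ab(1)] by (auto simp: s_def FibR_def)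
    then obtain sE where sE: "coh ?E sE" "sE a = s a"
      using good_edge[OF cE] EV(1) unfolding good_def by blast
    have 1: "sec (\<Inter>?E) (\<lambda>x. x) (\<lambda>x. restrict sE (VC (R x)))"
      by (rule sec_coh[OF ls _ _ cE(1) sE(1)]) (use EY in auto)
    have "sec (\<Inter>?E) (\<lambda>x. f (g x)) (\<lambda>x. S (g x))"
    proof (rule sec_compose[OF S(1)])
      have "\<Inter>?E \<subseteq> \<Inter>A" using AE by blast
      then show "continuous_on (\<Inter>?E) g" using continuous_on_subset[OF fg(2)] by blast
      show "g ` \<Inter>?E \<subseteq> std_sphere k" using gsph EY by blast
    qed
    then have 2: "sec (\<Inter>?E) (\<lambda>x. x) (\<lambda>x. S (g x))"
      by (rule sec_cong) (use fgw EY in auto)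
    have eqa: "restrict sE (VC (R a)) = S (g a)"
    proof (rule extensionalityI[of _ "VC (R a)"])
      show "S (g a) \<in> extensional (VC (R a))" using SF[OF ab(1)] by (simp add: FibR_def)
      show "restrict sE (VC (R a)) x = S (g a) x" if "x \<in> VC (R a)" for x
        using that VY(2)[OF ab(1)] sE(2) by (simp add: s_def)
    qed simp
    have in_E: "a \<in> \<Inter>?E" "b \<in> \<Inter>?E" using EV by (auto simp: VC_def)
    have "restrict sE (VC (R b)) = S (g b)"
      using sec_unique[OF cell_connected[OF cE(1)] 1 2 in_E(1) eqa in_E(2)] .
    then have "sE b = s b" using VY(2)[OF ab(2)] by (auto simp: s_def dest: fun_cong[of _ _ b])
    then show ?case using p(1) sE(2) cohD(2)[OF sE(1) arE] by auto
  qed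
  moreover have "s u = c" using S(2) VY(2)[OF u(1)] by (simp add: s_def)
  ultimately show "\<exists>s. coh A s \<and> s u = c" by blast
qed

lemma all_good: "cell A \<Longrightarrow> good A"
proof (induction "n + j - card A" arbitrary: A rule: less_induct)
  case less
  consider "card A = n + j" | "Suc (card A) = n + j" | "card A + 2 = n + j" | "card A + 3 \<le> n + j"
    using cell_card_le[OF less(2)] by linarith
  then show ?case
  proof cases
    case 4
    show ?thesis
    proof (rule good_higher_cell[OF less(2) 4])
      fix B assume "cell B" "card A < card B"
      then show "good B" using less(1)[of B] cell_card_le[of B] 4 by simp
    qed
  qed (use less(2) good_full good_edge good_two_cell in blast)+
qed

lemma local_system_M: "local_system M leR FibR rhoR"
  using local_system_cells[of M] all_good cell_R by blast

end

section \<open>Edge paths\<close>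

text \<open>The homotopy is the linear one in the parameter interval, carried over by
  \<open>\<gamma>\<close>.\<close>

lemma homotopic_paths_compose_interval:
  fixes \<gamma> :: "real \<Rightarrow> 'a::topological_space" and p q :: "real \<Rightarrow> real"
  assumes "path \<gamma>" "path_image \<gamma> \<subseteq> S" "path p" "path q" "path_image p \<subseteq> {0..1}" "path_image q \<subseteq> {0..1}"
    "pathstart p = pathstart q" "pathfinish p = pathfinish q"
  shows "homotopic_paths S (\<gamma> \<circ> p) (\<gamma> \<circ> q)"
proof (rule homotopic_paths_continuous_image)
  show "homotopic_paths {0..1} p q"
  proof (rule homotopic_paths_linear)
    fix t :: real assume "t \<in> {0..1}"
    then have "p t \<in> {0..1}" "q t \<in> {0..1}" using assms(5,6) unfolding path_image_def by blast+
    then show "closed_segment (p t) (q t) \<subseteq> {0..1}" by (intro closed_segment_subset) auto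
  qed (use assms in auto)
  show "continuous_on {0..1} \<gamma>" using assms(1) by (simp add: path_def)
  show "\<gamma> \<in> {0..1} \<rightarrow> S" using assms(2) by (auto simp: path_image_def)
qed

lemma joinpaths_compose: "f \<circ> (p +++ q) = (f \<circ> p) +++ (f \<circ> q)"
  by (auto simp: joinpaths_def)

lemma path_image_linepath_unit:
  fixes a b :: real
  assumes "a \<in> {0..1}" "b \<in> {0..1}" shows "path_image (linepath a b) \<subseteq> {0..1}"
  using assms by (simp add: closed_segment_subset)

lemma path_image_linepath_join_unit:
  fixes a b c :: real
  assumes "a \<in> {0..1}" "b \<in> {0..1}" "c \<in> {0..1}"
  shows "path_image (linepath a b +++ linepath b c) \<subseteq> {0..1}"
  by (intro subset_path_image_join path_image_linepath_unit assms)

lemma compose_linepath_0_1: "\<gamma> \<circ> linepath 0 (1::real) = \<gamma>"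
  by (auto simp: linepath_def)

lemma compose_linepath_const: "\<gamma> \<circ> linepath a (a::real) = (\<lambda>_. \<gamma> a)"
  by (auto simp: linepath_def algebra_simps)

lemma homotopic_paths_const_join:
  fixes \<gamma> :: "real \<Rightarrow> 'a::topological_space"
  assumes "path \<gamma>" "path_image \<gamma> \<subseteq> S" "pathstart \<gamma> = x"
  shows "homotopic_paths S ((\<lambda>_. x) +++ \<gamma>) \<gamma>"
proof -
  have "homotopic_paths S (\<gamma> \<circ> (linepath 0 0 +++ linepath 0 1)) (\<gamma> \<circ> linepath 0 1)"
    by (intro homotopic_paths_compose_interval[OF assms(1,2)] path_image_linepath_join_unit
        path_image_linepath_unit) (auto intro!: path_join_imp)
  then show ?thesis
    using assms(3) by (simp add: joinpaths_compose compose_linepath_0_1 compose_linepath_const pathstart_def)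
qed

lemma homotopic_paths_join_const:
  fixes \<gamma> :: "real \<Rightarrow> 'a::topological_space"
  assumes "path \<gamma>" "path_image \<gamma> \<subseteq> S" "pathfinish \<gamma> = x"
  shows "homotopic_paths S (\<gamma> +++ (\<lambda>_. x)) \<gamma>"
proof -
  have "homotopic_paths S (\<gamma> \<circ> (linepath 0 1 +++ linepath 1 1)) (\<gamma> \<circ> linepath 0 1)"
    by (intro homotopic_paths_compose_interval[OF assms(1,2)] path_image_linepath_join_unit
        path_image_linepath_unit) (auto intro!: path_join_imp)
  then show ?thesis
    using assms(3) by (simp add: joinpaths_compose compose_linepath_0_1 compose_linepath_const pathfinish_def)
qed

lemma homotopic_paths_square:
  fixes H :: "real \<times> real \<Rightarrow> 'a::topological_space"
  assumes "continuous_on ({0..1} \<times> {0..1}) H" "H ` ({0..1} \<times> {0..1}) \<subseteq> S"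
    "\<And>s. s \<in> {0..1} \<Longrightarrow> H (1, s) = x"
  shows "homotopic_paths S ((\<lambda>s. H (0, s)) +++ (\<lambda>t. H (t, 1))) (\<lambda>t. H (t, 0))"
proof -
  let ?Q = "{0..1::real} \<times> {0..1::real}"
  let ?p = "linepath (0, 0) (0, 1) +++ linepath (0, 1) (1, 1) :: real \<Rightarrow> real \<times> real"
  let ?q = "linepath (0, 0) (1, 0) +++ linepath (1, 0) (1, 1) :: real \<Rightarrow> real \<times> real"
  have Q: "convex ?Q" by (intro convex_Times) auto
  have seg: "closed_segment a b \<subseteq> ?Q" if "a \<in> ?Q" "b \<in> ?Q" for a b
    using that Q by (intro closed_segment_subset)
  have join: "path_image (linepath a b +++ linepath b c) \<subseteq> ?Q" if "a \<in> ?Q" "b \<in> ?Q" "c \<in> ?Q" for a b c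
    using seg[OF that(1,2)] seg[OF that(2,3)] by (intro subset_path_image_join) (simp_all only: path_image_linepath)
  have pQ: "path_image ?p \<subseteq> ?Q" "path_image ?q \<subseteq> ?Q"
    by (rule join; simp)+
  have "homotopic_paths ?Q ?p ?q"
  proof (rule homotopic_paths_linear)
    fix t :: real assume "t \<in> {0..1}"
    then have "?p t \<in> ?Q" "?q t \<in> ?Q" using pQ unfolding path_image_def by blast+
    then show "closed_segment (?p t) (?q t) \<subseteq> ?Q" by (rule seg)
  qed (auto intro!: path_join_imp)
  then have "homotopic_paths S (H \<circ> ?p) (H \<circ> ?q)"
    by (rule homotopic_paths_continuous_image) (use assms in auto)
  then have h: "homotopic_paths S ((H \<circ> linepath (0, 0) (0, 1)) +++ (H \<circ> linepath (0, 1) (1, 1)))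
     ((H \<circ> linepath (0, 0) (1, 0)) +++ (H \<circ> linepath (1, 0) (1, 1)))" by (simp add: joinpaths_compose)
  have l: "H \<circ> linepath (0, 0) (0, 1) = (\<lambda>s. H (0, s))" "H \<circ> linepath (0, 1) (1, 1) = (\<lambda>t. H (t, 1))"
     "H \<circ> linepath (0, 0) (1, 0) = (\<lambda>t. H (t, 0))" "H \<circ> linepath (1, 0) (1, 1) = (\<lambda>s. H (1, s))"
    by (auto simp: linepath_def algebra_simps)
  have h1: "homotopic_paths S ((\<lambda>s. H (0, s)) +++ (\<lambda>t. H (t, 1))) ((\<lambda>t. H (t, 0)) +++ (\<lambda>s. H (1, s)))"
    using h unfolding l .
  have k: "path (\<lambda>t. H (t, 0))" "path_image (\<lambda>t. H (t, 0)) \<subseteq> S"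
    using assms(1,2) by (auto simp: path_def path_image_def intro!: continuous_on_compose2[OF assms(1)] continuous_intros)
  have "homotopic_paths S ((\<lambda>t. H (t, 0)) +++ (\<lambda>s. H (1, s))) ((\<lambda>t. H (t, 0)) +++ (\<lambda>_. x))"
  proof (rule homotopic_paths_eq)
    show "path ((\<lambda>t. H (t, 0)) +++ (\<lambda>s. H (1, s)))" "path_image ((\<lambda>t. H (t, 0)) +++ (\<lambda>s. H (1, s))) \<subseteq> S"
      using homotopic_paths_imp_path[OF h1] homotopic_paths_imp_subset[OF h1] by auto
    show "((\<lambda>t. H (t, 0)) +++ (\<lambda>s. H (1, s))) t = ((\<lambda>t. H (t, 0)) +++ (\<lambda>_. x)) t" if "t \<in> {0..1}" for t
      using that assms(3)[of "2 * t - 1"] by (auto simp: joinpaths_def)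
  qed
  moreover have "homotopic_paths S ((\<lambda>t. H (t, 0)) +++ (\<lambda>_. x)) (\<lambda>t. H (t, 0))"
    by (rule homotopic_paths_join_const[OF k]) (use assms(3)[of 0] in \<open>simp add: pathfinish_def\<close>)
  ultimately show ?thesis using h1 homotopic_paths_trans by blast
qed

section \<open>Transport of colorings along edge paths\<close>

lemma path_transport_append:
  "path_transport n j X (p @ q) c = path_transport n j X q (path_transport n j X p c)"
  by (induction p arbitrary: c) (auto split: prod.split)

context layered_complex
begin

lemma layer_cells_iff: "C \<in> layer_cells n j X \<longleftrightarrow> (\<exists>A. cell A \<and> C = \<Inter>A)"
  unfolding layer_cells_def cell_def hits_def by blast

lemma vertex_iff: "{w} \<in> cells_of_dim 0 (layer_cells n j X) \<longleftrightarrow> w \<in> V"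
proof
  assume "{w} \<in> cells_of_dim 0 (layer_cells n j X)"
  then obtain A where A: "cell A" "{w} = \<Inter>A" "is_ball 0 (\<Inter>A)" by (auto simp: cells_of_dim_def layer_cells_iff)
  have "card A = n + j" using cell_dim[of A 0] A by (simp add: cell_def)
  then show "w \<in> V" using cell_full(2)[OF A(1)] A(2) by blast
next
  assume w: "w \<in> V"
  then have c: "cell (R w)" "card (R w) = n + j" using cell_R by (auto simp: V_def)
  then have "is_ball 0 (\<Inter>(R w))" using cell_dim[of "R w" 0] by (simp add: cell_def)
  moreover have "\<Inter>(R w) \<in> layer_cells n j X" using c(1) layer_cells_iff by blast
  ultimately show "{w} \<in> cells_of_dim 0 (layer_cells n j X)"
    using vertex_cell[OF w] by (simp add: cells_of_dim_def)
qed

lemma edge_cell_iff: "e \<in> cells_of_dim 1 (layer_cells n j X) \<longleftrightarrow> (\<exists>E. cell E \<and> Suc (card E) = n + j \<and> e = \<Inter>E)"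
proof -
  have "is_ball 1 (\<Inter>E) \<longleftrightarrow> Suc (card E) = n + j" if "cell E" for E
    using cell_dim[of E 1] that by (simp add: cell_def)
  then show ?thesis by (auto simp: cells_of_dim_def layer_cells_iff)
qed

text \<open>Translates edge paths into adjacency: by \<open>edge_structure\<close> an edge is the
  cell of the regions common to its two ends.\<close>

lemma edge_path_Cons_iff:
  "edge_path n j X a ((e, u) # p) w \<longleftrightarrow> adj a u \<and> e = \<Inter>(R a \<inter> R u) \<and> edge_path n j X u p w"
proof -
  have "a \<in> V \<and> u \<in> V \<and> (\<exists>E. cell E \<and> Suc (card E) = n + j \<and> e = \<Inter>E) \<and> a \<in> e \<and> u \<in> e \<and> a \<noteq> u \<longleftrightarrow>
     adj a u \<and> e = \<Inter>(R a \<inter> R u)" (is "?l \<longleftrightarrow> ?r")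
  proof
    assume l: ?l
    then obtain E where E: "cell E" "Suc (card E) = n + j" "e = \<Inter>E" by blast
    obtain u' w' where e: "VC E = {u', w'}" "adj u' w'" "E = R u' \<inter> R w'" by (rule edge_structure[OF E(1,2)]) blast
    have "a \<in> VC E" "u \<in> VC E" "a \<noteq> u" using l E(3) by (auto simp: VC_def)
    then have "a = u' \<and> u = w' \<or> a = w' \<and> u = u'" using e(1) by auto
    then show ?r using e E(3) adj_sym by (auto simp: Int_commute)
  next
    assume r: ?r
    then show ?l using adj_cell[of a u] mem_Inter_R by (auto simp: adj_def)
  qed
  then show ?thesis unfolding edge_path.simps vertex_iff edge_cell_iff by blast
qed

lemma edge_path_Nil_iff: "edge_path n j X a [] w \<longleftrightarrow> a \<in> V \<and> a = w"
  by (simp add: vertex_iff)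

lemmas [simp del] = edge_path.simps
lemmas edge_path_iff = edge_path_Nil_iff edge_path_Cons_iff

lemma edge_path_append:
  "edge_path n j X a p u \<Longrightarrow> edge_path n j X u q w \<Longrightarrow> edge_path n j X a (p @ q) w"
  by (induction p arbitrary: a) (auto simp: edge_path_iff)

text \<open>Tested at an interior point of the edge, which lies only in the common regions.\<close>

lemma edge_superset: "adj a u \<Longrightarrow> r \<in> Rg \<Longrightarrow> \<Inter>(R a \<inter> R u) \<subseteq> r \<longleftrightarrow> r \<in> R a \<inter> R u"
proof
  assume a: "adj a u" and r: "r \<in> Rg" and s: "\<Inter>(R a \<inter> R u) \<subseteq> r"
  obtain x where x: "x \<in> \<Inter>(R a \<inter> R u)" "R x = R a \<inter> R u"
    using adj_cell[OF a] unfolding cell_def by (elim conjE) (rule cell_interior_point)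
  then have "r \<in> R x" using r s by (auto simp: regions_at_def)
  then show "r \<in> R a \<inter> R u" using x(2) by simp
qed blast

text \<open>Characterizes the transported coloring, so that its definition by \<open>THE\<close> is
  evaluated only here. \<open>c\<close> need not be extensional, since the initial coloring may be
  arbitrary off the base vertex.\<close>

lemma edge_transport_eq:
  assumes a: "adj a u" and c: "bij_betw c (R a) {1..n + j}"
    and c': "c' \<in> Col u" "\<And>r. r \<in> R a \<Longrightarrow> r \<in> R u \<Longrightarrow> c r = c' r"
  shows "edge_transport n j X (\<Inter>(R a \<inter> R u)) u c = c'"
proof (rule extensionalityI[of _ "R u"])
  show "edge_transport n j X (\<Inter>(R a \<inter> R u)) u c \<in> extensional (R u)" by (simp add: edge_transport_def)
  show "c' \<in> extensional (R u)" using c'(1) by (simp add: Col_def)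
  let ?E = "R a \<inter> R u"
  fix r assume r: "r \<in> R u"
  have rg: "r \<in> Rg" using r R_subset by blast
  have sup: "{s \<in> Rg. \<Inter>?E \<subseteq> s} = ?E" using edge_superset[OF a] R_subset by blast
  show "edge_transport n j X (\<Inter>?E) u c r = c' r"
  proof (cases "r \<in> ?E")
    case True
    then show ?thesis using edge_superset[OF a rg] r c'(2) by (simp add: edge_transport_def)
  next
    case False
    have b: "bij_betw c' (R u) {1..n + j}" using c'(1) by (simp add: Col_def)
    have "card (R u - ?E) = card (R u) - card ?E" using finite_R by (intro card_Diff_subset) auto
    moreover have "card (R u) = n + j" "Suc (card ?E) = n + j" using a by (simp_all add: adj_def V_def)
    ultimately have "card (R u - ?E) = 1" by linarith
    then obtain q where q: "R u - ?E = {q}" using card_1_singletonE by blast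
    moreover have "r \<in> R u - ?E" using r False by blast
    ultimately have "R u - ?E = {r}" by simp
    then have Ru: "R u = insert r ?E" by blast
    have "c ` ?E = c' ` ?E" using c'(2) by (intro image_cong) auto
    moreover have "{1..n + j} - c' ` ?E = {c' r}"
    proof -
      have img: "c' ` R u = {1..n + j}" and inj: "inj_on c' (R u)" using b by (auto simp: bij_betw_def)
      have "c' ` R u - c' ` ?E = c' ` (R u - ?E)" using inj_on_image_set_diff[OF inj, of "R u" ?E] by auto
      then show ?thesis using img \<open>R u - ?E = {r}\<close> by simp
    qed
    ultimately have "{1..n + j} - c ` {s \<in> Rg. \<Inter>?E \<subseteq> s} = {c' r}" using sup by simp
    then have "(THE k. k \<in> {1..n + j} - c ` {s \<in> Rg. \<Inter>?E \<subseteq> s}) = c' r" by simp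
    then show ?thesis using r False edge_superset[OF a rg] by (simp add: edge_transport_def)
  qed
qed

lemma bij_restrict_Col: "bij_betw c (R a) {1..n + j} \<longleftrightarrow> restrict c (R a) \<in> Col a"
  using bij_betw_cong[of "R a" c "restrict c (R a)"] by (simp add: Col_def)

lemma edge_transport_Col:
  assumes a: "adj a u" and c: "bij_betw c (R a) {1..n + j}"
  shows "edge_transport n j X (\<Inter>(R a \<inter> R u)) u c \<in> Col u"
    and "r \<in> R a \<Longrightarrow> r \<in> R u \<Longrightarrow> edge_transport n j X (\<Inter>(R a \<inter> R u)) u c r = c r"
proof -
  obtain c' where c': "c' \<in> Col u" "\<And>r. r \<in> R a \<Longrightarrow> r \<in> R u \<Longrightarrow> restrict c (R a) r = c' r"
    using Col_transport[OF a] c bij_restrict_Col by metis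
  then have "edge_transport n j X (\<Inter>(R a \<inter> R u)) u c = c'" by (intro edge_transport_eq[OF a c]) auto
  then show "edge_transport n j X (\<Inter>(R a \<inter> R u)) u c \<in> Col u"
    "r \<in> R a \<Longrightarrow> r \<in> R u \<Longrightarrow> edge_transport n j X (\<Inter>(R a \<inter> R u)) u c r = c r"
    using c' by auto
qed

lemma path_transport_Col:
  "edge_path n j X a p w \<Longrightarrow> c \<in> Col a \<Longrightarrow> path_transport n j X p c \<in> Col w"
proof (induction p arbitrary: a c)
  case (Cons eu p)
  obtain e u where eu: "eu = (e, u)" by (cases eu)
  have a: "adj a u" "e = \<Inter>(R a \<inter> R u)" "edge_path n j X u p w" using Cons(2) eu by (auto simp: edge_path_iff)
  have "edge_transport n j X e u c \<in> Col u" using edge_transport_Col(1)[OF a(1), of c] a(2) Cons(3) by (simp add: Col_def)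
  then show ?case using Cons(1)[OF a(3)] eu by simp
qed (auto simp: edge_path_iff)

lemma path_transport_rename:
  assumes "\<sigma> permutes {1..n + j}"
  shows "edge_path n j X a p w \<Longrightarrow> c \<in> Col a \<Longrightarrow>
    path_transport n j X p (restrict (\<sigma> \<circ> c) (R a)) = restrict (\<sigma> \<circ> path_transport n j X p c) (R w)"
proof (induction p arbitrary: a c)
  case (Cons eu p)
  obtain e u where eu: "eu = (e, u)" by (cases eu)
  have a: "adj a u" "e = \<Inter>(R a \<inter> R u)" "edge_path n j X u p w" using Cons(2) eu by (auto simp: edge_path_iff)
  have bc: "bij_betw c (R a) {1..n + j}" using Cons(3) by (simp add: Col_def)
  let ?c1 = "edge_transport n j X e u c"
  have c1: "?c1 \<in> Col u" "\<And>r. r \<in> R a \<Longrightarrow> r \<in> R u \<Longrightarrow> ?c1 r = c r"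
    using edge_transport_Col[OF a(1) bc] a(2) by auto
  have ren: "bij_betw (restrict (\<sigma> \<circ> d) (R x)) (R x) {1..n + j}" if "bij_betw d (R x) {1..n + j}" for d x
  proof -
    have "bij_betw (\<sigma> \<circ> d) (R x) {1..n + j}" using that permutes_imp_bij[OF assms] by (rule bij_betw_trans)
    then show ?thesis using bij_restrict_Col by (simp add: Col_def)
  qed
  have "edge_transport n j X e u (restrict (\<sigma> \<circ> c) (R a)) = restrict (\<sigma> \<circ> ?c1) (R u)"
    unfolding a(2)
  proof (rule edge_transport_eq[OF a(1) ren[OF bc]])
    show "restrict (\<sigma> \<circ> edge_transport n j X (\<Inter>(R a \<inter> R u)) u c) (R u) \<in> Col u"
      using ren[of ?c1 u] c1(1) a(2) by (simp add: Col_def)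
  qed (use c1(2) a(2) in auto)
  then show ?case unfolding eu path_transport.simps using Cons(1)[OF a(3) c1(1)] by (simp only:)
qed (auto simp: edge_path_iff)

section \<open>Transport as monodromy of the sheaf\<close>

lemma traverses_path:
  "edge_path n j X a p w \<Longrightarrow> traverses \<gamma> a p \<Longrightarrow>
     path \<gamma> \<and> path_image \<gamma> \<subseteq> M \<and> pathstart \<gamma> = a \<and> pathfinish \<gamma> = w"
proof (induction p arbitrary: a \<gamma>)
  case Nil
  then show ?case by (auto simp: edge_path_iff V_def path_def path_image_def pathstart_def pathfinish_def)
next
  case (Cons eu p)
  obtain e u where eu: "eu = (e, u)" by (cases eu)
  have a: "adj a u" "e = \<Inter>(R a \<inter> R u)" "edge_path n j X u p w" using Cons(2) eu by (auto simp: edge_path_iff)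
  obtain \<alpha> \<beta> where ab: "arc \<alpha>" "path_image \<alpha> = e" "pathstart \<alpha> = a" "pathfinish \<alpha> = u"
       "traverses \<beta> u p" "\<gamma> = \<alpha> +++ \<beta>" using Cons(3) eu by auto
  have b: "path \<beta> \<and> path_image \<beta> \<subseteq> M \<and> pathstart \<beta> = u \<and> pathfinish \<beta> = w" using Cons(1)[OF a(3) ab(5)] .
  have "e \<subseteq> M" using cell_subset_M[OF adj_cell[OF a(1)]] a(2) by simp
  then show ?case using ab b by (auto simp: arc_imp_path path_image_join)
qed

text \<open>The element of the stalk at a vertex that corresponds to a coloring.\<close>

definition vert :: "'a \<Rightarrow> ('a set \<Rightarrow> nat) \<Rightarrow> 'a \<Rightarrow> 'a set \<Rightarrow> nat" where
  "vert w c = restrict (\<lambda>_. c) {w}"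

lemma vert_FibR: "w \<in> V \<Longrightarrow> c \<in> Col w \<Longrightarrow> vert w c \<in> FibR w"
  using restrict_FibR[of w "\<lambda>_. c"] VC_vertex[of w] by (auto simp: vert_def coh_def)

text \<open>Over each edge the section comes from the coherent coloring of that edge, whose value at
  the far end is the transported coloring.\<close>

lemma traverses_sec:
  "edge_path n j X a p w \<Longrightarrow> traverses \<gamma> a p \<Longrightarrow> c \<in> Col a \<Longrightarrow>
     \<exists>s. local_system.sec M leR FibR rhoR {0..1} \<gamma> s \<and> s 0 = vert a c \<and> s 1 = vert w (path_transport n j X p c)"
proof (induction p arbitrary: a \<gamma> c)
  case Nil
  interpret local_system M leR FibR rhoR by (rule local_system_M)
  have "a \<in> V" "a \<in> M" "w = a" "\<gamma> = (\<lambda>_. a)" using Nil by (auto simp: edge_path_iff V_def)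
  then show ?case using sec_const[OF \<open>a \<in> M\<close> vert_FibR] Nil(3) by (intro exI[of _ "\<lambda>_. vert a c"]) auto
next
  case (Cons eu p)
  interpret local_system M leR FibR rhoR by (rule local_system_M)
  obtain e u where eu: "eu = (e, u)" by (cases eu)
  have a: "adj a u" "e = \<Inter>(R a \<inter> R u)" "edge_path n j X u p w" using Cons(2) eu by (auto simp: edge_path_iff)
  obtain \<alpha> \<beta> where ab: "arc \<alpha>" "path_image \<alpha> = e" "pathstart \<alpha> = a" "pathfinish \<alpha> = u"
       "traverses \<beta> u p" "\<gamma> = \<alpha> +++ \<beta>" using Cons(3) eu by auto
  let ?E = "R a \<inter> R u"
  have cE: "cell ?E" "Suc (card ?E) = n + j" "a \<in> V" "u \<in> V" using adj_cell a(1) by (auto simp: adj_def)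
  have VE: "VC ?E = {a, u}" using adj_edge_VC[OF a(1)] .
  obtain sE where sE: "coh ?E sE" "sE a = c"
    using all_good[OF cE(1)] Cons(4) VE unfolding good_def by blast
  have arE: "(a, u) \<in> arel ?E" using a(1) VE by (auto simp: arel_def VC_def)
  let ?c1 = "edge_transport n j X e u c"
  have bc: "bij_betw c (R a) {1..n + j}" using Cons(4) by (simp add: Col_def)
  have sEu: "sE u \<in> Col u" using cohD(1)[OF sE(1)] VE by blast
  then have c1: "?c1 = sE u" unfolding a(2)
    by (intro edge_transport_eq[OF a(1) bc]) (use cohD(2)[OF sE(1) arE] sE(2) in auto)
  have eM: "e \<subseteq> M" using cell_subset_M[OF cE(1)] a(2) by simp
  have sec1: "sec {0..1} \<alpha> (\<lambda>t. restrict sE (VC (R (\<alpha> t))))"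
  proof (rule sec_coh[OF local_system_M _ _ cE(1) sE(1)])
    show "continuous_on {0..1} \<alpha>" using arc_imp_path[OF ab(1)] by (simp add: path_def)
    show "\<alpha> ` {0..1} \<subseteq> M" "\<alpha> ` {0..1} \<subseteq> \<Inter>?E" using ab(2) eM a(2) by (auto simp: path_image_def)
  qed
  obtain s where s: "sec {0..1} \<beta> s" "s 0 = vert u ?c1" "s 1 = vert w (path_transport n j X p ?c1)"
    using Cons(1)[OF a(3) ab(5)] c1 sEu by metis
  have ends: "\<alpha> 0 = a" "\<alpha> 1 = u" using ab(3,4) by (auto simp: pathstart_def pathfinish_def)
  have v1: "restrict sE (VC (R u)) = vert u ?c1" "restrict sE (VC (R a)) = vert a c"
    using VC_vertex[OF cE(4)] VC_vertex[OF cE(3)] c1 sE(2) by (auto simp: vert_def restrict_def)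
  have fin: "pathfinish \<alpha> = pathstart \<beta>" using ab(4) traverses_path[OF a(3) ab(5)] by simp
  have mid: "restrict sE (VC (R (\<alpha> 1))) = s 0" unfolding ends s(2) by (rule v1(1))
  let ?s = "\<lambda>t. if t \<le> 1/2 then restrict sE (VC (R (\<alpha> (2 * t)))) else s (2 * t - 1)"
  have "sec {0..1} \<gamma> ?s" unfolding ab(6) by (rule sec_joinpaths[OF sec1 s(1) mid fin])
  moreover have "?s 0 = vert a c" using v1(2) ends by simp
  moreover have "?s 1 = vert w (path_transport n j X (eu # p) c)" using s(3) eu by simp
  ultimately show ?case by blast
qed

lemma path_transport_homotopic:
  assumes "edge_path n j X a p w" "traverses \<gamma> a p" "edge_path n j X a q w" "traverses \<gamma>' a q"
    "homotopic_paths M \<gamma> \<gamma>'" "c \<in> Col a"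
  shows "path_transport n j X p c = path_transport n j X q c"
proof -
  interpret local_system M leR FibR rhoR by (rule local_system_M)
  obtain s where s: "sec {0..1} \<gamma> s" "s 0 = vert a c" "s 1 = vert w (path_transport n j X p c)"
    using traverses_sec[OF assms(1,2,6)] by blast
  obtain s' where s': "sec {0..1} \<gamma>' s'" "s' 0 = vert a c" "s' 1 = vert w (path_transport n j X q c)"
    using traverses_sec[OF assms(3,4,6)] by blast
  have "vert w (path_transport n j X p c) = vert w (path_transport n j X q c)"
    using sec_homotopic_paths[OF assms(5) s(1) s'(1)] s s' by simp
  from fun_cong[OF this, of w] show ?thesis by (simp add: vert_def)
qed

section \<open>Deforming paths into edge paths\<close>

lemma traverses_append:
  assumes "edge_path n j X u q w" "traverses \<gamma>' u q" "path_image \<gamma>' \<subseteq> S"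
  shows "edge_path n j X a p u \<Longrightarrow> traverses \<gamma> a p \<Longrightarrow> path_image \<gamma> \<subseteq> S \<Longrightarrow>
     \<exists>\<tau>. traverses \<tau> a (p @ q) \<and> homotopic_paths S (\<gamma> +++ \<gamma>') \<tau>"
proof (induction p arbitrary: a \<gamma>)
  case Nil
  have "homotopic_paths S ((\<lambda>_. u) +++ \<gamma>') \<gamma>'"
    using traverses_path[OF assms(1,2)] assms(3) by (intro homotopic_paths_const_join) auto
  then show ?case using Nil assms(2) by (auto simp: edge_path_iff)
next
  case (Cons ey p)
  obtain e y where ey: "ey = (e, y)" by (cases ey)
  have a: "adj a y" "e = \<Inter>(R a \<inter> R y)" "edge_path n j X y p u" using Cons(2) ey by (auto simp: edge_path_iff)
  obtain \<alpha> \<beta> where ab: "arc \<alpha>" "path_image \<alpha> = e" "pathstart \<alpha> = a" "pathfinish \<alpha> = y"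
       "traverses \<beta> y p" "\<gamma> = \<alpha> +++ \<beta>" using Cons(3) ey by auto
  have b: "path \<beta>" "pathstart \<beta> = y" "pathfinish \<beta> = u" using traverses_path[OF a(3) ab(5)] by auto
  have g': "path \<gamma>'" "pathstart \<gamma>' = u" using traverses_path[OF assms(1,2)] by auto
  have S: "path_image \<alpha> \<subseteq> S" "path_image \<beta> \<subseteq> S" using Cons(4) ab b by (auto simp: path_image_join)
  obtain \<tau> where t: "traverses \<tau> y (p @ q)" "homotopic_paths S (\<beta> +++ \<gamma>') \<tau>"
    using Cons(1)[OF a(3) ab(5) S(2)] by blast
  have pa: "path \<alpha>" using arc_imp_path[OF ab(1)] .
  have "homotopic_paths S ((\<alpha> +++ \<beta>) +++ \<gamma>') (\<alpha> +++ (\<beta> +++ \<gamma>'))"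
    using pa b g' S assms(3) ab(4) by (intro homotopic_paths_sym[OF homotopic_paths_assoc]) auto
  also have "homotopic_paths S (\<alpha> +++ (\<beta> +++ \<gamma>')) (\<alpha> +++ \<tau>)"
    using pa S t(2) ab(4) b by - (rule homotopic_paths_join, auto)
  finally have "homotopic_paths S (\<gamma> +++ \<gamma>') (\<alpha> +++ \<tau>)" using ab(6) by simp
  moreover have "traverses (\<alpha> +++ \<tau>) a ((ey # p) @ q)" using ab t(1) ey by auto
  ultimately show ?case by blast
qed

lemma edge_path_in_cell:
  assumes A: "cell A" and uw: "u \<in> VC A" "w \<in> VC A"
  obtains p \<tau> where "edge_path n j X u p w" "traverses \<tau> u p" "path_image \<tau> \<subseteq> \<Inter>A"
proof -
  have "(u, w) \<in> (arel A)\<^sup>*" using vertices_connected[OF assms] .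
  then have "\<exists>p \<tau>. edge_path n j X u p w \<and> traverses \<tau> u p \<and> path_image \<tau> \<subseteq> \<Inter>A"
  proof (induction rule: converse_rtrancl_induct)
    case base
    have "edge_path n j X w [] w" using uw(2) by (auto simp: edge_path_iff VC_def)
    moreover have "traverses (\<lambda>_. w) w []" by simp
    moreover have "path_image (\<lambda>_::real. w) \<subseteq> \<Inter>A" using uw(2) by (auto simp: path_image_def VC_def)
    ultimately show ?case by blast
  next
    case (step y z)
    then obtain p \<tau> where p: "edge_path n j X z p w" "traverses \<tau> z p" "path_image \<tau> \<subseteq> \<Inter>A" by blast
    have yz: "adj y z" "y \<in> \<Inter>A" "z \<in> \<Inter>A" using step(1) by (auto simp: arel_def)
    let ?E = "R y \<inter> R z"
    have cE: "cell ?E" "Suc (card ?E) = n + j" using adj_cell yz(1) by (auto simp: adj_def)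
    obtain u' w' f g where e: "u' \<noteq> w'" "VC ?E = {u', w'}"
      "homeomorphism (std_ball 1) (\<Inter>?E) f g" "f ` std_sphere 1 = {u', w'}"
      by (rule edge_structure[OF cE]) blast
    have "f ` std_sphere 1 = {y, z}" using e(2,4) adj_edge_VC[OF yz(1)] by simp
    then obtain \<alpha> where \<alpha>: "arc \<alpha>" "path_image \<alpha> = \<Inter>?E" "pathstart \<alpha> = y" "pathfinish \<alpha> = z"
      by (rule std_ball_1_arc[OF e(3)])
    have "A \<subseteq> ?E" using yz Inter_iff_R[OF A] by blast
    then have "path_image \<alpha> \<subseteq> \<Inter>A" using \<alpha>(2) by blast
    then have "path_image (\<alpha> +++ \<tau>) \<subseteq> \<Inter>A" using p(3) by (intro subset_path_image_join)
    moreover have "edge_path n j X y ((\<Inter>?E, z) # p) w" using yz(1) p(1) by (simp add: edge_path_iff)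
    moreover have "traverses (\<alpha> +++ \<tau>) y ((\<Inter>?E, z) # p)" using \<alpha> p(2) by auto
    ultimately show ?case by blast
  qed
  then show thesis using that by blast
qed

lemma cell_is_ball: "cell A \<Longrightarrow> is_ball (n + j - card A) (\<Inter>A)"
  using cell_dim[of A "n + j - card A"] cell_card_le[of A] by (simp add: cell_def)

lemma homotopic_in_cell:
  assumes "cell A" "\<Inter>A \<subseteq> S" "path p" "path q" "path_image p \<subseteq> \<Inter>A" "path_image q \<subseteq> \<Inter>A"
    "pathstart p = pathstart q" "pathfinish p = pathfinish q"
  shows "homotopic_paths S p q"
  using is_ball_homotopic_paths[OF cell_is_ball[OF assms(1)] assms(3-8)] assms(2) homotopic_paths_subset by blast

text \<open>The condition on \<open>S\<close> makes it a union of closed cells; the cases needed are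
  \<open>M\<close> and the 1-skeleton. To subdivide by \<open>Bolzano\<close>, the claim is extended
  to pieces with arbitrary ends: an end \<open>y\<close> is tied to a vertex \<open>wt y\<close> by
  a path \<open>\<delta> y\<close> inside the smallest cell containing \<open>y\<close>.\<close>

lemma edge_path_approximation:
  assumes S: "S \<subseteq> M" "\<And>y. y \<in> S \<Longrightarrow> \<Inter>(R y) \<subseteq> S"
    and \<gamma>: "path \<gamma>" "path_image \<gamma> \<subseteq> S" "pathstart \<gamma> \<in> V" "pathfinish \<gamma> \<in> V"
  obtains p \<tau> where "edge_path n j X (pathstart \<gamma>) p (pathfinish \<gamma>)" "traverses \<tau> (pathstart \<gamma>) p"
    "homotopic_paths S \<gamma> \<tau>"
proof -
  have cR: "cell (R y)" "\<Inter>(R y) \<subseteq> S" if "y \<in> S" for y using that S cell_R by blast+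
  have "\<exists>w \<delta>. w \<in> VC (R y) \<and> path \<delta> \<and> path_image \<delta> \<subseteq> \<Inter>(R y) \<and> pathstart \<delta> = y \<and> pathfinish \<delta> = w"
    if y: "y \<in> S" for y
  proof -
    obtain w where w: "w \<in> VC (R y)" using VC_nonempty[OF cR(1)[OF y]] by blast
    then have "w \<in> \<Inter>(R y)" by (simp add: VC_def)
    then obtain \<delta> where "path \<delta>" "path_image \<delta> \<subseteq> \<Inter>(R y)" "pathstart \<delta> = y" "pathfinish \<delta> = w"
      by (rule is_ball_path_connected[OF cell_is_ball[OF cR(1)[OF y]] mem_Inter_R])
    then show ?thesis using w by blast
  qed
  then obtain wt \<delta> where \<delta>: "\<And>y. y \<in> S \<Longrightarrow> wt y \<in> VC (R y)" "\<And>y. y \<in> S \<Longrightarrow> path (\<delta> y)"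
    "\<And>y. y \<in> S \<Longrightarrow> path_image (\<delta> y) \<subseteq> \<Inter>(R y)" "\<And>y. y \<in> S \<Longrightarrow> pathstart (\<delta> y) = y"
    "\<And>y. y \<in> S \<Longrightarrow> pathfinish (\<delta> y) = wt y" by metis
  have \<delta>S: "path_image (\<delta> y) \<subseteq> S" if "y \<in> S" for y using \<delta>(3) cR(2) that by blast
  define sub where "sub a b = \<gamma> \<circ> linepath a b" for a b :: real
  have \<gamma>S: "\<gamma> t \<in> S" if "t \<in> {0..1}" for t using that \<gamma>(2) by (auto simp: path_image_def)
  have \<gamma>c: "continuous_on {0..1} \<gamma>" using \<gamma>(1) by (simp add: path_def)
  have sub: "path (sub a b)" "path_image (sub a b) \<subseteq> S" "pathstart (sub a b) = \<gamma> a" "pathfinish (sub a b) = \<gamma> b"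
    if "a \<in> {0..1}" "b \<in> {0..1}" for a b
  proof -
    have l: "linepath a b ` {0..1} \<subseteq> {0..1}" using path_image_linepath_unit[OF that] by (simp add: path_image_def)
    show "path (sub a b)" unfolding sub_def path_def
      by (rule continuous_on_compose) (auto intro: continuous_on_subset[OF \<gamma>c l])
    show "path_image (sub a b) \<subseteq> S" using l \<gamma>S by (auto simp: sub_def path_image_def)
    show "pathstart (sub a b) = \<gamma> a" "pathfinish (sub a b) = \<gamma> b" by (auto simp: sub_def pathstart_def pathfinish_def linepath_def)
  qed
  \<comment> \<open>the piece of \<open>\<gamma>\<close> over \<open>[a, b]\<close> is homotopic to an edge path up to the connecting paths \<open>\<delta>\<close>\<close>
  define P where "P a b \<longleftrightarrow> (a \<in> {0..1} \<longrightarrow> b \<in> {0..1} \<longrightarrow>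
     (\<exists>p \<tau>. edge_path n j X (wt (\<gamma> a)) p (wt (\<gamma> b)) \<and> traverses \<tau> (wt (\<gamma> a)) p \<and> path_image \<tau> \<subseteq> S \<and>
       homotopic_paths S (sub a b +++ \<delta> (\<gamma> b)) (\<delta> (\<gamma> a) +++ \<tau>)))" for a b
  have "(0::real) \<le> 1" by simp
  then have "P 0 1"
  proof (induction rule: Bolzano)
    case (trans a b c)
    show ?case unfolding P_def
    proof (intro impI)
      assume ac: "a \<in> {0..1}" "c \<in> {0..1}"
      then have b: "b \<in> {0..1}" using trans(3,4) by auto
      obtain p \<tau> where p: "edge_path n j X (wt (\<gamma> a)) p (wt (\<gamma> b))" "traverses \<tau> (wt (\<gamma> a)) p" "path_image \<tau> \<subseteq> S"
         "homotopic_paths S (sub a b +++ \<delta> (\<gamma> b)) (\<delta> (\<gamma> a) +++ \<tau>)"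
        using trans(1) ac b unfolding P_def by blast
      obtain q \<tau>' where q: "edge_path n j X (wt (\<gamma> b)) q (wt (\<gamma> c))" "traverses \<tau>' (wt (\<gamma> b)) q" "path_image \<tau>' \<subseteq> S"
         "homotopic_paths S (sub b c +++ \<delta> (\<gamma> c)) (\<delta> (\<gamma> b) +++ \<tau>')"
        using trans(2) ac b unfolding P_def by blast
      note tp = traverses_path[OF p(1,2)] traverses_path[OF q(1,2)]
      note S3 = \<gamma>S[OF ac(1)] \<gamma>S[OF b] \<gamma>S[OF ac(2)]
      note facts = sub[OF ac(1) b] sub[OF b ac(2)] \<delta>(2,4,5)[OF S3(1)] \<delta>(2,4,5)[OF S3(2)] \<delta>(2,4,5)[OF S3(3)]
        \<delta>S[OF S3(1)] \<delta>S[OF S3(2)] \<delta>S[OF S3(3)] p(3) q(3)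
      obtain \<tau>2 where t2: "traverses \<tau>2 (wt (\<gamma> a)) (p @ q)" "homotopic_paths S (\<tau> +++ \<tau>') \<tau>2"
        using traverses_append[OF q(1,2,3) p(1,2,3)] by blast
      have "homotopic_paths S (\<gamma> \<circ> linepath a c) (\<gamma> \<circ> (linepath a b +++ linepath b c))"
        by (intro homotopic_paths_compose_interval[OF \<gamma>(1,2)] path_image_linepath_join_unit
          path_image_linepath_unit ac b) (auto intro!: path_join_imp)
      then have "homotopic_paths S (sub a c) (sub a b +++ sub b c)" by (simp add: sub_def joinpaths_compose)
      then have "homotopic_paths S (sub a c +++ \<delta> (\<gamma> c)) ((sub a b +++ sub b c) +++ \<delta> (\<gamma> c))"
        using facts sub[OF ac] by - (rule homotopic_paths_join, auto)
      also have "homotopic_paths S ((sub a b +++ sub b c) +++ \<delta> (\<gamma> c)) (sub a b +++ (sub b c +++ \<delta> (\<gamma> c)))"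
        using facts by (intro homotopic_paths_sym[OF homotopic_paths_assoc]) auto
      also have "homotopic_paths S (sub a b +++ (sub b c +++ \<delta> (\<gamma> c))) (sub a b +++ (\<delta> (\<gamma> b) +++ \<tau>'))"
        using facts q(4) by - (rule homotopic_paths_join, auto)
      also have "homotopic_paths S (sub a b +++ (\<delta> (\<gamma> b) +++ \<tau>')) ((sub a b +++ \<delta> (\<gamma> b)) +++ \<tau>')"
        using facts tp by (intro homotopic_paths_assoc) auto
      also have "homotopic_paths S ((sub a b +++ \<delta> (\<gamma> b)) +++ \<tau>') ((\<delta> (\<gamma> a) +++ \<tau>) +++ \<tau>')"
        using facts tp p(4) by - (rule homotopic_paths_join, auto)
      also have "homotopic_paths S ((\<delta> (\<gamma> a) +++ \<tau>) +++ \<tau>') (\<delta> (\<gamma> a) +++ (\<tau> +++ \<tau>'))"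
        using facts tp by (intro homotopic_paths_sym[OF homotopic_paths_assoc]) auto
      also have "homotopic_paths S (\<delta> (\<gamma> a) +++ (\<tau> +++ \<tau>')) (\<delta> (\<gamma> a) +++ \<tau>2)"
        using facts tp t2 by - (rule homotopic_paths_join, auto)
      finally have "homotopic_paths S (sub a c +++ \<delta> (\<gamma> c)) (\<delta> (\<gamma> a) +++ \<tau>2)" .
      moreover have "edge_path n j X (wt (\<gamma> a)) (p @ q) (wt (\<gamma> c))" using edge_path_append p(1) q(1) by blast
      moreover have "path_image \<tau>2 \<subseteq> S" using homotopic_paths_imp_subset[OF t2(2)] by blast
      ultimately show "\<exists>p \<tau>. edge_path n j X (wt (\<gamma> a)) p (wt (\<gamma> c)) \<and> traverses \<tau> (wt (\<gamma> a)) p \<and> path_image \<tau> \<subseteq> S \<and>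
       homotopic_paths S (sub a c +++ \<delta> (\<gamma> c)) (\<delta> (\<gamma> a) +++ \<tau>)" using t2(1) by blast
    qed
  next
    case (local t0)
    then have t0: "t0 \<in> {0..1}" by simp
    define x where "x = \<gamma> t0"
    have xS: "x \<in> S" using \<gamma>S[OF t0] by (simp add: x_def)
    obtain W and K :: "real \<times> 'a \<Rightarrow> 'a" where W: "openin (top_of_set M) W" "x \<in> W" "continuous_on ({0..1} \<times> W) K"
      "\<And>u. u \<in> W \<Longrightarrow> K (0, u) = u" "\<And>u. u \<in> W \<Longrightarrow> K (1, u) = x"
      "\<And>t u. u \<in> W \<Longrightarrow> 0 \<le> t \<Longrightarrow> t < 1 \<Longrightarrow> R (K (t, u)) = R u" "\<And>u. u \<in> W \<Longrightarrow> R u \<subseteq> R x"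
      by (rule local_contraction[OF subsetD[OF S(1) xS]]) blast
    obtain T where T: "open T" "W = M \<inter> T" using W(1) by (auto simp: openin_open)
    have "\<gamma> t0 \<in> T" using W(2) T(2) by (simp add: x_def)
    then obtain B where B: "open B" "t0 \<in> B" "\<forall>t\<in>{0..1}. t \<in> B \<longrightarrow> \<gamma> t \<in> T"
      using \<gamma>c t0 T(1) unfolding continuous_on_topological by metis
    then obtain d where d: "d > 0" "\<And>t. \<bar>t - t0\<bar> < d \<Longrightarrow> t \<in> B" unfolding open_real by metis
    have "P a b" if ab: "a \<le> t0" "t0 \<le> b" "b - a < d" for a b
      unfolding P_def
    proof (intro impI)
      assume a: "a \<in> {0..1}" and b: "b \<in> {0..1}"
      have lin: "linepath a b s \<in> {0..1}" "linepath a b s \<in> {a..b}" if "s \<in> {0..1}" for s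
      proof -
        have "linepath a b s \<in> closed_segment a b" using that path_image_linepath[of a b] unfolding path_image_def by blast
        then show "linepath a b s \<in> {a..b}" using ab by (simp add: closed_segment_eq_real_ivl)
        then show "linepath a b s \<in> {0..1}" using a b by auto
      qed
      have inW: "\<gamma> t \<in> W \<inter> S" if "t \<in> {a..b}" for t
      proof -
        have "t \<in> {0..1}" "\<bar>t - t0\<bar> < d" using that ab a b by auto
        then show ?thesis using B(3) d(2) \<gamma>S S(1) T(2) by blast
      qed
      \<comment> \<open>The contraction moves \<open>u\<close> within its smallest cell, which also
        contains the final point \<open>x\<close> because \<open>R u \<subseteq> R x\<close>. So it
        never leaves \<open>S\<close>.\<close>
      have KS: "K (t, u) \<in> S" "K (t, u) \<in> \<Inter>(R u)" if "u \<in> W \<inter> S" "t \<in> {0..1}" for t u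
      proof -
        show "K (t, u) \<in> \<Inter>(R u)"
        proof (cases "t = 1")
          case True
          then show ?thesis using W(5,7) that Inter_iff_R[OF cR(1), of u x] by auto
        next
          case False
          then have "R (K (t, u)) = R u" using W(6) that by auto
          then show ?thesis using mem_Inter_R[of "K (t, u)"] by simp
        qed
        then show "K (t, u) \<in> S" using cR(2) that by blast
      qed
      define y z where "y = \<gamma> a" and "z = \<gamma> b"
      have yz: "y \<in> W \<inter> S" "z \<in> W \<inter> S" using inW ab by (auto simp: y_def z_def)
      then have yzS: "y \<in> S" "z \<in> S" by blast+
      have sub_yz: "R y \<subseteq> R x" "R z \<subseteq> R x" using W(7) yz by blast+
      define k where "k u t = K (t, u)" for u t
      have k: "path (k u)" "path_image (k u) \<subseteq> \<Inter>(R u)" "path_image (k u) \<subseteq> S" "pathstart (k u) = u" "pathfinish (k u) = x"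
        if "u \<in> W \<inter> S" for u
      proof -
        show "path (k u)" unfolding path_def k_def
          by (rule continuous_on_compose2[OF W(3)]) (use that in \<open>auto intro!: continuous_intros\<close>)
        show "path_image (k u) \<subseteq> \<Inter>(R u)" "path_image (k u) \<subseteq> S" using KS[OF that] by (auto simp: path_image_def k_def)
        show "pathstart (k u) = u" "pathfinish (k u) = x" using W(4,5) that by (auto simp: pathstart_def pathfinish_def k_def)
      qed
      \<comment> \<open>The square contracts the piece of \<open>\<gamma>\<close> to
        \<open>x\<close> and thus trades it for the tracks of its two ends.\<close>
      let ?H = "\<lambda>zz. K (fst zz, \<gamma> (linepath a b (snd zz)))"
      have lc: "continuous_on UNIV (linepath a b)" by (rule continuous_on_linepath)
      have "continuous_on ({0..1} \<times> {0..1}) (\<lambda>zz::real\<times>real. linepath a b (snd zz))"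
        by (rule continuous_on_compose2[OF lc]) (auto intro!: continuous_intros)
      then have "continuous_on ({0..1} \<times> {0..1}) (\<lambda>zz::real\<times>real. \<gamma> (linepath a b (snd zz)))"
        by (rule continuous_on_compose2[OF \<gamma>c]) (use lin in auto)
      then have cH: "continuous_on ({0..1} \<times> {0..1}) ?H"
        by (intro continuous_on_compose2[OF W(3)] continuous_intros) (use lin inW in auto)
      have HS: "?H ` ({0..1} \<times> {0..1}) \<subseteq> S" using KS(1) lin inW by auto
      have H1: "?H (1, s) = x" if "s \<in> {0..1}" for s using W(5) inW lin(2)[OF that] by auto
      have sq: "homotopic_paths S ((\<lambda>s. ?H (0, s)) +++ (\<lambda>t. ?H (t, 1))) (\<lambda>t. ?H (t, 0))"
        by (rule homotopic_paths_square[OF cH HS H1])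
      have e1: "(\<lambda>t. ?H (t, 1)) = k z" "(\<lambda>t. ?H (t, 0)) = k y" by (auto simp: k_def y_def z_def linepath_def)
      note sb = sub[OF a b]
      have "homotopic_paths S (sub a b +++ k z) ((\<lambda>s. ?H (0, s)) +++ k z)"
      proof (rule homotopic_paths_join)
        show "homotopic_paths S (sub a b) (\<lambda>s. ?H (0, s))"
          by (rule homotopic_paths_eq[OF sb(1,2)]) (use W(4) inW lin in \<open>auto simp: sub_def\<close>)
        show "homotopic_paths S (k z) (k z)" using k[OF yz(2)] by auto
        show "pathfinish (sub a b) = pathstart (k z)" using sb(4) k(4)[OF yz(2)] by (simp add: z_def)
      qed
      then have sq': "homotopic_paths S (sub a b +++ k z) (k y)" using sq unfolding e1 by (rule homotopic_paths_trans)
      \<comment> \<open>Both \<open>x\<close> and its vertex \<open>wt x\<close> lie in the smallest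
        cells of \<open>y\<close> and of \<open>z\<close>. The remaining comparisons take place
        inside these two balls, where paths with equal ends are homotopic.\<close>
      have wx: "wt x \<in> VC (R y)" "wt x \<in> VC (R z)" using \<delta>(1)[OF xS] VC_mono[OF sub_yz(1)] VC_mono[OF sub_yz(2)] by blast+
      have Ix: "\<Inter>(R x) \<subseteq> \<Inter>(R y)" "\<Inter>(R x) \<subseteq> \<Inter>(R z)" using sub_yz by blast+
      obtain p1 \<tau>1 where p1: "edge_path n j X (wt y) p1 (wt x)" "traverses \<tau>1 (wt y) p1" "path_image \<tau>1 \<subseteq> \<Inter>(R y)"
        by (rule edge_path_in_cell[OF cR(1)[OF yzS(1)] \<delta>(1)[OF yzS(1)] wx(1)])
      obtain p2 \<tau>2 where p2: "edge_path n j X (wt x) p2 (wt z)" "traverses \<tau>2 (wt x) p2" "path_image \<tau>2 \<subseteq> \<Inter>(R z)"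
        by (rule edge_path_in_cell[OF cR(1)[OF yzS(2)] wx(2) \<delta>(1)[OF yzS(2)]])
      note tp = traverses_path[OF p1(1,2)] traverses_path[OF p2(1,2)]
      have t12S: "path_image \<tau>1 \<subseteq> S" "path_image \<tau>2 \<subseteq> S" using p1(3) p2(3) cR(2) yzS by blast+
      have xyz: "path_image (\<delta> x) \<subseteq> \<Inter>(R y)" "path_image (\<delta> x) \<subseteq> \<Inter>(R z)" using \<delta>(3)[OF xS] Ix by blast+
      obtain \<tau>3 where t3: "traverses \<tau>3 (wt y) (p1 @ p2)" "homotopic_paths S (\<tau>1 +++ \<tau>2) \<tau>3"
        using traverses_append[OF p2(1,2) t12S(2) p1(1,2) t12S(1)] by blast
      note ky = k[OF yz(1)] note kz = k[OF yz(2)]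
      note dx = \<delta>(2,4,5)[OF xS] \<delta>S[OF xS] note dy = \<delta>(2,3,4,5)[OF yzS(1)] \<delta>S[OF yzS(1)]
      note dz = \<delta>(2,3,4,5)[OF yzS(2)] \<delta>S[OF yzS(2)]
      have im: "path_image (k z +++ (\<delta> x +++ \<tau>2)) \<subseteq> \<Inter>(R z)" "path_image (k y +++ \<delta> x) \<subseteq> \<Inter>(R y)"
          "path_image (\<delta> y +++ \<tau>1) \<subseteq> \<Inter>(R y)" "path_image (\<delta> x +++ \<tau>2) \<subseteq> S"
        by (intro subset_path_image_join ky(2) kz(2) xyz dy(2) p1(3) p2(3) dx(4) t12S)+
      have "homotopic_paths S (\<delta> z) (k z +++ (\<delta> x +++ \<tau>2))"
        by (rule homotopic_in_cell[OF cR[OF yzS(2)] _ _ dz(2) im(1)]) (use dz dx kz tp in simp_all)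
      then have "homotopic_paths S (sub a b +++ \<delta> z) (sub a b +++ (k z +++ (\<delta> x +++ \<tau>2)))"
        using sb dz by - (rule homotopic_paths_join, (auto simp: z_def))
      also have "homotopic_paths S (sub a b +++ (k z +++ (\<delta> x +++ \<tau>2))) ((sub a b +++ k z) +++ (\<delta> x +++ \<tau>2))"
        using sb kz dx tp im(4) by (intro homotopic_paths_assoc) (auto simp: z_def)
      also have "homotopic_paths S ((sub a b +++ k z) +++ (\<delta> x +++ \<tau>2)) (k y +++ (\<delta> x +++ \<tau>2))"
        using sq' dx kz tp im(4) by - (rule homotopic_paths_join, auto)
      also have "homotopic_paths S (k y +++ (\<delta> x +++ \<tau>2)) ((k y +++ \<delta> x) +++ \<tau>2)"
        using ky dx tp t12S by (intro homotopic_paths_assoc) auto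
      also have "homotopic_paths S ((k y +++ \<delta> x) +++ \<tau>2) ((\<delta> y +++ \<tau>1) +++ \<tau>2)"
      proof (rule homotopic_paths_join)
        show "homotopic_paths S (k y +++ \<delta> x) (\<delta> y +++ \<tau>1)"
          by (rule homotopic_in_cell[OF cR[OF yzS(1)] _ _ im(2,3)]) (use dy dx ky tp in simp_all)
      qed (use tp t12S dx in auto)
      also have "homotopic_paths S ((\<delta> y +++ \<tau>1) +++ \<tau>2) (\<delta> y +++ (\<tau>1 +++ \<tau>2))"
        using dy tp t12S by (intro homotopic_paths_sym[OF homotopic_paths_assoc]) auto
      also have "homotopic_paths S (\<delta> y +++ (\<tau>1 +++ \<tau>2)) (\<delta> y +++ \<tau>3)"
        using dy tp t3 by - (rule homotopic_paths_join, auto)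
      finally have "homotopic_paths S (sub a b +++ \<delta> z) (\<delta> y +++ \<tau>3)" .
      moreover have "edge_path n j X (wt y) (p1 @ p2) (wt z)" using edge_path_append p1(1) p2(1) by blast
      moreover have "path_image \<tau>3 \<subseteq> S" using homotopic_paths_imp_subset[OF t3(2)] by blast
      ultimately show "\<exists>p \<tau>. edge_path n j X (wt (\<gamma> a)) p (wt (\<gamma> b)) \<and> traverses \<tau> (wt (\<gamma> a)) p \<and> path_image \<tau> \<subseteq> S \<and>
       homotopic_paths S (sub a b +++ \<delta> (\<gamma> b)) (\<delta> (\<gamma> a) +++ \<tau>)" using t3(1) unfolding y_def z_def by blast
    qed
    then show ?case using d(1) by blast
  qed
  then obtain p \<tau> where p: "edge_path n j X (wt (\<gamma> 0)) p (wt (\<gamma> 1))" "traverses \<tau> (wt (\<gamma> 0)) p" "path_image \<tau> \<subseteq> S"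
       "homotopic_paths S (sub 0 1 +++ \<delta> (\<gamma> 1)) (\<delta> (\<gamma> 0) +++ \<tau>)" unfolding P_def by auto
  have ends: "pathstart \<gamma> = \<gamma> 0" "pathfinish \<gamma> = \<gamma> 1" by (auto simp: pathstart_def pathfinish_def)
  \<comment> \<open>The smallest cell at a vertex is a point, so the connecting paths at both ends
    of \<open>\<gamma>\<close> disappear.\<close>
  have vtx: "wt y = y" "homotopic_paths S (\<delta> y) (\<lambda>_. y)" if y: "y \<in> S" "y \<in> V" for y
  proof -
    show "wt y = y" using \<delta>(1)[OF y(1)] VC_vertex[OF y(2)] by blast
    show "homotopic_paths S (\<delta> y) (\<lambda>_. y)"
    proof (rule homotopic_paths_eq[OF \<delta>(2)[OF y(1)] \<delta>S[OF y(1)]])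
      fix t :: real assume "t \<in> {0..1}"
      then have "\<delta> y t \<in> {y}" using \<delta>(3)[OF y(1)] vertex_cell[OF y(2)] unfolding path_image_def by blast
      then show "\<delta> y t = y" by simp
    qed
  qed
  have S01: "\<gamma> 0 \<in> S" "\<gamma> 1 \<in> S" "\<gamma> 0 \<in> V" "\<gamma> 1 \<in> V" using \<gamma>S \<gamma>(3,4) ends by auto
  note v0 = vtx[OF S01(1,3)] note v1 = vtx[OF S01(2,4)]
  have s01: "sub 0 1 = \<gamma>" by (simp add: sub_def compose_linepath_0_1)
  note tp = traverses_path[OF p(1,2)]
  have "homotopic_paths S \<gamma> (\<gamma> +++ (\<lambda>_. \<gamma> 1))"
    using \<gamma> ends by (intro homotopic_paths_sym[OF homotopic_paths_join_const]) auto
  also have "homotopic_paths S (\<gamma> +++ (\<lambda>_. \<gamma> 1)) (\<gamma> +++ \<delta> (\<gamma> 1))"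
    using \<gamma> ends v1(2) by (intro homotopic_paths_join homotopic_paths_sym[OF v1(2)]) (auto simp: pathstart_def)
  also have "homotopic_paths S (\<gamma> +++ \<delta> (\<gamma> 1)) (\<delta> (\<gamma> 0) +++ \<tau>)" using p(4) s01 by simp
  also have "homotopic_paths S (\<delta> (\<gamma> 0) +++ \<tau>) ((\<lambda>_. \<gamma> 0) +++ \<tau>)"
    using v0 tp p(3) \<delta>(5)[OF S01(1)] by - (rule homotopic_paths_join, auto)
  also have "homotopic_paths S ((\<lambda>_. \<gamma> 0) +++ \<tau>) \<tau>"
    using tp p(3) v0(1) by (intro homotopic_paths_const_join) auto
  finally have "homotopic_paths S \<gamma> \<tau>" .
  then show thesis using that[of p \<tau>] p(1,2) v0(1) v1(1) ends by simp
qed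

end

section \<open>The holonomy homomorphism\<close>

lemma loop_class_eq: "homotopic_paths S p q \<Longrightarrow> loop_class S p = loop_class S q"
  unfolding loop_class_def using homotopic_paths_trans homotopic_paths_sym by blast

lemma inclusion_hom_loop_class:
  assumes "S \<subseteq> M" "path p" "path_image p \<subseteq> S"
  shows "inclusion_hom M (loop_class S p) = loop_class M p"
proof -
  have "loop_class M q = loop_class M p" if "q \<in> loop_class S p" for q
    using that assms(1) homotopic_paths_subset homotopic_paths_sym unfolding loop_class_def[of S]
    by (intro loop_class_eq) blast
  moreover have "p \<in> loop_class S p" using assms by (simp add: loop_class_def)
  ultimately show ?thesis unfolding inclusion_hom_def by blast
qed

text \<open>The product is a union over all representatives, and every member of this union is the
  same class.\<close>

lemma fundamental_group_mult:
  assumes "path p" "path_image p \<subseteq> S" "path q" "path_image q \<subseteq> S" "pathfinish p = pathstart q"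
  shows "loop_class S p \<otimes>\<^bsub>fundamental_group S x\<^esub> loop_class S q = loop_class S (p +++ q)"
proof -
  have eq: "loop_class S (p' +++ q') = loop_class S (p +++ q)" if "p' \<in> loop_class S p" "q' \<in> loop_class S q" for p' q'
    using homotopic_paths_join[of S p p' q q'] that assms(5) loop_class_eq by (metis loop_class_def mem_Collect_eq)
  have ne: "p \<in> loop_class S p" "q \<in> loop_class S q" using assms by (simp_all add: loop_class_def)
  have "(\<Union>p'\<in>loop_class S p. \<Union>q'\<in>loop_class S q. loop_class S (p' +++ q')) =
      (\<Union>p'\<in>loop_class S p. \<Union>q'\<in>loop_class S q. loop_class S (p +++ q))"
    by (intro SUP_cong refl eq)
  also have "\<dots> = loop_class S (p +++ q)" using ne by blast
  finally show ?thesis by (simp add: fundamental_group_def)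
qed

section \<open>Permutations of closed edge paths\<close>

locale colored_complex = layered_complex +
  fixes col :: "'a set \<Rightarrow> nat"
  assumes col: "bij_betw col (R v) {1..n + j}"
begin

abbreviation c0 :: "'a set \<Rightarrow> nat" where "c0 \<equiv> restrict col (R v)"
abbreviation perm :: "('a set \<times> 'a) list \<Rightarrow> nat \<Rightarrow> nat" where "perm \<equiv> edge_path_perm n j X v col"

lemma vV: "v \<in> V"
  using vM card_v by (simp add: V_def)

lemma c0_Col: "c0 \<in> Col v"
  using col bij_restrict_Col by blast

text \<open>The first edge already makes the coloring extensional; only the empty path retains the
  values of \<open>col\<close> off \<open>R v\<close>.\<close>

lemma path_transport_restrict:
  assumes "edge_path n j X v p w" "r \<in> R w"
  shows "path_transport n j X p col r = path_transport n j X p c0 r"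
proof (cases p)
  case Nil
  then show ?thesis using assms by (simp add: edge_path_iff)
next
  case (Cons eu q)
  obtain e u where eu: "eu = (e, u)" by (cases eu)
  have a: "adj v u" "e = \<Inter>(R v \<inter> R u)" using assms(1) Cons eu by (auto simp: edge_path_iff)
  have "edge_transport n j X e u c0 = edge_transport n j X e u col"
    unfolding a(2)
  proof (rule edge_transport_eq[OF a(1)])
    show "bij_betw c0 (R v) {1..n + j}" using c0_Col by (simp add: Col_def)
    show "edge_transport n j X (\<Inter>(R v \<inter> R u)) u col \<in> Col u" by (rule edge_transport_Col(1)[OF a(1) col])
    show "c0 r = edge_transport n j X (\<Inter>(R v \<inter> R u)) u col r" if "r \<in> R v" "r \<in> R u" for r
      using edge_transport_Col(2)[OF a(1) col that] that(1) by simp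
  qed
  then show ?thesis using Cons eu by simp
qed

lemma perm_on:
  assumes p: "edge_path n j X v p v" and r: "r \<in> R v"
  shows "perm p (c0 r) = path_transport n j X p c0 r"
proof -
  have "inv_into (R v) col (col r) = r" using col r by (simp add: bij_betw_def)
  moreover have "col r \<in> {1..n + j}" using col r by (rule bij_betw_apply)
  ultimately show ?thesis
    using path_transport_restrict[OF p r] r unfolding edge_path_perm_def by simp
qed

lemma c0_image: "k \<in> {1..n + j} \<Longrightarrow> \<exists>r\<in>R v. k = c0 r"
  using c0_Col unfolding Col_def bij_betw_def by blast

lemma perm_permutes:
  assumes p: "edge_path n j X v p v"
  shows "perm p permutes {1..n + j}"
proof (rule bij_imp_permutes)
  have c: "bij_betw (path_transport n j X p c0) (R v) {1..n + j}" "bij_betw c0 (R v) {1..n + j}"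
    using path_transport_Col[OF p c0_Col] c0_Col by (auto simp: Col_def)
  have "bij_betw (perm p \<circ> c0) (R v) {1..n + j}"
    using c(1) perm_on[OF p] bij_betw_cong[of "R v" "perm p \<circ> c0" "path_transport n j X p c0"] by simp
  then show "bij_betw (perm p) {1..n + j} {1..n + j}" using bij_betw_comp_iff[OF c(2)] by blast
  show "perm p k = k" if "k \<notin> {1..n + j}" for k using that by (auto simp: edge_path_perm_def)
qed

lemma perm_eqI:
  assumes "edge_path n j X v p v" "edge_path n j X v q v"
    "path_transport n j X p c0 = path_transport n j X q c0"
  shows "perm p = perm q"
proof
  fix k
  show "perm p k = perm q k"
  proof (cases "k \<in> {1..n + j}")
    case True
    then obtain r where "r \<in> R v" "k = c0 r" using c0_image by blast
    then show ?thesis using perm_on assms by metis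
  next
    case False
    then show ?thesis by (auto simp: edge_path_perm_def)
  qed
qed

text \<open>After \<open>p\<close> the coloring is the initial one renamed by \<open>perm p\<close>,
  and transport along \<open>q\<close> commutes with this renaming.\<close>

lemma perm_append:
  assumes p: "edge_path n j X v p v" and q: "edge_path n j X v q v"
  shows "perm (p @ q) = perm p \<circ> perm q"
proof
  fix k
  show "perm (p @ q) k = (perm p \<circ> perm q) k"
  proof (cases "k \<in> {1..n + j}")
    case True
    then obtain r where r: "r \<in> R v" "k = c0 r" using c0_image by blast
    have "path_transport n j X p c0 = restrict (perm p \<circ> c0) (R v)"
    proof (rule extensionalityI[of _ "R v"])
      show "path_transport n j X p c0 \<in> extensional (R v)" using path_transport_Col[OF p c0_Col] by (simp add: Col_def)
      show "path_transport n j X p c0 r = restrict (perm p \<circ> c0) (R v) r" if "r \<in> R v" for r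
        using perm_on[OF p that] that by simp
    qed simp
    then have "path_transport n j X (p @ q) c0 = restrict (perm p \<circ> path_transport n j X q c0) (R v)"
      using path_transport_rename[OF perm_permutes[OF p] q c0_Col] by (simp only: path_transport_append)
    then have "path_transport n j X (p @ q) c0 r = perm p (path_transport n j X q c0 r)" using r(1) by simp
    then show ?thesis
      using perm_on[OF edge_path_append[OF p q] r(1)] perm_on[OF q r(1)] r(2) by simp
  next
    case False
    then show ?thesis by (auto simp: edge_path_perm_def)
  qed
qed

text \<open>\<open>skeleton_holonomy\<close> sees a class only as a set of curves, so it can be
  evaluated on classes in any \<open>S\<close>. The value is well defined because homotopies in
  \<open>S\<close> are homotopies in \<open>M\<close>.\<close>

lemma skeleton_holonomy_eq:
  assumes S: "S \<subseteq> M" and p: "edge_path n j X v p v" "traverses \<tau> v p" "\<tau> \<in> loop_class S \<gamma>"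
  shows "skeleton_holonomy n j X v col (loop_class S \<gamma>) = perm p"
  unfolding skeleton_holonomy_def
proof (rule the_equality)
  show "\<exists>p' \<tau>'. edge_path n j X v p' v \<and> traverses \<tau>' v p' \<and> \<tau>' \<in> loop_class S \<gamma> \<and> perm p = perm p'"
    using p by blast
  fix \<sigma> assume "\<exists>p' \<tau>'. edge_path n j X v p' v \<and> traverses \<tau>' v p' \<and> \<tau>' \<in> loop_class S \<gamma> \<and> \<sigma> = perm p'"
  then obtain p' \<tau>' where q: "edge_path n j X v p' v" "traverses \<tau>' v p'" "\<tau>' \<in> loop_class S \<gamma>" "\<sigma> = perm p'" by blast
  have "homotopic_paths S \<tau>' \<tau>"
    using q(3) p(3) homotopic_paths_sym homotopic_paths_trans unfolding loop_class_def by blast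
  then have "homotopic_paths M \<tau>' \<tau>" using homotopic_paths_subset S by blast
  then show "\<sigma> = perm p"
    using perm_eqI[OF q(1) p(1) path_transport_homotopic[OF q(1,2) p(1,2) _ c0_Col]] q(4) by simp
qed

section \<open>Loops in the manifold and in the 1-skeleton\<close>

lemma loop_has_edge_path:
  assumes S: "S \<subseteq> M" "\<And>y. y \<in> S \<Longrightarrow> \<Inter>(R y) \<subseteq> S"
    and a: "a \<in> carrier (fundamental_group S v)"
  obtains p \<tau> where "edge_path n j X v p v" "traverses \<tau> v p" "a = loop_class S \<tau>" "path \<tau>" "path_image \<tau> \<subseteq> S"
    "pathstart \<tau> = v" "pathfinish \<tau> = v" "skeleton_holonomy n j X v col a = perm p"
proof -
  obtain \<gamma> where g: "a = loop_class S \<gamma>" "path \<gamma>" "path_image \<gamma> \<subseteq> S" "pathstart \<gamma> = v" "pathfinish \<gamma> = v"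
    using a by (auto simp: fundamental_group_def)
  obtain p \<tau> where p: "edge_path n j X v p v" "traverses \<tau> v p" "homotopic_paths S \<gamma> \<tau>"
    using edge_path_approximation[OF S g(2,3)] g(4,5) vV by metis
  have a': "a = loop_class S \<tau>" using g(1) loop_class_eq[OF p(3)] by simp
  have t: "path \<tau>" "path_image \<tau> \<subseteq> S" using homotopic_paths_imp_path[OF p(3)] homotopic_paths_imp_subset[OF p(3)] by auto
  have "\<tau> \<in> loop_class S \<tau>" using t by (simp add: loop_class_def)
  then have "skeleton_holonomy n j X v col a = perm p"
    unfolding a' by (rule skeleton_holonomy_eq[OF S(1) p(1,2)])
  then show thesis using that[OF p(1,2) a' t] traverses_path[OF p(1,2)] by simp
qed

lemma Inter_R_subset_M: "y \<in> M \<Longrightarrow> \<Inter>(R y) \<subseteq> M"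
  using cell_subset_M cell_R by blast

lemma one_skeleton_eq: "one_skeleton n j X = \<Union>{\<Inter>A | A. cell A \<and> n + j \<le> Suc (card A)}"
proof -
  have iff: "C \<in> cells_of_dim 0 (layer_cells n j X) \<union> cells_of_dim 1 (layer_cells n j X) \<longleftrightarrow>
     (\<exists>A. C = \<Inter>A \<and> cell A \<and> n + j \<le> Suc (card A))" for C
  proof -
    have "(is_ball 0 (\<Inter>A) \<or> is_ball 1 (\<Inter>A)) \<longleftrightarrow> n + j \<le> Suc (card A)" if "cell A" for A
      using cell_dim[of A 0] cell_dim[of A 1] that cell_card_le[OF that] unfolding cell_def by auto
    then show ?thesis unfolding cells_of_dim_def layer_cells_iff by blast
  qed
  then have "cells_of_dim 0 (layer_cells n j X) \<union> cells_of_dim 1 (layer_cells n j X) =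
      {\<Inter>A | A. cell A \<and> n + j \<le> Suc (card A)}"
    unfolding set_eq_iff mem_Collect_eq by (intro allI)
  then show ?thesis unfolding one_skeleton_def by (simp only:)
qed

lemma one_skeleton_subset: "one_skeleton n j X \<subseteq> M"
  unfolding one_skeleton_eq using cell_subset_M by blast

lemma Inter_R_subset_skeleton:
  assumes "y \<in> one_skeleton n j X"
  shows "\<Inter>(R y) \<subseteq> one_skeleton n j X"
proof -
  obtain A where A: "cell A" "n + j \<le> Suc (card A)" "y \<in> \<Inter>A" using assms unfolding one_skeleton_eq by blast
  have "card A \<le> card (R y)" using Inter_iff_R[OF A(1)] A(3) card_mono[OF finite_R] by blast
  then have "n + j \<le> Suc (card (R y))" using A(2) by linarith
  moreover have "cell (R y)" using cell_R one_skeleton_subset assms by blast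
  ultimately show ?thesis unfolding one_skeleton_eq by blast
qed

lemma holonomy_hom:
  "restrict (skeleton_holonomy n j X v col) (carrier (fundamental_group M v))
     \<in> hom (fundamental_group M v) (sym_group (n + j))" (is "?H \<in> _")
proof (rule homI)
  fix a assume a: "a \<in> carrier (fundamental_group M v)"
  obtain p \<tau> where p: "edge_path n j X v p v" "skeleton_holonomy n j X v col a = perm p"
    by (rule loop_has_edge_path[OF subset_refl Inter_R_subset_M a])
  then show "?H a \<in> carrier (sym_group (n + j))" using a perm_permutes by (simp add: sym_group_carrier)
  fix b assume b: "b \<in> carrier (fundamental_group M v)"
  obtain p \<tau> where p: "edge_path n j X v p v" "traverses \<tau> v p" "a = loop_class M \<tau>" "path \<tau>" "path_image \<tau> \<subseteq> M"
    "pathstart \<tau> = v" "pathfinish \<tau> = v" "skeleton_holonomy n j X v col a = perm p"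
    by (rule loop_has_edge_path[OF subset_refl Inter_R_subset_M a])
  obtain q \<tau>' where q: "edge_path n j X v q v" "traverses \<tau>' v q" "b = loop_class M \<tau>'" "path \<tau>'" "path_image \<tau>' \<subseteq> M"
    "pathstart \<tau>' = v" "pathfinish \<tau>' = v" "skeleton_holonomy n j X v col b = perm q"
    by (rule loop_has_edge_path[OF subset_refl Inter_R_subset_M b])
  have ab: "a \<otimes>\<^bsub>fundamental_group M v\<^esub> b = loop_class M (\<tau> +++ \<tau>')"
    unfolding p(3) q(3) using p q by (intro fundamental_group_mult) auto
  obtain \<tau>2 where t: "traverses \<tau>2 v (p @ q)" "homotopic_paths M (\<tau> +++ \<tau>') \<tau>2"
    using traverses_append[OF q(1,2,5) p(1,2,5)] by blast
  have "skeleton_holonomy n j X v col (loop_class M (\<tau> +++ \<tau>')) = perm (p @ q)"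
    by (rule skeleton_holonomy_eq[OF subset_refl edge_path_append[OF p(1) q(1)] t(1)])
      (use t(2) in \<open>simp add: loop_class_def\<close>)
  moreover have "loop_class M (\<tau> +++ \<tau>') \<in> carrier (fundamental_group M v)"
  proof -
    have "path (\<tau> +++ \<tau>')" "path_image (\<tau> +++ \<tau>') \<subseteq> M" "pathstart (\<tau> +++ \<tau>') = v" "pathfinish (\<tau> +++ \<tau>') = v"
      using p(4,6,7) q(4,6,7) subset_path_image_join[OF p(5) q(5)] by simp_all
    then show ?thesis unfolding fundamental_group_def by auto
  qed
  ultimately show "?H (a \<otimes>\<^bsub>fundamental_group M v\<^esub> b) = ?H a \<otimes>\<^bsub>sym_group (n + j)\<^esub> ?H b"
    using a b ab p(8) q(8) perm_append[OF p(1) q(1)] by (simp add: sym_group_mult)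
qed

lemma edge_loop_in_skeleton:
  "edge_path n j X a p w \<Longrightarrow> traverses \<tau> a p \<Longrightarrow> path_image \<tau> \<subseteq> one_skeleton n j X"
proof (induction p arbitrary: a \<tau>)
  case Nil
  then have a: "a \<in> V" "\<tau> = (\<lambda>_. a)" by (auto simp: edge_path_iff)
  have "cell (R a)" "n + j \<le> Suc (card (R a))" using a(1) cell_R by (auto simp: V_def)
  then have "a \<in> one_skeleton n j X" unfolding one_skeleton_eq using mem_Inter_R by blast
  then show ?case using a(2) by (auto simp: path_image_def)
next
  case (Cons eu p)
  obtain e u where eu: "eu = (e, u)" by (cases eu)
  have a: "adj a u" "e = \<Inter>(R a \<inter> R u)" "edge_path n j X u p w" using Cons(2) eu by (auto simp: edge_path_iff)
  obtain \<alpha> \<beta> where ab: "path_image \<alpha> = e" "traverses \<beta> u p" "\<tau> = \<alpha> +++ \<beta>" using Cons(3) eu by auto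
  have "n + j \<le> Suc (card (R a \<inter> R u))" using a(1) by (simp add: adj_def)
  then have "e \<subseteq> one_skeleton n j X" unfolding one_skeleton_eq a(2) using adj_cell[OF a(1)] by blast
  then have "path_image \<alpha> \<subseteq> one_skeleton n j X" using ab(1) by simp
  then show ?case unfolding ab(3) using Cons(1)[OF a(3) ab(2)] by (rule subset_path_image_join)
qed

lemma skeleton_loop:
  assumes "a \<in> carrier (fundamental_group (one_skeleton n j X) v)"
  shows "inclusion_hom M a \<in> carrier (fundamental_group M v)"
    "skeleton_holonomy n j X v col (inclusion_hom M a) = skeleton_holonomy n j X v col a"
proof -
  obtain p \<tau> where p: "edge_path n j X v p v" "traverses \<tau> v p" "a = loop_class (one_skeleton n j X) \<tau>" "path \<tau>"
    "path_image \<tau> \<subseteq> one_skeleton n j X" "pathstart \<tau> = v" "pathfinish \<tau> = v" "skeleton_holonomy n j X v col a = perm p"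
    by (rule loop_has_edge_path[OF one_skeleton_subset Inter_R_subset_skeleton assms])
  have i: "inclusion_hom M a = loop_class M \<tau>"
    unfolding p(3) by (rule inclusion_hom_loop_class[OF one_skeleton_subset p(4,5)])
  have tM: "path_image \<tau> \<subseteq> M" using p(5) one_skeleton_subset by blast
  then show "inclusion_hom M a \<in> carrier (fundamental_group M v)"
    unfolding i fundamental_group_def using p(4,6,7) by auto
  have "\<tau> \<in> loop_class M \<tau>" using p(4) tM by (simp add: loop_class_def)
  then show "skeleton_holonomy n j X v col (inclusion_hom M a) = skeleton_holonomy n j X v col a"
    unfolding i using skeleton_holonomy_eq[OF subset_refl p(1,2)] p(8) by simp
qed

text \<open>The source of uniqueness: the edge path to which a loop is deformed in \<open>M\<close>
  runs in the 1-skeleton.\<close>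

lemma inclusion_surj:
  assumes "a \<in> carrier (fundamental_group M v)"
  obtains b where "b \<in> carrier (fundamental_group (one_skeleton n j X) v)" "a = inclusion_hom M b"
proof -
  obtain p \<tau> where p: "edge_path n j X v p v" "traverses \<tau> v p" "a = loop_class M \<tau>" "path \<tau>"
    "pathstart \<tau> = v" "pathfinish \<tau> = v"
    by (rule loop_has_edge_path[OF subset_refl Inter_R_subset_M assms])
  have s: "path_image \<tau> \<subseteq> one_skeleton n j X" using edge_loop_in_skeleton[OF p(1,2)] .
  have "loop_class (one_skeleton n j X) \<tau> \<in> carrier (fundamental_group (one_skeleton n j X) v)"
    unfolding fundamental_group_def using p(4-6) s by auto
  moreover have "a = inclusion_hom M (loop_class (one_skeleton n j X) \<tau>)"
    using inclusion_hom_loop_class[OF one_skeleton_subset p(4) s] p(3) by simp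
  ultimately show thesis using that by blast
qed

lemma holonomy_extends_uniquely:
  "\<exists>!H. H \<in> hom (fundamental_group M v) (sym_group (n + j)) \<and>
        H \<in> extensional (carrier (fundamental_group M v)) \<and>
        (\<forall>a\<in>carrier (fundamental_group (one_skeleton n j X) v).
           H (inclusion_hom M a) = skeleton_holonomy n j X v col a)"
proof (rule ex1I)
  let ?H = "restrict (skeleton_holonomy n j X v col) (carrier (fundamental_group M v))"
  show "?H \<in> hom (fundamental_group M v) (sym_group (n + j)) \<and>
        ?H \<in> extensional (carrier (fundamental_group M v)) \<and>
        (\<forall>a\<in>carrier (fundamental_group (one_skeleton n j X) v).
           ?H (inclusion_hom M a) = skeleton_holonomy n j X v col a)"
    using holonomy_hom skeleton_loop by simp
  fix H assume H: "H \<in> hom (fundamental_group M v) (sym_group (n + j)) \<and>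
        H \<in> extensional (carrier (fundamental_group M v)) \<and>
        (\<forall>a\<in>carrier (fundamental_group (one_skeleton n j X) v).
           H (inclusion_hom M a) = skeleton_holonomy n j X v col a)"
  show "H = ?H"
  proof (rule extensionalityI[of _ "carrier (fundamental_group M v)"])
    fix a assume a: "a \<in> carrier (fundamental_group M v)"
    obtain b where b: "b \<in> carrier (fundamental_group (one_skeleton n j X) v)" "a = inclusion_hom M b"
      by (rule inclusion_surj[OF a])
    then show "H a = ?H a" using H a skeleton_loop(2)[OF b(1)] by simp
  qed (use H in auto)
qed

end

text \<open>Base vertex and initial coloring are \<open>v\<close> and \<open>col\<close>. As
  functions are total, \<open>extensional\<close> fixes the values of \<open>H\<close> off the
  carrier, so that uniqueness speaks about the homomorphism itself.\<close>

theorem proposition33: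
  fixes M :: "'a::t2_space set"
    and A :: "('a set \<times> ('a \<Rightarrow> nat \<Rightarrow> real)) set"
    and X :: "nat \<Rightarrow> 'a set set"
    and n j :: nat
    and v :: 'a
    and col :: "'a set \<Rightarrow> nat"
  assumes "closed_smooth_manifold n M A" and "connected M" and "triangulable M"
    and "layer_ecpx n M j X"
    and "{v} \<in> cells_of_dim 0 (layer_cells n j X)"
    and "bij_betw col (regions_at n j X v) {1..n + j}"
  shows "\<exists>!H. H \<in> hom (fundamental_group M v) (sym_group (n + j)) \<and>
              H \<in> extensional (carrier (fundamental_group M v)) \<and>
              (\<forall>a\<in>carrier (fundamental_group (one_skeleton n j X) v).
                 H (inclusion_hom M a) = skeleton_holonomy n j X v col a)"
proof -
  have "v \<in> M"
  proof -
    obtain A where A: "{v} = \<Inter>A" "A \<subseteq> regions n j X" "\<forall>i<j. A \<inter> cells_of_dim n (X i) \<noteq> {}"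
      using assms(5) unfolding cells_of_dim_def layer_cells_def by blast
    have "1 \<le> j" using assms(4) by (simp add: layer_ecpx_def layer_cpx_def)
    then obtain r where r: "r \<in> A" using A(3) by (metis Int_emptyI less_eq_Suc_le One_nat_def)
    then obtain i where i: "i < j" "r \<in> X i" using A(2) by (auto simp: regions_def cells_of_dim_def)
    have "\<Union>(X i) = M" using assms(4) i(1) by (simp add: layer_ecpx_def layer_cpx_def cpx_def cell_complex_on_def)
    then show ?thesis using i(2) r A(1) by blast
  qed
  moreover have "card (regions_at n j X v) = n + j" using bij_betw_same_card[OF assms(6)] by simp
  ultimately interpret colored_complex n j M X v col
    using assms(2,4,6) by unfold_locales
  show ?thesis by (rule holonomy_extends_uniquely)
qed

end
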